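(* Let $f_1, f_2$ be nonlinearizable germs, $f_j(z)=e^{2\pi i\alpha_j}z+O(z^2)$ with $\alpha_j\in\mathbb{R}\setminus\mathbb{Q}$, and let $\phi\in\mathrm{Diff}(\mathbb{C},0)$. Then $\phi\circ f_1\circ\phi^{-1} = f_2$ if and only if the rotation numbers of $f_1$ and $f_2$ are equal (i.e. $f_1'(0)=f_2'(0)$) and $\phi$ (univalent on a neighbourhood of $K_1$) maps some hedgehog $K_1$ of $f_1$ onto a hedgehog $K_2 = \phi(K_1)$ of $f_2$. Consequently, for nonlinearizable germs, the rotation number together with the germ of hedgehog form a complete set of holomorphic conjugacy invariants: $f_1$ and $f_2$ are holomorphically conjugate if and only if they have the same rotation number and there is $\phi\in\mathrm{Diff}(\mathbb{C},0)$ with $\phi([\mathcal{K}(f_1)]) = [\mathcal{K}(f_2)]$.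
   Context: $\mathrm{Diff}(\mathbb{C},0)$ is the group of germs at $0$ of holomorphic diffeomorphisms fixing $0$. A germ $f(z)=e^{2\pi i\alpha}z+O(z^2)$ with $\alpha$ irrational (its rotation number) is linearizable if there is a holomorphic $h(w)=w+O(w^2)$ with $h^{-1}\circ f\circ h=R_\alpha$, $R_\alpha(w)=e^{2\pi i\alpha}w$; otherwise nonlinearizable. A Siegel compact of $f$ is a full, connected, compact $K\subset\mathbb{C}$ with $0\in K$, $K\ne\{0\}$, such that $f,f^{-1}$ extend univalently to a neighbourhood of $K$ and $f(K)=f^{-1}(K)=K$; a hedgehog is a Siegel compact not contained in the closure of a linearization domain (for nonlinearizable $f$, every Siegel compact is a hedgehog). $\mathcal{K}(f)$ is the family of all Siegel compacta of $f$. For families $\mathcal{K}$ of compacta containing $0$ with members of arbitrarily small diameter, $\mathcal{K}_1\sim\mathcal{K}_2$ if there is $\epsilon>0$ such that every compact of diameter $<\epsilon$ lies in $\mathcal{K}_1$ iff it lies in $\mathcal{K}_2$; the class $[\mathcal{K}]$ is a germ of compact and $[\mathcal{K}(f)]$ is the germ of hedgehog of nonlinearizable $f$. A germ $\phi$ acts by $\phi([\mathcal{K}])=[\{\phi(K):K\in\mathcal{K}'\}]$ for a representative $\mathcal{K}'\sim\mathcal{K}$ all of whose members have a neighbourhood on which $\phi$ is defined. *)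

theory Defs
  imports "HOL-Analysis.Analysis"
begin

text \<open>Germs in Diff(C,0) are represented by functions that are holomorphic and
injective on some disc around 0 and fix 0. Equality of germs is equality on
a neighbourhood of 0.\<close>

definition diff_germ :: "(complex \<Rightarrow> complex) \<Rightarrow> bool" where
  "diff_germ f \<longleftrightarrow> (\<exists>r>0. f holomorphic_on ball 0 r \<and> inj_on f (ball 0 r) \<and> f 0 = 0)"

definition has_rotation_number :: "(complex \<Rightarrow> complex) \<Rightarrow> real \<Rightarrow> bool" where
  "has_rotation_number f \<alpha> \<longleftrightarrow> deriv f 0 = exp (2 * pi * \<i> * complex_of_real \<alpha>)"

text \<open>Linearizable: h(w) = w + O(w^2) holomorphic with h^{-1} o f o h = R_alpha,
written as f o h = h o R_alpha near 0.\<close>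
definition linearizable :: "(complex \<Rightarrow> complex) \<Rightarrow> bool" where
  "linearizable f \<longleftrightarrow> (\<exists>h r. r > 0 \<and> h holomorphic_on ball 0 r \<and> h 0 = 0 \<and> deriv h 0 = 1 \<and>
      (\<forall>\<^sub>F w in nhds 0. f (h w) = h (deriv f 0 * w)))"

definition full_continuum :: "complex set \<Rightarrow> bool" where
  "full_continuum K \<longleftrightarrow> compact K \<and> connected K \<and> connected (UNIV - K)"

definition siegel_compact :: "(complex \<Rightarrow> complex) \<Rightarrow> complex set \<Rightarrow> bool" where
  "siegel_compact f K \<longleftrightarrow> full_continuum K \<and> 0 \<in> K \<and> K \<noteq> {0} \<and>
     (\<exists>U F. open U \<and> K \<subseteq> U \<and> F holomorphic_on U \<and> inj_on F U \<and>
            (\<forall>\<^sub>F z in nhds 0. F z = f z) \<and> F ` K = K) \<and>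
     (\<exists>V G. open V \<and> K \<subseteq> V \<and> G holomorphic_on V \<and> inj_on G V \<and>
            (\<forall>\<^sub>F z in nhds 0. G (f z) = z) \<and> G ` K = K)"

definition linearization_domain :: "(complex \<Rightarrow> complex) \<Rightarrow> complex set \<Rightarrow> bool" where
  "linearization_domain f D \<longleftrightarrow> (\<exists>B h F. (B = UNIV \<or> (\<exists>\<rho>>0. B = ball 0 \<rho>)) \<and>
      h holomorphic_on B \<and> inj_on h B \<and> h 0 = 0 \<and> deriv h 0 = 1 \<and> D = h ` B \<and>
      F holomorphic_on D \<and> (\<forall>\<^sub>F z in nhds 0. F z = f z) \<and>
      (\<forall>w\<in>B. F (h w) = h (deriv f 0 * w)))"

definition hedgehog :: "(complex \<Rightarrow> complex) \<Rightarrow> complex set \<Rightarrow> bool" where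
  "hedgehog f K \<longleftrightarrow> siegel_compact f K \<and> \<not> (\<exists>D. linearization_domain f D \<and> K \<subseteq> closure D)"

definition siegel_family :: "(complex \<Rightarrow> complex) \<Rightarrow> complex set set" where
  "siegel_family f = {K. siegel_compact f K}"

definition germ_equiv :: "complex set set \<Rightarrow> complex set set \<Rightarrow> bool" where
  "germ_equiv \<K>1 \<K>2 \<longleftrightarrow> (\<exists>\<epsilon>>0. \<forall>K. compact K \<and> diameter K < \<epsilon> \<longrightarrow> (K \<in> \<K>1 \<longleftrightarrow> K \<in> \<K>2))"

text \<open>phi([K1]) = [K2]: for a representative K' of [K1] all of whose members have a
neighbourhood on which phi is defined (holomorphic and univalent),
the family {phi(K) : K in K'} represents [K2].\<close>
definition germ_action_eq :: "(complex \<Rightarrow> complex) \<Rightarrow> complex set set \<Rightarrow> complex set set \<Rightarrow> bool" where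
  "germ_action_eq \<phi> \<K>1 \<K>2 \<longleftrightarrow> (\<exists>\<K>'. germ_equiv \<K>' \<K>1 \<and>
      (\<forall>K\<in>\<K>'. \<exists>U. open U \<and> K \<subseteq> U \<and> \<phi> holomorphic_on U \<and> inj_on \<phi> U) \<and>
      germ_equiv ((\<lambda>K. \<phi> ` K) ` \<K>') \<K>2)"

text \<open>Germ equation phi o f1 o phi^{-1} = f2, i.e. phi o f1 = f2 o phi near 0.\<close>
definition conjugates :: "(complex \<Rightarrow> complex) \<Rightarrow> (complex \<Rightarrow> complex) \<Rightarrow> (complex \<Rightarrow> complex) \<Rightarrow> bool" where
  "conjugates \<phi> f1 f2 \<longleftrightarrow> (\<forall>\<^sub>F z in nhds 0. \<phi> (f1 z) = f2 (\<phi> z))"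

end

theory Submission
  imports Defs "HOL-Complex_Analysis.Complex_Analysis"
begin

text \<open>
  Rigidity. Let \<open>f\<close> and \<open>g\<close> have the same irrational multiplier and preserve a closed set \<open>K\<close>
  such that 0 is a limit point both of \<open>K\<close> and of its complement. If \<open>f \<noteq> g\<close>, then \<open>g\<inverse> f\<close> is
  \<open>z + a z\<^sup>n\<^sup>+\<^sup>1 + \<dots>\<close> with \<open>a \<noteq> 0\<close>; its conjugates by \<open>f\<close> and their products act near 0, in the coordinate
  proportional to \<open>1 / z\<^sup>n\<close>, as approximate translations by a dense set of vectors. Iterating the
  parabolic germ carries a disc of the complement of \<open>K\<close> towards 0 without shrinking in this
  coordinate, while the approximate translations put points of \<open>K\<close> into it, a contradiction. For a
  Siegel compact of a nonlinearizable germ, 0 is not interior, since otherwise averages of the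
  normalized iterates would linearize the germ.

  Existence of small Siegel compacta. If the points whose full orbit stays in a small disc had no
  component joining 0 to the boundary circle, the same would hold robustly for the germs \<open>f\<^sub>t\<close>,
  obtained from \<open>f\<close> by changing the rotation number to \<open>t\<close> near \<open>\<alpha>\<close>. For rationals \<open>p/q < p'/q'\<close> near
  \<open>\<alpha>\<close>, the cycle of rotation number \<open>p/q\<close> born at 0 for \<open>t = p/q\<close> and the one of rotation number
  \<open>p'/q'\<close> born at 0 for \<open>t = p'/q'\<close> would both persist for all \<open>t\<close> in between. Their linking number
  is constant, but equals \<open>q p'\<close> when the first cycle collapses to 0 and \<open>q' p\<close> when the second does.
\<close>

section \<open>Irrational rotations\<close>

text \<open>Nothing is known about the shape of \<open>K\<close>, so its complement is not
  uniformized. One disc of the complement and one point of \<open>K\<close> in a common attracting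
  petal suffice, and the irrational rotation brings both there. In the petal coordinate the
  parabolic germ is w + 1 + E w with E of order |w|^(-1/n). This bound is not summable along orbits,
  so an orbit may drift far from that of the pure translation. The derivative of E gains a full
  power of |w| and is summable, so distances between two orbits change only by bounded factors.
  Hence the disc keeps its size, and the vector from the point of \<open>K\<close> to the disc stays
  bounded; along a subsequence it converges, and one fixed approximate translation then serves for
  all late times. In the existence part, cycles may branch or merge as t varies, so no cycle is
  chosen continuously. What is followed is a relatively clopen set of pairs (t, z), and the linking
  number cuts such a set into smaller clopen pieces.\<close>

lemma irrational_rotation_dense:
  fixes \<theta> :: real and u :: complex
  assumes "\<theta> \<notin> \<rat>" "norm u = 1" "\<epsilon> > 0"
  obtains l :: nat where "norm (cis (2 * pi * \<theta>) ^ l - u) < \<epsilon>"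
proof -
  define x where "x = Arg2pi u / (2*pi)"
  have x: "0 \<le> x" "x \<le> 1"
    using Arg2pi [of u] by (auto simp: x_def)
  have u: "u = cis (2 * pi * x)"
    using complex_unimodular_polar assms(2) Arg2pi_eq [of u] by (simp add: x_def cis_conv_exp mult.commute)
  have "isCont (\<lambda>s. cis (2 * pi * s)) x"
    unfolding cis_conv_exp by (intro continuous_intros)
  then obtain \<delta> where "\<delta> > 0" and \<delta>: "\<And>s. \<bar>s - x\<bar> < \<delta> \<Longrightarrow> norm (cis (2 * pi * s) - cis (2 * pi * x)) < \<epsilon>"
    using \<open>\<epsilon> > 0\<close> unfolding continuous_at_eps_delta dist_norm real_norm_def by blast
  have "x \<in> closure (range (\<lambda>n. frac (real n * \<theta>)))"
    using Kronecker_approx_1 [OF assms(1)] x by auto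
  then obtain n where "\<bar>frac (real n * \<theta>) - x\<bar> < \<delta>"
    using \<open>\<delta> > 0\<close> by (auto simp: closure_approachable dist_norm)
  then have "norm (cis (2 * pi * frac (real n * \<theta>)) - u) < \<epsilon>"
    using \<delta> u by simp
  moreover have "cis (2 * pi * frac (real n * \<theta>)) = cis (2 * pi * \<theta>) ^ n"
  proof -
    have "cis (2 * pi * frac (real n * \<theta>)) = cis (real n * (2*pi*\<theta>)) * cis (- (2 * pi * of_int \<lfloor>real n * \<theta>\<rfloor>))"
      by (simp add: cis_mult frac_def algebra_simps)
    also have "cis (- (2 * pi * of_int \<lfloor>real n * \<theta>\<rfloor>)) = 1"
      by (metis cis_multiple_2pi Ints_of_int cis_inverse inverse_1)
    finally show ?thesis unfolding Complex.DeMoivre by (simp only: mult_1_right)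
  qed
  ultimately show thesis using that by metis
qed

text \<open>The two unit vectors are the sides of a rhombus with diagonal \<sigma>, so each makes
  the angle \<open>arccos (norm \<sigma> / 2)\<close> with it.\<close>

lemma unit_sum_two:
  fixes \<sigma> :: complex assumes "norm \<sigma> \<le> 2"
  obtains u v where "norm u = 1" "norm v = 1" "\<sigma> = u + v"
proof -
  define e where "e = (if \<sigma> = 0 then 1 else sgn \<sigma>)"
  have e: "norm e = 1" "\<sigma> = complex_of_real (norm \<sigma>) * e"
    by (auto simp: e_def norm_sgn) (simp add: sgn_div_norm scaleR_conv_of_real)
  define t where "t = norm \<sigma> / 2"
  have t: "0 \<le> t" "t \<le> 1" using assms by (auto simp: t_def)
  define c where "c = arccos t"
  have c: "cos c = t" using t by (simp add: c_def)
  have "cis c + cis (- c) = complex_of_real (norm \<sigma>)"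
    using c by (simp add: complex_eq_iff t_def)
  then have "\<sigma> = cis c * e + cis (-c) * e"
    using e(2) by (metis distrib_right)
  then show thesis using that [of "cis c * e" "cis (-c) * e"] e(1) by (simp add: norm_mult)
qed

text \<open>Sums of two vectors on a circle fill a disc, so multiples of such sums fill the plane;
  hence no inverses are needed.\<close>
lemma rotation_invariant_semigroup_dense:
  fixes \<theta> :: real and S :: "complex set"
  assumes "\<theta> \<notin> \<rat>" "a \<noteq> 0" "a \<in> S"
    and add: "\<And>c d. c \<in> S \<Longrightarrow> d \<in> S \<Longrightarrow> c + d \<in> S"
    and rot: "\<And>c. c \<in> S \<Longrightarrow> cis (2 * pi * \<theta>) * c \<in> S"
    and "\<epsilon> > 0"
  obtains c where "c \<in> S" "norm (c - \<tau>) < \<epsilon>"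
proof -
  have pow: "cis (2 * pi * \<theta>) ^ l * a \<in> S" for l
  proof (induction l)
    case 0 show ?case using assms by simp
  next
    case (Suc l) show ?case using rot [OF Suc] by (simp add: mult.assoc)
  qed
  have mult: "of_nat (Suc m) * c \<in> S" if "c \<in> S" for m c
  proof (induction m)
    case 0 then show ?case using that by simp
  next
    case (Suc m)
    have "of_nat (Suc (Suc m)) * c = c + of_nat (Suc m) * c" by (simp add: algebra_simps)
    then show ?case using add [OF that Suc] by simp
  qed
  \<comment> \<open>With \<open>M = Suc m\<close> the rescaled target \<tau> / (M a) has modulus
    below 2, hence is a sum of two unit vectors, which powers of the rotation approximate.\<close>
  obtain m :: nat where m: "norm \<tau> / (2 * norm a) < real (Suc m)"
    by (metis reals_Archimedean2 less_trans lessI of_nat_less_iff)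
  define M where "M = real (Suc m)"
  have M: "M > 0" by (simp add: M_def)
  define \<sigma> where "\<sigma> = \<tau> / (of_real M * a)"
  have "norm \<tau> < 2 * norm a * M"
    using m \<open>a \<noteq> 0\<close> unfolding M_def[symmetric] by (simp add: divide_less_eq mult.commute)
  then have "norm \<sigma> \<le> 2"
    using \<open>a \<noteq> 0\<close> M by (simp add: \<sigma>_def norm_divide norm_mult divide_le_eq mult.assoc mult.commute)
  then obtain u v where uv: "norm u = 1" "norm v = 1" "\<sigma> = u + v" by (rule unit_sum_two)
  \<comment> \<open>There are two approximation errors, each later multiplied by
    \<open>M * norm a\<close>.\<close>
  define \<delta> where "\<delta> = \<epsilon> / (2 * M * norm a)"
  have "\<delta> > 0" using \<open>\<epsilon> > 0\<close> M \<open>a \<noteq> 0\<close> by (simp add: \<delta>_def)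
  obtain k where k: "norm (cis (2 * pi * \<theta>) ^ k - u) < \<delta>"
    using irrational_rotation_dense [OF assms(1) uv(1) \<open>\<delta> > 0\<close>] by blast
  obtain l where l: "norm (cis (2 * pi * \<theta>) ^ l - v) < \<delta>"
    using irrational_rotation_dense [OF assms(1) uv(2) \<open>\<delta> > 0\<close>] by blast
  define p q where "p = cis (2 * pi * \<theta>) ^ k" and "q = cis (2 * pi * \<theta>) ^ l"
  define c where "c = of_nat (Suc m) * (p * a + q * a)"
  have "c \<in> S"
    unfolding c_def p_def q_def by (intro mult add pow)
  have Mc: "of_nat (Suc m) = complex_of_real M" by (simp add: M_def)
  have "\<tau> = of_real M * a * (u + v)"
    using uv(3) M \<open>a \<noteq> 0\<close> by (simp add: \<sigma>_def field_simps)
  then have "c - \<tau> = of_real M * a * ((p - u) + (q - v))"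
    unfolding c_def Mc by (simp add: algebra_simps)
  then have "norm (c - \<tau>) = M * norm a * norm ((p - u) + (q - v))"
    using M by (simp add: norm_mult)
  also have "\<dots> < M * norm a * (\<delta> + \<delta>)"
    using k l M \<open>a \<noteq> 0\<close> unfolding p_def q_def
    by (intro mult_strict_left_mono norm_triangle_lt) auto
  also have "\<dots> = \<epsilon>" using M \<open>a \<noteq> 0\<close> by (simp add: \<delta>_def field_simps)
  finally show thesis using that \<open>c \<in> S\<close> by blast
qed

section \<open>Germs tangent to the identity preserving a set\<close>

lemma analytic_at_0_D:
  assumes "f analytic_on {0::complex}"
  obtains r where "r > 0" "f holomorphic_on ball 0 r"
  using assms by (auto simp: analytic_on_def)

lemma analytic_at_0_isCont: "f analytic_on {0::complex} \<Longrightarrow> isCont f 0"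
  by (rule analytic_at_imp_isCont)

lemma analytic_at_0_tendsto:
  assumes "f analytic_on {0::complex}" "f 0 = 0"
  shows "(f \<longlongrightarrow> 0) (nhds 0)" "(f \<longlongrightarrow> 0) (at 0)"
  using analytic_at_0_isCont [OF assms(1)] assms(2)
  by (auto simp: isCont_def tendsto_nhds_iff)

lemma analytic_local_inverse:
  fixes f :: "complex \<Rightarrow> complex"
  assumes "f analytic_on {0}" "f 0 = 0" "deriv f 0 \<noteq> 0"
  obtains g where "g analytic_on {0}" "g 0 = 0" "deriv g 0 = inverse (deriv f 0)"
    "\<forall>\<^sub>F z in nhds 0. f (g z) = z" "\<forall>\<^sub>F z in nhds 0. g (f z) = z"
proof -
  obtain r where r: "r > 0" "f holomorphic_on ball 0 r"
    using assms(1) by (rule analytic_at_0_D)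
  have "0 \<in> ball (0::complex) r" using r(1) by simp
  from has_complex_derivative_locally_injective [OF r(2) this open_ball assms(3)]
  obtain s where s: "s > 0" "ball 0 s \<subseteq> ball (0::complex) r" "inj_on f (ball 0 s)" by blast
  have holf: "f holomorphic_on ball 0 s"
    using r s holomorphic_on_subset by blast
  obtain g where g: "g holomorphic_on f ` ball 0 s"
      "\<And>z. z \<in> ball 0 s \<Longrightarrow> deriv f z * deriv g (f z) = 1" "\<And>z. z \<in> ball 0 s \<Longrightarrow> g (f z) = z"
    using holomorphic_has_inverse [OF holf open_ball s(3)] by metis
  have op: "open (f ` ball 0 s)"
    using open_mapping_thm3 [OF holf open_ball s(3)] .
  have "0 \<in> f ` ball 0 s" using s(1) assms(2) by force
  with op g(1) have an: "g analytic_on {0}"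
    by (metis analytic_at)
  have 0: "g 0 = 0" using g(3)[of 0] s assms(2) by simp
  have d: "deriv g 0 = inverse (deriv f 0)"
    using g(2)[of 0] s assms by (simp add: field_simps)
  have "\<forall>\<^sub>F z in nhds 0. z \<in> f ` ball 0 s"
    using op \<open>0 \<in> f ` ball 0 s\<close> by (rule eventually_nhds_in_open)
  then have e1: "\<forall>\<^sub>F z in nhds 0. f (g z) = z"
    by (rule eventually_mono) (use g(3) in auto)
  have "\<forall>\<^sub>F z in nhds 0. z \<in> ball (0::complex) s"
    using s(1) by (intro eventually_nhds_in_open) auto
  then have e2: "\<forall>\<^sub>F z in nhds 0. g (f z) = z"
    by (rule eventually_mono) (use g(3) in auto)
  show thesis by (rule that [OF an 0 d e1 e2])
qed

text \<open>Both points move. For \<open>T\<close> tangent to the identity, \<open>T z - z\<close>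
  is much smaller than \<open>z\<close>, and \<open>f (T z) - f z\<close> has to be known up to an
  error small against \<open>T z - z\<close>; differentiability at the single point 0 does not give
  that.\<close>

lemma strict_derivative_at_0:
  fixes f :: "complex \<Rightarrow> complex"
  assumes "f analytic_on {0}" "\<epsilon> > 0"
  obtains \<delta> where "\<delta> > 0"
    "\<And>u v. u \<in> ball 0 \<delta> \<Longrightarrow> v \<in> ball 0 \<delta> \<Longrightarrow> norm (f u - f v - deriv f 0 * (u - v)) \<le> \<epsilon> * norm (u - v)"
proof -
  obtain r where r: "r > 0" "f holomorphic_on ball 0 r"
    using assms(1) by (rule analytic_at_0_D)
  have "deriv f holomorphic_on ball 0 r"
    using r by (intro holomorphic_deriv) auto
  then have "isCont (deriv f) 0"
    using r holomorphic_on_imp_continuous_on continuous_on_interior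
    by (metis centre_in_ball interior_ball)
  then obtain d where d: "d > 0" "\<And>z. norm z < d \<Longrightarrow> norm (deriv f z - deriv f 0) < \<epsilon>"
    using assms(2) unfolding continuous_at_eps_delta dist_norm by (metis diff_zero)
  define \<delta> where "\<delta> = min d r"
  have \<delta>: "\<delta> > 0" "\<delta> \<le> d" "\<delta> \<le> r" using d r by (auto simp: \<delta>_def)
  have "norm (f u - f v - deriv f 0 * (u - v)) \<le> \<epsilon> * norm (u - v)"
    if "u \<in> ball 0 \<delta>" "v \<in> ball 0 \<delta>" for u v
  proof -
    have der: "((\<lambda>z. f z - deriv f 0 * z) has_field_derivative (deriv f z - deriv f 0)) (at z within ball 0 \<delta>)"
      if "z \<in> ball 0 \<delta>" for z
    proof -
      have "(f has_field_derivative deriv f z) (at z)"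
        using r that \<delta> by (intro holomorphic_derivI [OF r(2)]) auto
      then have "((\<lambda>z. f z - deriv f 0 * z) has_field_derivative (deriv f z - deriv f 0)) (at z)"
        by (auto intro!: derivative_eq_intros)
      then show ?thesis by (rule has_field_derivative_at_within)
    qed
    have "norm ((f u - deriv f 0 * u) - (f v - deriv f 0 * v)) \<le> \<epsilon> * norm (u - v)"
      by (rule field_differentiable_bound [OF convex_ball der])
         (use d \<delta> that in \<open>auto intro: less_imp_le\<close>)
    then show ?thesis by (simp add: algebra_simps)
  qed
  then show thesis using that \<delta>(1) by blast
qed

text \<open>Some map acts near 0 in the coordinate \<open>1 / z\<^sup>n\<close> as a translation by nearly \<open>-n c\<close> and
  preserves \<open>K\<close>.\<close>
definition tangent_shift :: "complex set \<Rightarrow> nat \<Rightarrow> complex \<Rightarrow> bool" where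
  "tangent_shift K n c \<longleftrightarrow> (\<exists>T. ((\<lambda>z. (T z - z) / z ^ Suc n) \<longlongrightarrow> c) (at 0) \<and>
      (\<forall>\<^sub>F z in at 0. z \<in> K \<longrightarrow> T z \<in> K))"

lemma tangent_map_ratio:
  fixes T :: "complex \<Rightarrow> complex"
  assumes "((\<lambda>z. (T z - z) / z ^ Suc n) \<longlongrightarrow> c) (at 0)" "n \<ge> 1"
  shows "((\<lambda>z. T z / z) \<longlongrightarrow> 1) (at 0)"
proof -
  have "((\<lambda>z. 1 + z ^ n * ((T z - z) / z ^ Suc n)) \<longlongrightarrow> 1 + 0 ^ n * c) (at 0)"
    by (intro tendsto_intros assms)
  then have "((\<lambda>z. 1 + z ^ n * ((T z - z) / z ^ Suc n)) \<longlongrightarrow> 1) (at 0)"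
    using assms(2) by (simp add: power_0_left)
  then show ?thesis
    by (rule Lim_transform_eventually) (auto simp: eventually_at_filter field_simps)
qed

text \<open>Quotients by powers of \<open>z\<close> have limits only along the punctured filter
  \<open>at 0\<close>; a nonzero limit of \<open>T z / z\<close> keeps \<open>T z\<close> off 0,
  which allows such limits to be composed with \<open>T\<close>.\<close>

lemma ratio_tendsto_nonzero_filterlim:
  fixes T :: "complex \<Rightarrow> complex"
  assumes "((\<lambda>z. T z / z) \<longlongrightarrow> l) (at 0)" "l \<noteq> 0"
  shows "filterlim T (at 0) (at 0)"
proof -
  have "((\<lambda>z. T z / z * z) \<longlongrightarrow> l * 0) (at 0)"
    by (intro tendsto_intros assms)
  then have "(T \<longlongrightarrow> 0) (at 0)"
    unfolding mult_zero_right by (rule Lim_transform_eventually) (auto simp: eventually_at_filter)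
  moreover have "\<forall>\<^sub>F z in at 0. T z / z \<noteq> 0"
    using tendsto_imp_eventually_ne [OF assms] .
  then have "\<forall>\<^sub>F z in at 0. T z \<noteq> 0"
    by (rule eventually_mono) auto
  ultimately show ?thesis by (simp add: filterlim_at)
qed

text \<open>The second displacement is measured at \<open>T z\<close> instead of \<open>z\<close>;
  the correcting factor \<open>(T z / z) ^ Suc n\<close> tends to 1.\<close>

lemma tangent_shift_add:
  assumes "tangent_shift K n c" "tangent_shift K n d" "n \<ge> 1"
  shows "tangent_shift K n (c + d)"
proof -
  obtain T where T: "((\<lambda>z. (T z - z) / z ^ Suc n) \<longlongrightarrow> c) (at 0)" "\<forall>\<^sub>F z in at 0. z \<in> K \<longrightarrow> T z \<in> K"
    using assms(1) unfolding tangent_shift_def by blast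
  obtain S where S: "((\<lambda>z. (S z - z) / z ^ Suc n) \<longlongrightarrow> d) (at 0)" "\<forall>\<^sub>F z in at 0. z \<in> K \<longrightarrow> S z \<in> K"
    using assms(2) unfolding tangent_shift_def by blast
  note ratio = tangent_map_ratio [OF T(1) assms(3)]
  have lim: "filterlim T (at 0) (at 0)"
    by (rule ratio_tendsto_nonzero_filterlim [OF ratio]) simp
  have "((\<lambda>z. (S (T z) - T z) / T z ^ Suc n) \<longlongrightarrow> d) (at 0)"
    using filterlim_compose [OF S(1) lim] by simp
  then have lim2: "((\<lambda>z. (T z - z) / z ^ Suc n + (S (T z) - T z) / T z ^ Suc n * (T z / z) ^ Suc n) \<longlongrightarrow> c + d * 1 ^ Suc n) (at 0)"
    by (intro tendsto_intros T(1) ratio)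
  have "\<forall>\<^sub>F z in at 0. T z \<noteq> 0 \<and> z \<noteq> 0"
    using lim by (auto simp: filterlim_at eventually_conj_iff eventually_at_filter)
  then have ev: "\<forall>\<^sub>F z in at 0. (T z - z) / z ^ Suc n + (S (T z) - T z) / T z ^ Suc n * (T z / z) ^ Suc n = (S (T z) - z) / z ^ Suc n"
    by (rule eventually_mono) (simp add: power_divide add_divide_distrib [symmetric] del: power_Suc)
  have "((\<lambda>z. ((S \<circ> T) z - z) / z ^ Suc n) \<longlongrightarrow> c + d) (at 0)"
    using Lim_transform_eventually [OF lim2 ev] by (simp only: o_def power_one mult_1_right)
  moreover have "\<forall>\<^sub>F z in at 0. T z \<in> K \<longrightarrow> S (T z) \<in> K"
    using S(2) lim by (rule eventually_compose_filterlim)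
  with T(2) have "\<forall>\<^sub>F z in at 0. z \<in> K \<longrightarrow> (S \<circ> T) z \<in> K"
    by eventually_elim auto
  ultimately show ?thesis unfolding tangent_shift_def by blast
qed

lemma analytic_at_0_ratio:
  fixes f :: "complex \<Rightarrow> complex"
  assumes "f analytic_on {0}" "f 0 = 0"
  shows "((\<lambda>z. f z / z) \<longlongrightarrow> deriv f 0) (at 0)"
proof -
  have "(f has_field_derivative deriv f 0) (at 0)"
    using assms(1) analytic_on_imp_differentiable_at DERIV_deriv_iff_field_differentiable by blast
  then show ?thesis using assms(2) by (simp add: has_field_derivative_iff)
qed

text \<open>For y = f x and \<mu> the multiplier of \<open>f\<close>, the conjugate of
  \<open>T\<close> by \<open>f\<close> displaces y by about \<mu> c x^(n+1) = \<mu>^(-n) c y^(n+1).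
  An irrational rotation thereby turns one shift vector into a dense set of directions.\<close>

lemma tangent_shift_conj:
  assumes "f analytic_on {0}" "f 0 = 0" "deriv f 0 \<noteq> 0"
    and inv: "\<forall>\<^sub>F z in nhds 0. f z \<in> K \<longleftrightarrow> z \<in> K"
    and c: "tangent_shift K n c" "n \<ge> 1"
  shows "tangent_shift K n (inverse (deriv f 0) ^ n * c)"
proof -
  define \<mu> where "\<mu> = deriv f 0"
  have l0: "\<mu> \<noteq> 0" using assms(3) by (simp add: \<mu>_def)
  obtain T where T: "((\<lambda>z. (T z - z) / z ^ Suc n) \<longlongrightarrow> c) (at 0)" "\<forall>\<^sub>F z in at 0. z \<in> K \<longrightarrow> T z \<in> K"
    using c unfolding tangent_shift_def by blast
  obtain g where g: "g analytic_on {0}" "g 0 = 0" "deriv g 0 = inverse \<mu>"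
    "\<forall>\<^sub>F z in nhds 0. f (g z) = z" "\<forall>\<^sub>F z in nhds 0. g (f z) = z"
    using analytic_local_inverse [OF assms(1-3)] unfolding \<mu>_def by metis
  have gr: "((\<lambda>z. g z / z) \<longlongrightarrow> inverse \<mu>) (at 0)"
    using analytic_at_0_ratio [OF g(1,2)] g(3) by simp
  have limg: "filterlim g (at 0) (at 0)"
    by (rule ratio_tendsto_nonzero_filterlim [OF gr]) (use l0 in simp)
  have limT: "filterlim T (at 0) (at 0)"
    by (rule ratio_tendsto_nonzero_filterlim [OF tangent_map_ratio [OF T(1) c(2)]]) simp
  \<comment> \<open>\<open>Q\<close> is the difference quotient of \<open>f\<close> between
    \<open>T x\<close> and \<open>x\<close>. The value \<mu> at fixed points of \<open>T\<close>
    respects both its limit and the identity \<open>f (T x) - f x = Q x * (T x - x)\<close>.\<close>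
  define Q where "Q = (\<lambda>x. if T x = x then \<mu> else (f (T x) - f x) / (T x - x))"
  have Q: "(Q \<longlongrightarrow> \<mu>) (at 0)"
  proof (rule tendstoI)
    fix e :: real assume "e > 0"
    then obtain \<delta> where \<delta>: "\<delta> > 0" "\<And>u v. u \<in> ball 0 \<delta> \<Longrightarrow> v \<in> ball 0 \<delta> \<Longrightarrow> norm (f u - f v - deriv f 0 * (u - v)) \<le> (e/2) * norm (u - v)"
      using strict_derivative_at_0 [OF assms(1), of "e/2"] by auto
    have "\<forall>\<^sub>F x in at 0. x \<in> ball (0::complex) \<delta>"
      using \<delta>(1) by (intro eventually_at_in_open') auto
    moreover from this have "\<forall>\<^sub>F x in at 0. T x \<in> ball 0 \<delta>"
      using limT by (rule eventually_compose_filterlim)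
    ultimately show "\<forall>\<^sub>F x in at 0. dist (Q x) \<mu> < e"
    proof eventually_elim
      case (elim x)
      show ?case
      proof (cases "T x = x")
        case False
        have "norm (f (T x) - f x - \<mu> * (T x - x)) \<le> (e/2) * norm (T x - x)"
          using \<delta>(2) elim unfolding \<mu>_def by blast
        moreover have "Q x - \<mu> = (f (T x) - f x - \<mu> * (T x - x)) / (T x - x)"
          using False by (simp add: Q_def field_simps)
        ultimately have "norm (Q x - \<mu>) \<le> e/2"
          using False by (simp add: norm_divide divide_le_eq)
        then show ?thesis using \<open>e > 0\<close> by (simp add: dist_norm)
      qed (use \<open>e > 0\<close> in \<open>simp add: Q_def\<close>)
    qed
  qed
  have "((\<lambda>x. Q x * ((T x - x) / x ^ Suc n)) \<longlongrightarrow> \<mu> * c) (at 0)"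
    by (intro tendsto_intros Q T(1))
  then have "((\<lambda>y. Q (g y) * ((T (g y) - g y) / g y ^ Suc n)) \<longlongrightarrow> \<mu> * c) (at 0)"
    by (rule filterlim_compose [OF _ limg])
  then have lim2: "((\<lambda>y. Q (g y) * ((T (g y) - g y) / g y ^ Suc n) * (g y / y) ^ Suc n) \<longlongrightarrow> \<mu> * c * inverse \<mu> ^ Suc n) (at 0)"
    by (rule tendsto_mult [OF _ tendsto_power [OF gr]])
  have leq: "\<mu> * c * inverse \<mu> ^ Suc n = inverse \<mu> ^ n * c"
    using l0 by simp
  have fg: "\<forall>\<^sub>F y in at 0. f (g y) = y"
    using g(4) by (simp add: eventually_at_filter eventually_mono)
  then have "\<forall>\<^sub>F y in at 0. f (g y) = y \<and> g y \<noteq> 0 \<and> y \<noteq> 0"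
    using limg by (auto simp: filterlim_at eventually_conj_iff eventually_at_filter)
  then have ev: "\<forall>\<^sub>F y in at 0. Q (g y) * ((T (g y) - g y) / g y ^ Suc n) * (g y / y) ^ Suc n
      = ((f \<circ> T \<circ> g) y - y) / y ^ Suc n"
    by (rule eventually_mono) (auto simp: Q_def power_divide simp del: power_Suc)
  have 1: "((\<lambda>y. ((f \<circ> T \<circ> g) y - y) / y ^ Suc n) \<longlongrightarrow> inverse \<mu> ^ n * c) (at 0)"
    using Lim_transform_eventually [OF lim2 ev] by (simp only: leq)
  have inv': "\<forall>\<^sub>F z in at 0. f z \<in> K \<longleftrightarrow> z \<in> K"
    using inv by (simp add: eventually_at_filter eventually_mono)
  have "\<forall>\<^sub>F y in at 0. f (g y) \<in> K \<longleftrightarrow> g y \<in> K"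
    using inv' limg by (rule eventually_compose_filterlim)
  moreover have "\<forall>\<^sub>F y in at 0. g y \<in> K \<longrightarrow> T (g y) \<in> K"
    using T(2) limg by (rule eventually_compose_filterlim)
  moreover have "\<forall>\<^sub>F y in at 0. f (T (g y)) \<in> K \<longleftrightarrow> T (g y) \<in> K"
    using eventually_compose_filterlim [OF eventually_compose_filterlim [OF inv' limT] limg] .
  moreover note fg
  ultimately have "\<forall>\<^sub>F y in at 0. y \<in> K \<longrightarrow> (f \<circ> T \<circ> g) y \<in> K"
    by eventually_elim auto
  with 1 show ?thesis unfolding tangent_shift_def \<mu>_def by blast
qed

section \<open>The parabolic chart and its dynamics\<close>

text \<open>A branch of the inverse of \<open>z \<mapsto> (\<xi> / z)\<^sup>n\<close> on the right half-plane.\<close>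
definition chart :: "nat \<Rightarrow> complex \<Rightarrow> complex \<Rightarrow> complex" where
  "chart n \<xi> w = \<xi> * exp (- Ln w / of_nat n)"

text \<open>Multiplying z by v divides (\<xi> / z)^n by v^n. The arguments of w and of v^n are each
  below pi/2 in modulus, so \<open>Ln w - n * Ln v\<close> stays in the strip of the principal
  branch, even if \<open>w / v ^ n\<close> leaves the half-plane.\<close>

lemma chart_mult:
  assumes "n \<ge> 1" "Re w > 0" "v \<noteq> 0" "\<bar>real n * Im (Ln v)\<bar> < pi / 2"
  shows "chart n \<xi> (w / v ^ n) = chart n \<xi> w * v"
proof -
  have w0: "w \<noteq> 0" using assms(2) by auto
  have im: "\<bar>Im (Ln w)\<bar> < pi / 2"
    using Re_Ln_pos_lt_imp assms(2) w0 Re_Ln_pos_lt by blast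
  have "exp (Ln w - of_nat n * Ln v) = w / v ^ n"
    using w0 assms(3) by (simp add: exp_diff exp_of_nat_mult)
  moreover have "Ln (exp (Ln w - of_nat n * Ln v)) = Ln w - of_nat n * Ln v"
  proof (rule Ln_exp)
    have "Im (Ln w - of_nat n * Ln v) = Im (Ln w) - real n * Im (Ln v)" by simp
    then show "- pi < Im (Ln w - of_nat n * Ln v)" "Im (Ln w - of_nat n * Ln v) \<le> pi"
      using im assms(4) by linarith+
  qed
  ultimately have "Ln (w / v ^ n) = Ln w - of_nat n * Ln v" by simp
  then have "- Ln (w / v ^ n) / of_nat n = - Ln w / of_nat n + Ln v"
    using assms(1) by (simp add: field_simps)
  then show ?thesis
    using assms(3) by (simp add: chart_def exp_diff exp_minus field_simps)
qed

lemma norm_chart: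
  assumes "w \<noteq> 0"
  shows "norm (chart n \<xi> w) = norm \<xi> * norm w powr (- 1 / real n)"
  using assms by (simp add: chart_def norm_mult powr_def Re_divide_of_nat)

lemma chart_power:
  assumes "n \<ge> 1" "w \<noteq> 0"
  shows "chart n \<xi> w ^ n = \<xi> ^ n / w"
proof -
  have "exp (- Ln w / of_nat n) ^ n = exp (- Ln w)"
    using assms(1) by (simp flip: exp_of_nat_mult)
  then show ?thesis using assms(2) by (simp add: chart_def power_mult_distrib exp_minus field_simps)
qed

lemma chart_holomorphic: "chart n \<xi> holomorphic_on {w. Re w > R}" if "R \<ge> 0"
proof -
  have "w \<notin> \<real>\<^sub>\<le>\<^sub>0" if "Re w > R" for w
    using that \<open>R \<ge> 0\<close> by (auto simp: complex_nonpos_Reals_iff)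
  then show ?thesis
    unfolding chart_def by (cases "n = 0") (auto intro!: holomorphic_intros)
qed

lemma analytic_at_0_linear_bound:
  fixes e :: "complex \<Rightarrow> complex"
  assumes "e analytic_on {0}" "e 0 = 0"
  obtains C \<delta> where "C > 0" "\<delta> > 0" "\<And>z. norm z < \<delta> \<Longrightarrow> norm (e z) \<le> C * norm z"
proof -
  obtain \<delta> where \<delta>: "\<delta> > 0"
    "\<And>u v. u \<in> ball 0 \<delta> \<Longrightarrow> v \<in> ball 0 \<delta> \<Longrightarrow> norm (e u - e v - deriv e 0 * (u - v)) \<le> 1 * norm (u - v)"
    using strict_derivative_at_0 [OF assms(1), of 1] by auto
  have "norm (e z) \<le> (1 + norm (deriv e 0)) * norm z" if "norm z < \<delta>" for z
  proof -
    have "norm (e z - deriv e 0 * z) \<le> norm z"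
      using \<delta>(2)[of z 0] \<delta>(1) that assms(2) by simp
    then have "norm (e z) \<le> norm z + norm (deriv e 0 * z)"
      by (metis norm_triangle_sub add.commute order_trans add_left_mono)
    then show ?thesis by (simp add: norm_mult algebra_simps)
  qed
  then show thesis using that [of "1 + norm (deriv e 0)"] \<delta>(1) by (simp add: add_pos_nonneg)
qed

lemma chart_small:
  assumes "n \<ge> 1" "\<delta> > 0"
  obtains R where "R > 0" "\<And>w. Re w > R \<Longrightarrow> norm (chart n \<xi> w) < \<delta>"
proof -
  have "((\<lambda>x. norm \<xi> * x powr (- 1 / real n)) \<longlongrightarrow> norm \<xi> * 0) at_top"
    using assms(1) by (intro tendsto_intros tendsto_neg_powr filterlim_ident) auto
  then have "\<forall>\<^sub>F x in at_top. norm \<xi> * x powr (- 1 / real n) < \<delta>"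
    using assms(2) by (auto intro: order_tendstoD)
  then obtain R where R: "\<And>x. x \<ge> R \<Longrightarrow> norm \<xi> * x powr (- 1 / real n) < \<delta>"
    by (auto simp: eventually_at_top_linorder)
  have "norm (chart n \<xi> w) < \<delta>" if "Re w > max R 1" for w
  proof -
    have "norm w \<ge> R" "w \<noteq> 0" using that complex_Re_le_cmod [of w] by auto
    then show ?thesis using R by (simp add: norm_chart)
  qed
  then show thesis using that [of "max R 1"] by auto
qed

text \<open>Writing h z = z u(z), the germ divides w = (\<xi> / z)^n by u(z)^n. To leading order
  this adds -n a \<xi>^n to w, and \<xi> is chosen to make that 1. The remaining error is an
  analytic function of z vanishing at 0, hence of order |z|, that is |w|^(-1/n).\<close>

lemma parabolic_chart:
  fixes h k :: "complex \<Rightarrow> complex"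
  assumes k: "k analytic_on {0}" "k 0 = a" "a \<noteq> 0" and n: "n \<ge> 1"
    and h: "\<forall>\<^sub>F z in nhds 0. h z = z + z ^ Suc n * k z"
    and \<xi>: "\<xi> ^ n = - 1 / (of_nat n * a)" and "\<delta> > 0"
  obtains R C E where "R > 0" "C > 0" "E holomorphic_on {w. Re w > R}"
    "\<And>w. Re w > R \<Longrightarrow> norm (chart n \<xi> w) < \<delta>"
    "\<And>w. Re w > R \<Longrightarrow> h (chart n \<xi> w) = chart n \<xi> (w + 1 + E w)"
    "\<And>w. Re w > R \<Longrightarrow> norm (E w) \<le> C * norm w powr (- 1 / real n)"
proof -
  define u where "u = (\<lambda>z. 1 + z ^ n * k z)"
  define e where "e = (\<lambda>z. k z * (\<Sum>j<n. u z ^ j) / (of_nat n * a * u z ^ n) - 1)"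
  have u0: "u 0 = 1" using n by (simp add: u_def power_0_left)
  have uan: "u analytic_on {0}" unfolding u_def by (intro analytic_intros k)
  have ean: "e analytic_on {0}" unfolding e_def
    by (intro analytic_intros k uan) (use u0 k n in auto)
  have e0: "e 0 = 0" using u0 k n by (simp add: e_def)
  obtain C \<delta>1 where C: "C > 0" "\<delta>1 > 0" "\<And>z. norm z < \<delta>1 \<Longrightarrow> norm (e z) \<le> C * norm z"
    using analytic_at_0_linear_bound [OF ean e0] by blast
  obtain r where r: "r > 0" "e holomorphic_on ball 0 r" using ean by (rule analytic_at_0_D)
  have "isCont (\<lambda>z. real n * Im (Ln (u z))) 0"
    using analytic_at_0_isCont [OF uan] u0 by (intro continuous_intros) auto
  moreover have "isCont u 0" by (rule analytic_at_0_isCont [OF uan])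
  ultimately have "\<forall>\<^sub>F z in nhds 0. \<bar>real n * Im (Ln (u z))\<bar> < pi / 2 \<and> u z \<noteq> 0"
    unfolding isCont_def
    by (intro eventually_conj order_tendstoD(2) [of _ 0] tendsto_imp_eventually_ne [of u 1] tendsto_rabs_zero)
       (use u0 in \<open>auto simp: tendsto_nhds_iff\<close>)
  with h have "\<forall>\<^sub>F z in nhds 0. \<bar>real n * Im (Ln (u z))\<bar> < pi / 2 \<and> u z \<noteq> 0 \<and> h z = z * u z"
    by eventually_elim (simp add: u_def algebra_simps)
  then obtain \<delta>2 where \<delta>2: "\<delta>2 > 0" "\<And>z. norm z < \<delta>2 \<Longrightarrow> \<bar>real n * Im (Ln (u z))\<bar> < pi / 2 \<and> u z \<noteq> 0 \<and> h z = z * u z"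
    by (auto simp: eventually_nhds_metric)
  define \<delta>' where "\<delta>' = Min {\<delta>, \<delta>1, \<delta>2, r}"
  have \<delta>': "\<delta>' > 0" "\<delta>' \<le> \<delta>" "\<delta>' \<le> \<delta>1" "\<delta>' \<le> \<delta>2" "\<delta>' \<le> r"
    using assms(7) C(2) \<delta>2(1) r(1) by (auto simp: \<delta>'_def)
  obtain R where R: "R > 0" "\<And>w. Re w > R \<Longrightarrow> norm (chart n \<xi> w) < \<delta>'"
    using chart_small [OF n \<delta>'(1)] by blast
  have \<xi>0: "\<xi> \<noteq> 0" using \<xi> k n by (auto simp: power_0_left)
  define E where "E = e \<circ> chart n \<xi>"
  show thesis
  proof (rule that)
    show "R > 0" by fact
    show "C * norm \<xi> > 0" using C \<xi>0 by simp
    show "E holomorphic_on {w. Re w > R}"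
      unfolding E_def using R \<delta>'
      by (intro holomorphic_on_compose_gen [OF chart_holomorphic r(2)]) force+
    show "norm (chart n \<xi> w) < \<delta>" if "Re w > R" for w
      using R(2)[OF that] \<delta>' by simp
    show "norm (E w) \<le> C * norm \<xi> * norm w powr (- 1 / real n)" if "Re w > R" for w
    proof -
      have "w \<noteq> 0" using that R by auto
      then show ?thesis
        using C(3)[of "chart n \<xi> w"] R(2)[OF that] \<delta>' by (simp add: E_def norm_chart)
    qed
    show "h (chart n \<xi> w) = chart n \<xi> (w + 1 + E w)" if "Re w > R" for w
    proof -
      define z where "z = chart n \<xi> w"
      have w: "Re w > 0" "w \<noteq> 0" using that R by auto
      have z: "norm z < \<delta>2" using R(2)[OF that] \<delta>' by (simp add: z_def)
      note d = \<delta>2(2)[OF z]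
      have zn: "w * z ^ n = - 1 / (of_nat n * a)"
        using chart_power [OF n w(2), of \<xi>] w \<xi> by (simp add: z_def)
      have "u z ^ n - 1 = (u z - 1) * (\<Sum>j<n. u z ^ j)"
        by (rule power_diff_1_eq)
      then have "w * (1 - u z ^ n) = - (w * z ^ n) * (k z * (\<Sum>j<n. u z ^ j))"
        by (simp add: u_def algebra_simps)
      also have "\<dots> = (k z * (\<Sum>j<n. u z ^ j)) / (of_nat n * a)"
        by (simp add: zn)
      finally have *: "w * (1 - u z ^ n) = (k z * (\<Sum>j<n. u z ^ j)) / (of_nat n * a)" .
      have "w / u z ^ n - w = w * (1 - u z ^ n) / u z ^ n"
        using d by (simp add: field_simps)
      then have "w / u z ^ n = w + 1 + E w"
        using * by (simp add: E_def e_def z_def [symmetric] field_simps)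
      moreover have "chart n \<xi> (w / u z ^ n) = z * u z"
        using chart_mult [OF n w(1)] d by (simp add: z_def)
      ultimately show ?thesis using d by (simp add: z_def)
    qed
  qed
qed

section \<open>Distortion of iterates of a near-translation of a half-plane\<close>

lemma exp_minus_double_le:
  fixes x :: real assumes "0 \<le> x" "x \<le> 1/2"
  shows "exp (- 2 * x) \<le> 1 - x"
proof -
  have "- x - 2 * x\<^sup>2 \<le> ln (1 - x)"
    by (rule ln_one_minus_pos_lower_bound) (use assms in auto)
  moreover have "x\<^sup>2 \<le> x / 2"
    using mult_left_mono [OF assms(2,1)] by (simp add: power2_eq_square)
  ultimately have "- 2 * x \<le> ln (1 - x)" by simp
  then show ?thesis using assms by (simp add: ln_ge_iff)
qed

lemma powr_half:
  fixes x s :: real assumes "x > 0"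
  shows "(x / 2) powr (- s) = x powr (- s) * 2 powr s"
  using assms by (simp add: powr_divide powr_minus field_simps)

text \<open>Cauchy's inequality on discs of radius half the real part bounds the derivative of
  \<open>E\<close> by a multiple of x^(-1-\<gamma>). Real parts grow by at least 1/2 per step, so
  the Lipschitz constants \<open>a m\<close> along orbits are summable, and the products of 1 +
  \<open>a m\<close> and of 1 - \<open>a m\<close> stay bounded and bounded away from 0.\<close>

lemma half_plane_iterates:
  fixes E :: "complex \<Rightarrow> complex" and R C \<gamma> :: real
  assumes "R > 0" "C > 0" "\<gamma> > 0" and holE: "E holomorphic_on {w. Re w > R}"
    and bound: "\<And>w. Re w > R \<Longrightarrow> norm (E w) \<le> C * norm w powr (- \<gamma>)"
  defines "H \<equiv> \<lambda>w. w + 1 + E w"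
  obtains R1 c B where "R1 > R" "c > 0"
    "\<And>w m. Re w > R1 \<Longrightarrow> Re ((H ^^ m) w) \<ge> Re w + m / 2"
    "\<And>w w' m. Re w > R1 \<Longrightarrow> Re w' > R1 \<Longrightarrow> c * norm (w - w') \<le> norm ((H ^^ m) w - (H ^^ m) w')"
    "\<And>w w' m. Re w > R1 \<Longrightarrow> Re w' > R1 \<Longrightarrow> norm ((H ^^ m) w - (H ^^ m) w') \<le> B * norm (w - w')"
proof -
  \<comment> \<open>Cauchy's inequality divides by the radius x/2 and uses the bound on
    \<open>E\<close> at real part x/2, which yields the factors 2 and 2^\<gamma>.\<close>
  define D where "D = C * 2 powr (1 + \<gamma>)"
  define Lp where "Lp = (\<lambda>x. D * x powr (- (1 + \<gamma>)))"
  have D: "D > 0" using assms by (simp add: D_def)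
  have Lp_anti: "Lp y \<le> Lp x" if "0 < x" "x \<le> y" for x y
    unfolding Lp_def using that D \<open>\<gamma> > 0\<close> by (intro mult_left_mono powr_mono2') auto
  have der: "norm (deriv E w) \<le> Lp x" if "x > 2 * R" "Re w \<ge> x" for x w
  proof -
    have x: "x > 0" using that assms by simp
    have sub: "cball w (x/2) \<subseteq> {w. Re w > R} \<inter> {w. Re w \<ge> x/2}"
    proof
      fix z assume "z \<in> cball w (x/2)"
      then have "norm (w - z) \<le> x/2" by (simp add: dist_norm)
      then have "Re (w - z) \<le> x/2" using complex_Re_le_cmod order_trans by blast
      then show "z \<in> {w. Re w > R} \<inter> {w. Re w \<ge> x/2}" using that by auto
    qed
    have "norm ((deriv ^^ 1) E w) \<le> fact 1 * (C * (x/2) powr (-\<gamma>)) / (x/2) ^ 1"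
    proof (rule Cauchy_inequality)
      show "E holomorphic_on ball w (x/2)"
        using holE by (rule holomorphic_on_subset) (use sub ball_subset_cball in blast)
      show "continuous_on (cball w (x/2)) E"
        by (intro holomorphic_on_imp_continuous_on holomorphic_on_subset [OF holE]) (use sub in blast)
      show "x/2 > 0" using x by simp
      fix z assume "norm (w - z) = x/2"
      then have "z \<in> cball w (x/2)" by (simp add: dist_norm)
      then have z: "Re z > R" "Re z \<ge> x/2" using sub by auto
      have "norm (E z) \<le> C * norm z powr (-\<gamma>)" using bound z by blast
      also have "\<dots> \<le> C * (x/2) powr (-\<gamma>)"
        using z x assms complex_Re_le_cmod [of z] by (intro mult_left_mono powr_mono2') auto
      finally show "norm (E z) \<le> C * (x/2) powr (-\<gamma>)" .
    qed
    also have "fact 1 * (C * (x/2) powr (-\<gamma>)) / (x/2) ^ 1 = Lp x"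
    proof -
      have "- (1 + \<gamma>) = - \<gamma> - 1" by simp
      then have "(x/2) powr (-\<gamma>) / (x/2) = (x/2) powr (-(1+\<gamma>))"
        using x powr_diff [of "x/2" "-\<gamma>" 1] by (simp only:) simp
      also have "\<dots> = x powr (-(1+\<gamma>)) * 2 powr (1+\<gamma>)"
        by (rule powr_half) (use x in simp)
      finally have eq: "(x/2) powr (-\<gamma>) / (x/2) = x powr (-(1+\<gamma>)) * 2 powr (1+\<gamma>)" .
      have "fact 1 * (C * (x/2) powr (-\<gamma>)) / (x/2) ^ 1 = C * ((x/2) powr (-\<gamma>) / (x/2))"
        by simp
      then show ?thesis unfolding Lp_def D_def eq by (simp only: mult_ac)
    qed
    finally show ?thesis by simp
  qed
  have Lip: "norm (E w - E w') \<le> Lp x * norm (w - w')" if "x > 2 * R" "Re w \<ge> x" "Re w' \<ge> x" for x w w'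
  proof (rule field_differentiable_bound [where S = "{w. Re w \<ge> x}"])
    show "convex {w. Re w \<ge> x}" by (rule convex_halfspace_Re_ge)
    fix z assume "z \<in> {w. Re w \<ge> x}"
    then have "Re z \<ge> x" by simp
    then have zR: "Re z > R" using that(1) \<open>R > 0\<close> by linarith
    show "(E has_field_derivative deriv E z) (at z within {w. Re w \<ge> x})"
      by (rule has_field_derivative_at_within [OF holomorphic_derivI [OF holE open_halfspace_Re_gt]]) (use zR in simp)
    show "norm (deriv E z) \<le> Lp x" by (rule der [OF that(1) \<open>Re z \<ge> x\<close>])
  qed (use that in auto)
  have "((\<lambda>x. C * x powr (- \<gamma>)) \<longlongrightarrow> C * 0) at_top"
    using \<open>\<gamma> > 0\<close> by (intro tendsto_intros tendsto_neg_powr filterlim_ident) auto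
  then have e1: "\<forall>\<^sub>F x in at_top. C * x powr (- \<gamma>) < 1/2" by (rule order_tendstoD) simp
  have "((\<lambda>x. Lp x) \<longlongrightarrow> D * 0) at_top"
    unfolding Lp_def using \<open>\<gamma> > 0\<close> by (intro tendsto_intros tendsto_neg_powr filterlim_ident) auto
  then have e2: "\<forall>\<^sub>F x in at_top. Lp x < 1/2" by (rule order_tendstoD) simp
  \<comment> \<open>\<open>2 * R\<close> leaves room for the Cauchy discs, and \<open>R1 > 1\<close>
    allows comparison with the series of \<open>Suc m powr (- (1 + \<gamma>))\<close>. The third
    bound makes every step advance by 1/2; the fourth gives \<open>a m \<le> 1/2\<close>, as
    \<open>exp_minus_double_le\<close> requires.\<close>
  obtain R1 where R1: "R1 > 2 * R" "R1 > 1" "C * R1 powr (- \<gamma>) < 1/2" "Lp R1 < 1/2"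
    using eventually_happens [OF eventually_conj [OF e1 eventually_conj [OF e2
      eventually_conj [OF eventually_gt_at_top [of "2*R"] eventually_gt_at_top [of 1]]]]]
    by auto
  define a where "a = (\<lambda>m::nat. Lp (R1 + m / 2))"
  have a_nonneg: "a m \<ge> 0" for m using D by (simp add: a_def Lp_def)
  have a_le: "a m \<le> 1/2" for m
    using Lp_anti [of R1 "R1 + m/2"] R1 by (simp add: a_def)
  have "summable (\<lambda>m::nat. of_nat m powr (- (1 + \<gamma>)) :: real)"
    using \<open>\<gamma> > 0\<close> by (simp add: summable_real_powr_iff)
  then have "summable (\<lambda>m::nat. of_nat (Suc m) powr (- (1 + \<gamma>)) :: real)"
    by (subst summable_Suc_iff)
  then have sum_g: "summable (\<lambda>m. D * 2 powr (1 + \<gamma>) * (of_nat (Suc m) powr (- (1 + \<gamma>)) :: real))"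
    by (rule summable_mult)
  have a_le_g: "norm (a m) \<le> D * 2 powr (1 + \<gamma>) * (of_nat (Suc m) powr (- (1 + \<gamma>)))" for m
  proof -
    have "a m \<le> Lp (Suc m / 2)"
      unfolding a_def using R1 by (intro Lp_anti) auto
    also have "\<dots> = D * 2 powr (1 + \<gamma>) * (of_nat (Suc m) powr (- (1 + \<gamma>)))"
      unfolding Lp_def by (subst powr_half) (simp_all add: mult_ac)
    finally show ?thesis using a_nonneg by simp
  qed
  have sum_a: "summable a"
    by (rule summable_comparison_test' [OF sum_g, of 0]) (rule a_le_g)
  have sum_le: "sum a {..<m} \<le> suminf a" for m
    using sum_a a_nonneg by (intro sum_le_suminf) auto
  have re_step: "Re (H w) \<ge> Re w + 1/2" if "Re w > R1" for w
  proof -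
    have "Re w > R" using that R1 \<open>R > 0\<close> by linarith
    then have "norm (E w) \<le> C * norm w powr (- \<gamma>)" by (rule bound)
    also have "\<dots> \<le> C * R1 powr (- \<gamma>)"
      using that R1 assms complex_Re_le_cmod [of w] by (intro mult_left_mono powr_mono2') auto
    finally have "\<bar>Re (E w)\<bar> \<le> 1/2" using R1 abs_Re_le_cmod [of "E w"] by linarith
    then show ?thesis by (simp add: H_def)
  qed
  have re: "Re ((H ^^ m) w) \<ge> Re w + m / 2" if "Re w > R1" for w m
  proof (induction m)
    case (Suc m)
    then have "Re ((H ^^ m) w) > R1" using that by linarith
    from re_step [OF this] Suc show ?case by (simp add: field_simps)
  qed simp
  have step: "norm (E ((H ^^ m) w) - E ((H ^^ m) w')) \<le> a m * norm ((H ^^ m) w - (H ^^ m) w')"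
    if "Re w > R1" "Re w' > R1" for w w' m
    unfolding a_def using re [OF that(1), of m] re [OF that(2), of m] that R1
    by (intro Lip) auto
  show thesis
  proof (rule that)
    show "R1 > R" using R1 \<open>R > 0\<close> by linarith
    show "exp (- 2 * suminf a) > 0" by simp
    show "Re ((H ^^ m) w) \<ge> Re w + m / 2" if "Re w > R1" for w m
      by (rule re [OF that])
    fix w w' m assume w: "Re w > R1" "Re w' > R1"
    have "norm ((H ^^ m) w - (H ^^ m) w') \<le> exp (sum a {..<m}) * norm (w - w')"
    proof (induction m)
      case (Suc m)
      let ?u = "(H ^^ m) w" and ?v = "(H ^^ m) w'"
      have "norm (H ?u - H ?v) = norm ((?u - ?v) + (E ?u - E ?v))"
        by (simp add: H_def algebra_simps)
      also have "\<dots> \<le> norm (?u - ?v) + a m * norm (?u - ?v)"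
        using step [OF w] by (meson add_left_mono norm_triangle_ineq order_trans)
      also have "\<dots> = (1 + a m) * norm (?u - ?v)" by (simp add: algebra_simps)
      also have "\<dots> \<le> exp (a m) * (exp (sum a {..<m}) * norm (w - w'))"
        using Suc a_nonneg [of m] by (intro mult_mono) (auto simp: add_nonneg_nonneg)
      finally show ?case by (simp add: exp_add algebra_simps)
    qed simp
    also have "\<dots> \<le> exp (suminf a) * norm (w - w')"
      using sum_le by (intro mult_right_mono) auto
    finally show "norm ((H ^^ m) w - (H ^^ m) w') \<le> exp (suminf a) * norm (w - w')" .
    have "exp (- 2 * suminf a) * norm (w - w') \<le> exp (- 2 * sum a {..<m}) * norm (w - w')"
      using sum_le by (intro mult_right_mono) auto
    also have "\<dots> \<le> norm ((H ^^ m) w - (H ^^ m) w')"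
    proof (induction m)
      case (Suc m)
      let ?u = "(H ^^ m) w" and ?v = "(H ^^ m) w'"
      have "exp (- 2 * sum a {..<Suc m}) * norm (w - w') = exp (- 2 * a m) * (exp (- 2 * sum a {..<m}) * norm (w - w'))"
        by (simp add: exp_add [symmetric] algebra_simps)
      also have "\<dots> \<le> (1 - a m) * norm (?u - ?v)"
        using Suc a_nonneg [of m] a_le [of m] exp_minus_double_le [of "a m"]
        by (intro mult_mono) auto
      also have "\<dots> = norm (?u - ?v) - a m * norm (?u - ?v)" by (simp add: algebra_simps)
      also have "\<dots> \<le> norm (?u - ?v) - norm (E ?u - E ?v)"
        using step [OF w, of m] by simp
      also have "\<dots> \<le> norm ((?u - ?v) + (E ?u - E ?v))"
        using norm_triangle_ineq4 [of "(?u - ?v) + (E ?u - E ?v)" "E ?u - E ?v"] by (simp add: algebra_simps)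
      also have "(?u - ?v) + (E ?u - E ?v) = (H ^^ Suc m) w - (H ^^ Suc m) w'"
        by (simp add: H_def algebra_simps)
      finally show ?case .
    qed simp
    finally show "exp (- 2 * suminf a) * norm (w - w') \<le> norm ((H ^^ m) w - (H ^^ m) w')" .
  qed
qed

text \<open>The iterate is open and injective and sends the boundary circle to distance at least
  \<open>c * \<rho>\<close> from the image of the centre. The radius does not depend on
  \<open>m\<close>: a hole of the invariant set never shrinks.\<close>

lemma iterates_cover_ball:
  fixes H :: "complex \<Rightarrow> complex" and R1 c :: real
  assumes hol: "H holomorphic_on {w. Re w > R1}" and "c > 0" "\<rho> > 0"
    and re: "\<And>w m. Re w > R1 \<Longrightarrow> Re ((H ^^ m) w) \<ge> Re w + m / 2"
    and low: "\<And>w w' m. Re w > R1 \<Longrightarrow> Re w' > R1 \<Longrightarrow> c * norm (w - w') \<le> norm ((H ^^ m) w - (H ^^ m) w')"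
    and sub: "cball p \<rho> \<subseteq> {w. Re w > R1}"
  shows "ball ((H ^^ m) p) (c * \<rho>) \<subseteq> (H ^^ m) ` cball p \<rho>"
proof (rule ball_subset_open_map_image)
  have holm: "(H ^^ m) holomorphic_on {w. Re w > R1}" for m
  proof (induction m)
    case (Suc m)
    have "(H ^^ m) ` {w. Re w > R1} \<subseteq> {w. Re w > R1}"
    proof clarsimp
      fix w assume "R1 < Re w"
      with re [OF this, of m] show "R1 < Re ((H ^^ m) w)" by linarith
    qed
    with Suc show ?case
      unfolding funpow.simps by (intro holomorphic_on_compose_gen [OF _ hol]) auto
  qed (simp add: id_def)
  have inj: "inj_on (H ^^ m) {w. Re w > R1}"
  proof (rule inj_onI)
    fix w w' assume "w \<in> {w. Re w > R1}" "w' \<in> {w. Re w > R1}" "(H ^^ m) w = (H ^^ m) w'"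
    then have "c * norm (w - w') \<le> 0" using low [of w w' m] by simp
    then show "w = w'" using \<open>c > 0\<close> by (simp add: mult_le_0_iff)
  qed
  show "continuous_on (closure (cball p \<rho>)) (H ^^ m)"
    using continuous_on_subset [OF holomorphic_on_imp_continuous_on [OF holm] sub] by simp
  show "open ((H ^^ m) ` interior (cball p \<rho>))"
    using order_trans [OF ball_subset_cball sub] unfolding interior_cball
    by (intro open_mapping_thm3 holomorphic_on_subset [OF holm] inj_on_subset [OF inj] open_ball)
  show "c * \<rho> \<le> norm ((H ^^ m) z - (H ^^ m) p)" if "z \<in> frontier (cball p \<rho>)" for z
  proof -
    have z: "norm (z - p) = \<rho>" using that \<open>\<rho> > 0\<close> by (simp add: dist_norm norm_minus_commute)
    then have "z \<in> cball p \<rho>" "p \<in> cball p \<rho>" using \<open>\<rho> > 0\<close> by (auto simp: dist_norm norm_minus_commute)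
    then have "Re z > R1" "Re p > R1" using sub by blast+
    then show ?thesis using low [of z p m] z by blast
  qed
qed (use assms in auto)

section \<open>Rigidity of invariant sets\<close>

lemma nth_iterate_ratio:
  fixes f :: "complex \<Rightarrow> complex"
  assumes "((\<lambda>z. f z / z) \<longlongrightarrow> l) (at 0)" "l \<noteq> 0"
  shows "((\<lambda>z. (f ^^ m) z / z) \<longlongrightarrow> l ^ m) (at 0)"
proof (induction m)
  case 0
  have "((\<lambda>z. 1 :: complex) \<longlongrightarrow> 1) (at (0::complex))" by simp
  then show ?case
    by (simp, rule Lim_transform_eventually) (auto simp: eventually_at_filter)
next
  case (Suc m)
  have fl: "filterlim (f ^^ m) (at 0) (at 0)"
    by (rule ratio_tendsto_nonzero_filterlim [OF Suc]) (use assms(2) in simp)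
  have "((\<lambda>z. f ((f ^^ m) z) / (f ^^ m) z) \<longlongrightarrow> l) (at 0)"
    using filterlim_compose [OF assms(1) fl] .
  then have "((\<lambda>z. f ((f ^^ m) z) / (f ^^ m) z * ((f ^^ m) z / z)) \<longlongrightarrow> l * l ^ m) (at 0)"
    by (intro tendsto_mult Suc)
  moreover have "\<forall>\<^sub>F z in at 0. (f ^^ m) z \<noteq> 0"
    using fl by (auto simp: filterlim_at eventually_conj_iff)
  then have "\<forall>\<^sub>F z in at 0. f ((f ^^ m) z) / (f ^^ m) z * ((f ^^ m) z / z) = (f ^^ Suc m) z / z"
    by (rule eventually_mono) auto
  ultimately show ?case
    unfolding power_Suc by (rule Lim_transform_eventually)
qed

lemma nth_iterate_invariant:
  fixes f :: "complex \<Rightarrow> complex"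
  assumes "((\<lambda>z. f z / z) \<longlongrightarrow> l) (at 0)" "l \<noteq> 0"
    and inv: "\<forall>\<^sub>F z in at 0. z \<in> S \<longrightarrow> f z \<in> S"
  shows "\<forall>\<^sub>F z in at 0. z \<in> S \<longrightarrow> (f ^^ m) z \<in> S"
proof (induction m)
  case (Suc m)
  have fl: "filterlim (f ^^ m) (at 0) (at 0)"
    by (rule ratio_tendsto_nonzero_filterlim [OF nth_iterate_ratio [OF assms(1,2)]]) (use assms(2) in simp)
  have "\<forall>\<^sub>F z in at 0. (f ^^ m) z \<in> S \<longrightarrow> f ((f ^^ m) z) \<in> S"
    using inv fl by (rule eventually_compose_filterlim)
  with Suc show ?case by eventually_elim auto
qed simp

text \<open>The irrational rotation turns any sequence in \<open>S\<close> tending to 0 into the chosen petal.\<close>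
lemma irrational_orbit_meets_petal:
  fixes f :: "complex \<Rightarrow> complex"
  assumes ratio: "((\<lambda>z. f z / z) \<longlongrightarrow> cis (2 * pi * \<alpha>)) (at 0)" and "\<alpha> \<notin> \<rat>"
    and inv: "\<forall>\<^sub>F z in at 0. z \<in> S \<longrightarrow> f z \<in> S" and "0 islimpt S"
    and "n \<ge> 1" "\<xi> \<noteq> 0"
  obtains w where "Re w > R" "chart n \<xi> w \<in> S"
proof -
  obtain z where z: "\<And>i. z i \<in> S - {0}" "z \<longlonglongrightarrow> 0"
    using \<open>0 islimpt S\<close> unfolding islimpt_sequential by blast
  have "\<forall>i. sgn (z i) \<in> sphere 0 1" using z(1) by (simp add: norm_sgn)
  then obtain u0 r where "u0 \<in> sphere 0 1" "strict_mono r" "((\<lambda>i. sgn (z i)) \<circ> r) \<longlonglongrightarrow> u0"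
    using compact_sphere [of "0::complex" 1] unfolding compact_def by meson
  then have u0: "norm u0 = 1" and r: "strict_mono r" "(\<lambda>i. sgn (z (r i))) \<longlonglongrightarrow> u0"
    by (simp_all add: o_def)
  \<comment> \<open>For \<open>v\<close> near 1, \<open>chart_mult\<close> applies, and
    \<open>w / v ^ n\<close> retains more than half of a positive real \<open>w\<close> in its real
    part.\<close>
  have "isCont (\<lambda>v. real n * Im (Ln v)) 1" "isCont (\<lambda>v::complex. v) 1" "isCont (\<lambda>v::complex. Re (1 / v ^ n)) 1"
    by (intro isCont_Re continuous_intros; simp)+
  then have "\<forall>\<^sub>F v in nhds 1. \<bar>real n * Im (Ln v)\<bar> < pi / 2 \<and> v \<noteq> 0 \<and> Re (1 / v ^ n) > 1 / 2"
    unfolding isCont_def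
    by (intro eventually_conj order_tendstoD(2) [of _ 0] order_tendstoD(1) [of _ 1]
        tendsto_imp_eventually_ne [of "\<lambda>v. v" 1] tendsto_rabs_zero)
       (auto simp: tendsto_nhds_iff)
  then obtain \<epsilon> where \<epsilon>: "\<epsilon> > 0" "\<And>v. norm (v - 1) < \<epsilon> \<Longrightarrow> \<bar>real n * Im (Ln v)\<bar> < pi / 2 \<and> v \<noteq> 0 \<and> Re (1 / v ^ n) > 1 / 2"
    by (auto simp: eventually_nhds_metric dist_norm)
  have "norm (sgn \<xi> / u0) = 1" using u0 \<open>\<xi> \<noteq> 0\<close> by (simp add: norm_divide norm_sgn)
  \<comment> \<open>The iterate of order \<open>l\<close> turns the limiting direction
    \<open>u0\<close> of the sequence almost into the direction of \<xi>, the axis of the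
    petal.\<close>
  then obtain l where l: "norm (cis (2 * pi * \<alpha>) ^ l - sgn \<xi> / u0) < \<epsilon>"
    using irrational_rotation_dense [OF \<open>\<alpha> \<notin> \<rat>\<close> _ \<open>\<epsilon> > 0\<close>] by blast
  define y where "y = (\<lambda>i. (f ^^ l) (z (r i)))"
  define t where "t = (\<lambda>i. norm (z (r i)) / norm \<xi>)"
  have zr: "(\<lambda>i. z (r i)) \<longlonglongrightarrow> 0"
    using LIMSEQ_subseq_LIMSEQ [OF z(2) r(1)] by (simp add: o_def)
  have zr0: "z (r i) \<noteq> 0" for i using z(1) by auto
  have fl: "filterlim (\<lambda>i. z (r i)) (at 0) sequentially"
    using zr zr0 by (simp add: filterlim_at)
  have "(\<lambda>i. y i / z (r i) * sgn (z (r i)) / sgn \<xi>) \<longlonglongrightarrow> cis (2 * pi * \<alpha>) ^ l * u0 / sgn \<xi>"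
    unfolding y_def
    by (intro tendsto_intros r(2) filterlim_compose [OF nth_iterate_ratio [OF ratio] fl])
       (use \<open>\<xi> \<noteq> 0\<close> in \<open>auto simp: sgn_zero_iff\<close>)
  then have "(\<lambda>i. norm (y i / z (r i) * sgn (z (r i)) / sgn \<xi> - 1)) \<longlonglongrightarrow> norm (cis (2 * pi * \<alpha>) ^ l * u0 / sgn \<xi> - 1)"
    by (intro tendsto_norm tendsto_diff tendsto_const)
  moreover have "norm (cis (2 * pi * \<alpha>) ^ l * u0 / sgn \<xi> - 1) < \<epsilon>"
  proof -
    have "cis (2 * pi * \<alpha>) ^ l * u0 / sgn \<xi> - 1 = (cis (2 * pi * \<alpha>) ^ l - sgn \<xi> / u0) * (u0 / sgn \<xi>)"
      using u0 \<open>\<xi> \<noteq> 0\<close> by (auto simp: field_simps sgn_zero_iff)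
    then show ?thesis using l u0 \<open>\<xi> \<noteq> 0\<close> by (simp add: norm_mult norm_divide norm_sgn)
  qed
  ultimately have ev1: "\<forall>\<^sub>F i in sequentially. norm (y i / z (r i) * sgn (z (r i)) / sgn \<xi> - 1) < \<epsilon>"
    by (rule order_tendstoD)
  have ev2: "\<forall>\<^sub>F i in sequentially. z (r i) \<in> S \<longrightarrow> (f ^^ l) (z (r i)) \<in> S"
    by (rule eventually_compose_filterlim [OF nth_iterate_invariant [OF ratio _ inv] fl]) simp
  have "(\<lambda>i. t i ^ n) \<longlonglongrightarrow> (norm (0::complex) / norm \<xi>) ^ n"
    unfolding t_def by (intro tendsto_intros zr) (use \<open>\<xi> \<noteq> 0\<close> in auto)
  then have ev3: "\<forall>\<^sub>F i in sequentially. t i ^ n < 1 / (2 * (\<bar>R\<bar> + 1))"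
    by (rule order_tendstoD) (use \<open>n \<ge> 1\<close> in \<open>simp add: power_0_left\<close>)
  obtain i where i: "norm (y i / z (r i) * sgn (z (r i)) / sgn \<xi> - 1) < \<epsilon>" "y i \<in> S" "t i ^ n < 1 / (2 * (\<bar>R\<bar> + 1))"
    using eventually_happens [OF eventually_conj [OF ev1 eventually_conj [OF ev2 ev3]]] z(1)
    unfolding y_def by auto
  \<comment> \<open>\<open>v\<close> compares \<open>y i\<close> with the point
    \<open>\<xi> * t i\<close> on the axis, which is the chart value at the positive real
    \<open>w0\<close> below.\<close>
  define v where "v = y i / z (r i) * sgn (z (r i)) / sgn \<xi>"
  have tpos: "t i > 0" using zr0 \<open>\<xi> \<noteq> 0\<close> by (simp add: t_def)
  have yv: "y i = \<xi> * of_real (t i) * v"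
    using zr0 [of i] \<open>\<xi> \<noteq> 0\<close> unfolding v_def t_def sgn_div_norm scaleR_conv_of_real by (simp add: field_simps)
  define w0 where "w0 = complex_of_real (1 / t i ^ n)"
  have "Ln w0 = of_real (ln (1 / t i ^ n))"
    unfolding w0_def using tpos by (intro Ln_of_real) simp
  also have "ln (1 / t i ^ n) = - real n * ln (t i)"
    using tpos by (simp add: ln_div ln_realpow)
  finally have "chart n \<xi> w0 = \<xi> * exp (of_real (ln (t i)))"
    using \<open>n \<ge> 1\<close> by (simp add: chart_def)
  then have c0: "chart n \<xi> w0 = \<xi> * of_real (t i)"
    using tpos by (simp only: exp_of_real exp_ln)
  have "Re w0 > 0" using tpos by (simp add: w0_def)
  have v: "\<bar>real n * Im (Ln v)\<bar> < pi / 2" "v \<noteq> 0" "Re (1 / v ^ n) > 1 / 2"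
    using \<epsilon>(2) [of v] i(1) unfolding v_def by blast+
  have "chart n \<xi> (w0 / v ^ n) = chart n \<xi> w0 * v"
    by (rule chart_mult [OF \<open>n \<ge> 1\<close> \<open>Re w0 > 0\<close> v(2,1)])
  then have "chart n \<xi> (w0 / v ^ n) = y i"
    by (simp only: c0 yv)
  moreover have "Re (w0 / v ^ n) > R"
  proof -
    have "w0 / v ^ n = of_real (1 / t i ^ n) * (1 / v ^ n)" by (simp add: w0_def)
    moreover have "Re (of_real s * X) = s * Re X" for s X by simp
    ultimately have "Re (w0 / v ^ n) = 1 / t i ^ n * Re (1 / v ^ n)" by (simp only:)
    also have "\<dots> \<ge> 1 / t i ^ n * (1/2)"
      using v(3) tpos by (intro mult_left_mono) auto
    finally have "Re (w0 / v ^ n) \<ge> 1 / (2 * t i ^ n)" by simp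
    moreover have "1 / (2 * t i ^ n) > R"
    proof -
      have "t i ^ n * (2 * (\<bar>R\<bar> + 1)) < 1" using i(3) by (simp add: field_simps)
      moreover have "R * (2 * t i ^ n) \<le> (\<bar>R\<bar> + 1) * (2 * t i ^ n)"
        using tpos by (intro mult_right_mono) auto
      ultimately have "R * (2 * t i ^ n) < 1"
        by (simp add: algebra_simps)
      then show ?thesis using tpos by (simp add: field_simps)
    qed
    ultimately show ?thesis by linarith
  qed
  ultimately show thesis using that i(2) by metis
qed

text \<open>\<open>Suc n\<close> is the order of the zero of h - id at 0; it is at least 2 because
  the multiplier is 1.\<close>

lemma tangent_to_identity_form:
  fixes h :: "complex \<Rightarrow> complex"
  assumes "h analytic_on {0}" "h 0 = 0" "deriv h 0 = 1" "\<not> (\<forall>\<^sub>F z in nhds 0. h z = z)"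
  obtains n k where "n \<ge> 1" "k analytic_on {0}" "k 0 \<noteq> 0" "\<forall>\<^sub>F z in nhds 0. h z = z + z ^ Suc n * k z"
proof -
  obtain r where r: "r > 0" "h holomorphic_on ball 0 r" using assms(1) by (rule analytic_at_0_D)
  define d where "d = (\<lambda>z. h z - z)"
  have hol: "d holomorphic_on ball 0 r" unfolding d_def by (intro holomorphic_intros r)
  have d0: "d 0 = 0" using assms by (simp add: d_def)
  have nc: "\<not> d constant_on ball 0 r"
  proof
    assume "d constant_on ball 0 r"
    then have "\<And>z. z \<in> ball 0 r \<Longrightarrow> d z = 0"
      using d0 r(1) unfolding constant_on_def by (metis centre_in_ball)
    moreover have "\<forall>\<^sub>F z in nhds 0. z \<in> ball (0::complex) r"
      by (rule eventually_nhds_in_open) (use r in auto)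
    ultimately have "\<forall>\<^sub>F z in nhds 0. h z = z"
      by (auto simp: d_def elim!: eventually_mono)
    then show False using assms(4) by contradiction
  qed
  have zero_in: "0 \<in> ball (0::complex) r" using r(1) by simp
  obtain k s m where k: "0 < m" "0 < s" "ball 0 s \<subseteq> ball (0::complex) r" "k holomorphic_on ball 0 s"
      "\<And>w. w \<in> ball 0 s \<Longrightarrow> d w = (w - 0) ^ m * k w" "\<And>w. w \<in> ball 0 s \<Longrightarrow> k w \<noteq> 0"
    by (rule holomorphic_factor_zero_nonconstant [OF hol open_ball connected_ball zero_in d0 nc]) (rule that, assumption+)
  have kan: "k analytic_on {0}"
    using k by (auto simp: analytic_on_def)
  have k0: "k 0 \<noteq> 0" using k by simp
  have "\<forall>\<^sub>F z in nhds 0. z \<in> ball (0::complex) s"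
    by (rule eventually_nhds_in_open) (use k(2) in auto)
  then have ev: "\<forall>\<^sub>F z in nhds 0. h z = z + z ^ m * k z"
  proof eventually_elim
    case (elim z)
    have "h z = z + d z" by (simp add: d_def)
    then show ?case using k(5) [OF elim] by simp
  qed
  have "m \<noteq> 1"
  proof
    assume "m = 1"
    have 1: "((\<lambda>z. h z / z) \<longlongrightarrow> 1) (at 0)"
      using analytic_at_0_ratio [OF assms(1,2)] assms(3) by simp
    have 2: "((\<lambda>z. 1 + k z) \<longlongrightarrow> 1 + k 0) (at 0)"
      using analytic_at_0_isCont [OF kan] by (intro tendsto_intros) (auto simp: isCont_def)
    have 3: "\<forall>\<^sub>F z in at 0. 1 + k z = h z / z"
      using ev unfolding eventually_at_filter
      by (rule eventually_mono) (simp add: \<open>m = 1\<close> field_simps)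
    have "1 + k 0 = 1"
      by (rule tendsto_unique [OF at_neq_bot Lim_transform_eventually [OF 2 3] 1])
    then show False using k0 by simp
  qed
  then obtain n where "m = Suc n" "n \<ge> 1"
    using k(1) by (cases m) auto
  then show thesis using that kan k0 ev by blast
qed

lemma eventually_at_0_of_nhds:
  "\<forall>\<^sub>F z in nhds (0::complex). P z \<Longrightarrow> \<forall>\<^sub>F z in at 0. P z \<and> z \<noteq> 0"
  by (simp add: eventually_at_filter eventually_mono)

lemma root_nonzero:
  fixes \<xi> a :: complex
  assumes "\<xi> ^ n = - 1 / (of_nat n * a)" "a \<noteq> 0" "n \<ge> 1"
  shows "\<xi> \<noteq> 0"
proof
  assume "\<xi> = 0"
  then have "\<xi> ^ n = 0" using assms(3) by simp
  then show False using assms by (simp del: power_eq_0_iff)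
qed

text \<open>Only the limit of the displacement of \<open>T\<close> is known, so in the chart it is a
  translation only asymptotically, along points tending to 0. The displacement c z^(n+1) becomes -n
  c \<xi>^n = c / a.\<close>

lemma tangent_map_in_chart:
  fixes T :: "complex \<Rightarrow> complex" and x :: "nat \<Rightarrow> complex"
  assumes T: "((\<lambda>z. (T z - z) / z ^ Suc n) \<longlongrightarrow> c) (at 0)" and n: "n \<ge> 1"
    and \<xi>: "\<xi> ^ n = - 1 / (of_nat n * a)" and "a \<noteq> 0"
    and x: "\<And>m. Re (x m) > 0" "(\<lambda>m. chart n \<xi> (x m)) \<longlonglongrightarrow> 0"
  obtains y where "(\<lambda>m. y m - x m) \<longlonglongrightarrow> c / a"
    "\<forall>\<^sub>F m in sequentially. T (chart n \<xi> (x m)) = chart n \<xi> (y m)"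
proof -
  define z where "z = (\<lambda>m. chart n \<xi> (x m))"
  define u where "u = (\<lambda>m. T (z m) / z m)"
  define y where "y = (\<lambda>m. x m / u m ^ n)"
  have \<xi>0: "\<xi> \<noteq> 0" by (rule root_nonzero [OF \<xi> \<open>a \<noteq> 0\<close> n])
  have z0: "z m \<noteq> 0" for m using \<xi>0 by (simp add: z_def chart_def)
  have fl: "filterlim z (at 0) sequentially"
    using x(2) z0 by (simp add: filterlim_at z_def)
  have u1: "u \<longlonglongrightarrow> 1"
    unfolding u_def using filterlim_compose [OF tangent_map_ratio [OF T n] fl] .
  have lim: "(\<lambda>m. (T (z m) - z m) / z m ^ Suc n) \<longlonglongrightarrow> c"
    using filterlim_compose [OF T fl] .
  have "isCont (\<lambda>v. real n * Im (Ln v)) 1"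
    by (intro continuous_intros) auto
  then have "(\<lambda>m. real n * Im (Ln (u m))) \<longlonglongrightarrow> real n * Im (Ln 1)"
    using u1 by (rule isCont_tendsto_compose)
  then have "\<forall>\<^sub>F m in sequentially. \<bar>real n * Im (Ln (u m))\<bar> < pi / 2"
    by (intro order_tendstoD(2) [of _ 0] tendsto_rabs_zero) auto
  moreover have u0: "\<forall>\<^sub>F m in sequentially. u m \<noteq> 0"
    using tendsto_imp_eventually_ne [OF u1] by simp
  ultimately have "\<forall>\<^sub>F m in sequentially. T (chart n \<xi> (x m)) = chart n \<xi> (y m)"
  proof eventually_elim
    case (elim m)
    have "chart n \<xi> (y m) = z m * u m"
      unfolding y_def z_def using chart_mult [OF n x(1)] elim by blast
    then show ?case using z0 by (simp add: u_def z_def)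
  qed
  moreover have "(\<lambda>m. y m - x m) \<longlonglongrightarrow> c / a"
  proof (rule Lim_transform_eventually)
    have "(\<lambda>m. (T (z m) - z m) / z m ^ Suc n * (\<Sum>j<n. u m ^ j) / (of_nat n * a * u m ^ n)) \<longlonglongrightarrow> c * (\<Sum>j<n. 1 ^ j) / (of_nat n * a * 1 ^ n)"
      using \<open>a \<noteq> 0\<close> n by (intro tendsto_intros lim u1) auto
    then show "(\<lambda>m. (T (z m) - z m) / z m ^ Suc n * (\<Sum>j<n. u m ^ j) / (of_nat n * a * u m ^ n)) \<longlonglongrightarrow> c / a"
      using n \<open>a \<noteq> 0\<close> by simp
    show "\<forall>\<^sub>F m in sequentially. (T (z m) - z m) / z m ^ Suc n * (\<Sum>j<n. u m ^ j) / (of_nat n * a * u m ^ n) = y m - x m"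
      using u0
    proof eventually_elim
      case (elim m)
      have x0: "x m \<noteq> 0" using x(1)[of m] by auto
      have zn: "x m * z m ^ n = - 1 / (of_nat n * a)"
        using chart_power [OF n x0, of \<xi>] x0 \<xi> by (simp add: z_def)
      have 1: "(T (z m) - z m) / z m ^ Suc n = (u m - 1) / z m ^ n"
        using z0 by (simp add: u_def field_simps)
      have 2: "u m ^ n - 1 = (u m - 1) * (\<Sum>j<n. u m ^ j)"
        by (rule power_diff_1_eq)
      have "(u m - 1) / z m ^ n * (\<Sum>j<n. u m ^ j) / (of_nat n * a * u m ^ n)
          = (u m ^ n - 1) / (z m ^ n * u m ^ n) * (1 / (of_nat n * a))"
        unfolding 2 by simp
      also have "1 / (of_nat n * a) = - (x m * z m ^ n)" using zn by simp
      also have "(u m ^ n - 1) / (z m ^ n * u m ^ n) * - (x m * z m ^ n) = y m - x m"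
        using z0 elim by (simp add: y_def field_simps)
      finally show ?case unfolding 1 .
    qed
  qed
  ultimately show thesis using that by blast
qed

theorem invariant_set_rigidity:
  fixes f g :: "complex \<Rightarrow> complex"
  assumes "closed K" "f analytic_on {0}" "g analytic_on {0}" "f 0 = 0" "g 0 = 0"
    and df: "deriv f 0 = cis (2 * pi * \<alpha>)" and dg: "deriv g 0 = deriv f 0" and "\<alpha> \<notin> \<rat>"
    and invf: "\<forall>\<^sub>F z in nhds 0. f z \<in> K \<longleftrightarrow> z \<in> K"
    and invg: "\<forall>\<^sub>F z in nhds 0. g z \<in> K \<longleftrightarrow> z \<in> K"
    and "0 islimpt K" "0 \<in> closure (- K)"
  shows "\<forall>\<^sub>F z in nhds 0. f z = g z"
proof (rule ccontr)
  assume neq: "\<not> ?thesis"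
  have df0: "deriv f 0 \<noteq> 0" and dg0: "deriv g 0 \<noteq> 0" using df dg by auto
  obtain gi where gi: "gi analytic_on {0}" "gi 0 = 0" "deriv gi 0 = inverse (deriv g 0)"
    "\<forall>\<^sub>F z in nhds 0. g (gi z) = z" "\<forall>\<^sub>F z in nhds 0. gi (g z) = z"
    by (rule analytic_local_inverse [OF assms(3,5) dg0])
  define h where "h = gi \<circ> f"
  have tf: "filterlim f (nhds 0) (nhds 0)" and tgi: "filterlim gi (nhds 0) (nhds 0)"
    using analytic_at_0_tendsto assms gi by blast+
  have han: "h analytic_on {0}"
    unfolding h_def using assms gi by (intro analytic_on_compose) auto
  have h0: "h 0 = 0" using gi assms by (simp add: h_def)
  have dh: "deriv h 0 = 1"
  proof -
    have "deriv h 0 = deriv gi (f 0) * deriv f 0"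
      unfolding h_def using assms gi by (intro deriv_chain) (auto intro: analytic_on_imp_differentiable_at)
    then show ?thesis by (simp add: assms(4) gi(3) dg df0)
  qed
  have hinv: "\<forall>\<^sub>F z in nhds 0. h z \<in> K \<longleftrightarrow> z \<in> K"
  proof -
    have a: "\<forall>\<^sub>F z in nhds 0. g (gi z) \<in> K \<longleftrightarrow> gi z \<in> K"
      by (rule eventually_compose_filterlim [OF invg tgi])
    have "\<forall>\<^sub>F z in nhds 0. z \<in> K \<longleftrightarrow> gi z \<in> K"
      using a gi(4) by eventually_elim simp
    then have "\<forall>\<^sub>F z in nhds 0. f z \<in> K \<longleftrightarrow> gi (f z) \<in> K"
      by (rule eventually_compose_filterlim [OF _ tf])
    then show ?thesis using invf unfolding h_def by eventually_elim simp
  qed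
  have "\<not> (\<forall>\<^sub>F z in nhds 0. h z = z)"
  proof
    assume "\<forall>\<^sub>F z in nhds 0. h z = z"
    moreover have "\<forall>\<^sub>F z in nhds 0. g (gi (f z)) = f z"
      by (rule eventually_compose_filterlim [OF gi(4) tf])
    ultimately have "\<forall>\<^sub>F z in nhds 0. f z = g z"
      unfolding h_def by eventually_elim simp
    then show False using neq by contradiction
  qed
  from tangent_to_identity_form [OF han h0 dh this]
  obtain n k where n: "n \<ge> 1" and k: "k analytic_on {0}" "k 0 \<noteq> 0"
    and hk: "\<forall>\<^sub>F z in nhds 0. h z = z + z ^ Suc n * k z" by blast
  define a where "a = k 0"
  have a0: "a \<noteq> 0" using k by (simp add: a_def)
  have base: "tangent_shift K n a"
    unfolding tangent_shift_def
  proof (intro exI conjI)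
    have "(k \<longlongrightarrow> a) (at 0)" using analytic_at_0_isCont [OF k(1)] by (simp add: isCont_def a_def)
    then show "((\<lambda>z. (h z - z) / z ^ Suc n) \<longlongrightarrow> a) (at 0)"
      by (rule Lim_transform_eventually) (rule eventually_mono [OF eventually_at_0_of_nhds [OF hk]], simp)
    show "\<forall>\<^sub>F z in at 0. z \<in> K \<longrightarrow> h z \<in> K"
      by (rule eventually_mono [OF eventually_at_0_of_nhds [OF hinv]]) simp
  qed
  obtain \<xi> where \<xi>: "\<xi> ^ n = - 1 / (of_nat n * a)"
    using exists_complex_root [of n "- 1 / (of_nat n * a)"] n by (metis not_one_le_zero)
  have \<xi>0: "\<xi> \<noteq> 0" by (rule root_nonzero [OF \<xi> a0 n])
  obtain \<delta> where \<delta>: "\<delta> > 0" "\<And>z. norm z < \<delta> \<Longrightarrow> h z \<in> K \<longleftrightarrow> z \<in> K"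
    using hinv unfolding eventually_nhds_metric dist_norm by (metis diff_zero)
  obtain R C E where E: "R > 0" "C > 0" "E holomorphic_on {w. Re w > R}"
    "\<And>w. Re w > R \<Longrightarrow> norm (chart n \<xi> w) < \<delta>"
    "\<And>w. Re w > R \<Longrightarrow> h (chart n \<xi> w) = chart n \<xi> (w + 1 + E w)"
    "\<And>w. Re w > R \<Longrightarrow> norm (E w) \<le> C * norm w powr (- 1 / real n)"
    by (rule parabolic_chart [OF k(1) a_def [symmetric] a0 n hk \<xi> \<delta>(1)]) (rule that)
  define H where "H = (\<lambda>w. w + 1 + E w)"
  have g1: "1 / real n > 0" using n by simp
  have g2: "norm (E w) \<le> C * norm w powr - (1 / real n)" if "Re w > R" for w
    using E(6) [OF that] by simp
  note iterates = half_plane_iterates [OF E(1,2) g1 E(3), folded H_def]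
  obtain R1 c B where R1: "R1 > R" "c > 0"
    and re: "\<And>w m. Re w > R1 \<Longrightarrow> Re ((H ^^ m) w) \<ge> Re w + m / 2"
    and low: "\<And>w w' m. Re w > R1 \<Longrightarrow> Re w' > R1 \<Longrightarrow> c * norm (w - w') \<le> norm ((H ^^ m) w - (H ^^ m) w')"
    and up: "\<And>w w' m. Re w > R1 \<Longrightarrow> Re w' > R1 \<Longrightarrow> norm ((H ^^ m) w - (H ^^ m) w') \<le> B * norm (w - w')"
    by (rule iterates) (assumption | rule g2 | rule that)+
  have holH: "H holomorphic_on {w. Re w > R1}"
    unfolding H_def using R1 by (intro holomorphic_intros holomorphic_on_subset [OF E(3)]) auto
  have inv: "chart n \<xi> ((H ^^ m) w) \<in> K \<longleftrightarrow> chart n \<xi> w \<in> K" if "Re w > R1" for w m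
  proof (induction m)
    case (Suc m)
    have r: "Re ((H ^^ m) w) > R" using re [OF that, of m] that R1 by linarith
    have "chart n \<xi> ((H ^^ Suc m) w) = h (chart n \<xi> ((H ^^ m) w))"
      using E(5) [OF r] by (simp add: H_def)
    then show ?case using Suc \<delta>(2) E(4) [OF r] by simp
  qed simp
  have ratio: "((\<lambda>z. f z / z) \<longlongrightarrow> cis (2 * pi * \<alpha>)) (at 0)"
    using analytic_at_0_ratio [OF assms(2,4)] df by simp
  obtain wk where wk: "Re wk > R1" "chart n \<xi> wk \<in> K"
  proof (rule irrational_orbit_meets_petal [OF ratio \<open>\<alpha> \<notin> \<rat>\<close> _ \<open>0 islimpt K\<close> n \<xi>0])
    show "\<forall>\<^sub>F z in at 0. z \<in> K \<longrightarrow> f z \<in> K"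
      by (rule eventually_mono [OF eventually_at_0_of_nhds [OF invf]]) simp
  qed
  \<comment> \<open>As 0 belongs to \<open>K\<close>, the complement can have 0 in its closure only
    as a limit point, which is the form needed to bring points of the complement into the
    petal.\<close>
  have "0 \<in> K" using \<open>0 islimpt K\<close> \<open>closed K\<close> by (simp add: closed_limpt)
  then have lim': "0 islimpt (- K)" using \<open>0 \<in> closure (- K)\<close> by (simp add: closure_def)
  obtain wp where wp: "Re wp > R1" "chart n \<xi> wp \<in> - K"
  proof (rule irrational_orbit_meets_petal [OF ratio \<open>\<alpha> \<notin> \<rat>\<close> _ lim' n \<xi>0])
    show "\<forall>\<^sub>F z in at 0. z \<in> - K \<longrightarrow> f z \<in> - K"
      by (rule eventually_mono [OF eventually_at_0_of_nhds [OF invf]]) simp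
  qed
  have R10: "R1 \<ge> 0" using R1 E by linarith
  have "open {w. Re w > R1}" by (rule open_halfspace_Re_gt)
  moreover have "continuous_on {w. Re w > R1} (chart n \<xi>)"
    by (intro holomorphic_on_imp_continuous_on chart_holomorphic R10)
  ultimately have "open ({w. Re w > R1} \<inter> chart n \<xi> -` (- K))"
    using \<open>closed K\<close> continuous_open_preimage by blast
  then obtain \<rho> where \<rho>: "\<rho> > 0" "cball wp \<rho> \<subseteq> {w. Re w > R1} \<inter> chart n \<xi> -` (- K)"
    using wp open_contains_cball by (metis (no_types, lifting) IntI mem_Collect_eq vimageI)
  have hole: "chart n \<xi> w \<notin> K" if w: "w \<in> ball ((H ^^ m) wp) (c * \<rho>)" for m w
  proof -
    have "ball ((H ^^ m) wp) (c * \<rho>) \<subseteq> (H ^^ m) ` cball wp \<rho>"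
      using \<rho> by (intro iterates_cover_ball [OF holH R1(2) \<rho>(1) re low]) auto
    then obtain v where v: "v \<in> cball wp \<rho>" "w = (H ^^ m) v" using w by blast
    then have "Re v > R1" "chart n \<xi> v \<notin> K" using \<rho>(2) by blast+
    then show ?thesis using inv [of v m] v(2) by simp
  qed
  \<comment> \<open>The upper distortion bound keeps the vector from the point of \<open>K\<close>
    to the centre of the hole bounded. Passing to a limit \<tau> fixes one target, so a single
    \<open>T\<close> works for all late times.\<close>
  define d where "d = (\<lambda>m. (H ^^ m) wp - (H ^^ m) wk)"
  have "bounded (range d)"
    unfolding bounded_iff d_def using up [OF wp(1) wk(1)] by auto
  then obtain \<tau> r where r: "strict_mono r" "(d \<circ> r) \<longlonglongrightarrow> \<tau>"
    using bounded_imp_convergent_subsequence by blast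
  define S where "S = {c. tangent_shift K n c}"
  have "of_int (int n) * \<alpha> \<notin> \<rat>"
    using \<open>\<alpha> \<notin> \<rat>\<close> n by (metis Rats_divide Rats_of_int nonzero_mult_div_cancel_left of_int_of_nat_eq of_nat_0_eq_iff not_one_le_zero)
  then have irr: "- (real n * \<alpha>) \<notin> \<rat>" by simp
  have "a \<in> S" using base by (simp add: S_def)
  moreover have "c + d \<in> S" if "c \<in> S" "d \<in> S" for c d
    using that tangent_shift_add n by (auto simp: S_def)
  moreover have "cis (2 * pi * - (real n * \<alpha>)) * c \<in> S" if "c \<in> S" for c
  proof -
    have "inverse (deriv f 0) ^ n = cis (2 * pi * - (real n * \<alpha>))"
      unfolding df cis_inverse Complex.DeMoivre by (simp add: algebra_simps)
    then show ?thesis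
      using tangent_shift_conj [OF assms(2,4) df0 invf, of n c] that n by (simp add: S_def)
  qed
  \<comment> \<open>A shift \<open>b\<close> translates the chart by b / a, so hitting a hole of
    radius \<open>c * \<rho>\<close> allows an error of \<open>norm a\<close> times that radius in
    \<open>b\<close>.\<close>
  moreover have "norm a * (c * \<rho>) > 0" using a0 R1 \<rho> by simp
  ultimately obtain b where b: "b \<in> S" "norm (b - \<tau> * a) < norm a * (c * \<rho>)"
    using rotation_invariant_semigroup_dense [OF irr a0, of S "norm a * (c * \<rho>)" "\<tau> * a"] by blast
  obtain T where T: "((\<lambda>z. (T z - z) / z ^ Suc n) \<longlongrightarrow> b) (at 0)" "\<forall>\<^sub>F z in at 0. z \<in> K \<longrightarrow> T z \<in> K"
    using b(1) unfolding S_def tangent_shift_def by blast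
  define x where "x = (\<lambda>i. (H ^^ r i) wk)"
  have xre: "Re (x i) \<ge> Re wk + real i / 2" for i
    using re [OF wk(1), of "r i"] seq_suble [OF r(1), of i] unfolding x_def by linarith
  have xpos: "Re (x i) > 0" for i using xre [of i] wk R10 by linarith
  have xlim: "(\<lambda>i. chart n \<xi> (x i)) \<longlonglongrightarrow> 0"
  proof (rule tendstoI)
    fix e :: real assume "e > 0"
    then obtain R2 where R2: "\<And>w. Re w > R2 \<Longrightarrow> norm (chart n \<xi> w) < e"
      using chart_small [OF n] by metis
    have "\<forall>\<^sub>F i in sequentially. real i > 2 * (R2 - Re wk)"
      using filterlim_real_sequentially by (simp add: filterlim_at_top_dense)
    then show "\<forall>\<^sub>F i in sequentially. dist (chart n \<xi> (x i)) 0 < e"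
    proof eventually_elim
      case (elim i)
      have "R2 < Re wk + real i / 2" using elim by (simp add: field_simps)
      then have "Re (x i) > R2" using xre [of i] by (rule less_le_trans)
      then show ?case using R2 by simp
    qed
  qed
  obtain y where y: "(\<lambda>i. y i - x i) \<longlonglongrightarrow> b / a"
    "\<forall>\<^sub>F i in sequentially. T (chart n \<xi> (x i)) = chart n \<xi> (y i)"
    using tangent_map_in_chart [OF T(1) n \<xi> a0 xpos xlim] by blast
  have fl: "filterlim (\<lambda>i. chart n \<xi> (x i)) (at 0) sequentially"
    using xlim \<xi>0 by (auto simp: filterlim_at chart_def)
  have ev1: "\<forall>\<^sub>F i in sequentially. chart n \<xi> (x i) \<in> K \<longrightarrow> T (chart n \<xi> (x i)) \<in> K"
    by (rule eventually_compose_filterlim [OF T(2) fl])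
  have "(\<lambda>i. norm ((y i - x i) - (d \<circ> r) i)) \<longlonglongrightarrow> norm (b / a - \<tau>)"
    by (intro tendsto_intros y r)
  moreover have "norm (b / a - \<tau>) < c * \<rho>"
  proof -
    have "norm (b / a - \<tau>) = norm (b - \<tau> * a) / norm a"
      using a0 by (simp add: norm_divide [symmetric] field_simps)
    then show ?thesis using b(2) a0 by (simp add: divide_less_eq mult.commute)
  qed
  ultimately have ev2: "\<forall>\<^sub>F i in sequentially. norm ((y i - x i) - (d \<circ> r) i) < c * \<rho>"
    by (rule order_tendstoD)
  obtain i where i: "chart n \<xi> (x i) \<in> K \<longrightarrow> T (chart n \<xi> (x i)) \<in> K"
    "norm ((y i - x i) - (d \<circ> r) i) < c * \<rho>" "T (chart n \<xi> (x i)) = chart n \<xi> (y i)"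
    using eventually_happens' [OF sequentially_bot eventually_conj [OF ev1 eventually_conj [OF ev2 y(2)]]] by blast
  have "y i \<in> ball ((H ^^ r i) wp) (c * \<rho>)"
    using i(2) by (simp add: d_def x_def dist_norm norm_minus_commute algebra_simps)
  then have "chart n \<xi> (y i) \<notin> K" by (rule hole)
  moreover have "chart n \<xi> (x i) \<in> K"
    unfolding x_def using inv wk by blast
  ultimately show False using i by simp
qed

section \<open>Small Siegel compacta: linking numbers of cycles\<close>

text \<open>The bound 1/2 in \<open>quot\<close> confines the normalized difference quotients to the
  right half-plane. This gives injectivity of \<open>f\<close> and a continuous principal logarithm
  of these quotients.\<close>

locale disc_map =
  fixes f :: "complex \<Rightarrow> complex" and \<alpha> r R :: real
  assumes r: "0 < r" "r < R" and holf: "f holomorphic_on ball 0 R" and f0: "f 0 = 0"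
    and deriv0: "deriv f 0 = cis (2 * pi * \<alpha>)"
    and quot: "\<And>z w. z \<in> ball 0 R \<Longrightarrow> w \<in> ball 0 R \<Longrightarrow> z \<noteq> w \<Longrightarrow>
      norm ((f z - f w) / (cis (2 * pi * \<alpha>) * (z - w)) - 1) \<le> 1 / 2"
begin

definition P :: "complex \<Rightarrow> complex" where "P = closest_point (cball 0 r)"

text \<open>\<open>F t\<close> is the germ \<open>f\<close> with its rotation number changed to \<open>t\<close>; precomposing with
  the retraction \<open>P\<close> onto the disc makes all iterates total and continuous.\<close>
definition F :: "real \<Rightarrow> complex \<Rightarrow> complex" where "F t z = cis (2 * pi * (t - \<alpha>)) * f (P z)"

text \<open>The imaginary part records how far \<open>f\<close> turns the chord from w to z,
  relative to the rotation by \<alpha>. The value 0 at z = w = 0 is the true limit, as the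
  multiplier there is exactly \<open>cis (2 * pi * \<alpha>)\<close>; at other diagonal points it is
  a mere default, so joint continuity is used only off the diagonal.\<close>

definition L :: "complex \<Rightarrow> complex \<Rightarrow> complex" where
  "L z w = (if z = w then 0 else Ln ((f z - f w) / (cis (2 * pi * \<alpha>) * (z - w))))"

lemma P_in: "P z \<in> cball 0 r"
  unfolding P_def using r(1) by (intro closest_point_in_set) auto

lemma P_id: "z \<in> cball 0 r \<Longrightarrow> P z = z"
  unfolding P_def by (rule closest_point_self)

lemma P_cont: "continuous_on S P"
  unfolding P_def using r(1) by (intro continuous_on_closest_point) auto

lemma P_ball: "P z \<in> ball 0 R"
  using P_in [of z] r by auto

lemma f_cont: "continuous_on (ball 0 R) f"
  using holf by (rule holomorphic_on_imp_continuous_on)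

lemma cball_ball: "z \<in> cball 0 r \<Longrightarrow> z \<in> ball 0 R"
  using r by auto

lemma f_inj: "inj_on f (ball 0 R)"
proof (rule inj_onI)
  fix z w assume "z \<in> ball 0 R" "w \<in> ball 0 R" "f z = f w"
  with quot [of z w] show "z = w" by (cases "z = w") auto
qed

lemma F_eq: "z \<in> cball 0 r \<Longrightarrow> F t z = cis (2 * pi * (t - \<alpha>)) * f z"
  by (simp add: F_def P_id)

lemma F_alpha: "z \<in> cball 0 r \<Longrightarrow> F \<alpha> z = f z"
  by (simp add: F_eq)

lemma F_0 [simp]: "F t 0 = 0"
  using r by (simp add: F_eq f0)

lemma Fn_0 [simp]: "(F t ^^ j) 0 = 0"
  by (induction j) auto

lemma F_cont: "continuous_on UNIV (\<lambda>x. F (fst x) (snd x))"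
proof -
  have "continuous_on UNIV (\<lambda>x. f (P (snd x)))"
    by (rule continuous_on_compose2 [OF f_cont continuous_on_compose2 [OF P_cont continuous_on_snd]])
       (use P_ball in \<open>auto intro: continuous_intros\<close>)
  then show ?thesis
    unfolding F_def cis_conv_exp by (intro continuous_intros)
qed

lemma Fn_cont: "continuous_on UNIV (\<lambda>x. (F (fst x) ^^ j) (snd x))"
proof (induction j)
  case 0 show ?case by (simp add: continuous_intros)
next
  case (Suc j)
  have "continuous_on UNIV (\<lambda>x. (fst x, (F (fst x) ^^ j) (snd x)))"
    by (intro continuous_intros Suc)
  from continuous_on_compose2 [OF F_cont this] show ?case by simp
qed

lemma Fn_cont_snd: "continuous_on UNIV (F t ^^ j)"
proof -
  have "continuous_on UNIV (\<lambda>z. (t, z))" by (intro continuous_intros)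
  from continuous_on_compose2 [OF Fn_cont this] show ?thesis by simp
qed

lemma quotient_Re:
  assumes "z \<in> ball 0 R" "w \<in> ball 0 R" "z \<noteq> w"
  shows "Re ((f z - f w) / (cis (2 * pi * \<alpha>) * (z - w))) > 0"
proof -
  have "\<bar>Re ((f z - f w) / (cis (2 * pi * \<alpha>) * (z - w)) - 1)\<bar> \<le> 1 / 2"
    using quot [OF assms] abs_Re_le_cmod order_trans by blast
  then have "\<bar>Re ((f z - f w) / (cis (2 * pi * \<alpha>) * (z - w))) - 1\<bar> \<le> 1 / 2" by simp
  then show ?thesis by linarith
qed

text \<open>Adding 2 pi i t outside the principal logarithm gives an exponent continuous in the real
  number t, not merely in t modulo 1. Turns can thus be counted consistently while t varies.\<close>

lemma exp_L:
  assumes "z \<in> cball 0 r" "w \<in> cball 0 r" "z \<noteq> w"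
  shows "F t z - F t w = (z - w) * exp (L z w + 2 * pi * \<i> * t)"
proof -
  let ?q = "(f z - f w) / (cis (2 * pi * \<alpha>) * (z - w))"
  have "?q \<noteq> 0" using quotient_Re [OF cball_ball [OF assms(1)] cball_ball [OF assms(2)] assms(3)]
    by (metis less_irrefl zero_complex.sel(1))
  then have e: "exp (L z w) = ?q" using assms(3) by (simp add: L_def)
  have c: "exp (2 * pi * \<i> * t) = cis (2 * pi * (t - \<alpha>)) * cis (2 * pi * \<alpha>)"
  proof -
    have "cis (2 * pi * (t - \<alpha>)) * cis (2 * pi * \<alpha>) = cis (2 * pi * t)"
      by (simp add: cis_mult algebra_simps)
    then show ?thesis by (simp add: cis_conv_exp mult_ac)
  qed
  have "(z - w) * exp (L z w + 2 * pi * \<i> * t) = cis (2 * pi * (t - \<alpha>)) * ((z - w) * (?q * cis (2 * pi * \<alpha>)))"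
    unfolding exp_add e c by (simp only: mult_ac)
  also have "(z - w) * (?q * cis (2 * pi * \<alpha>)) = f z - f w"
    using assms(3) by (simp add: field_simps)
  finally show ?thesis
    using assms by (simp add: F_eq algebra_simps)
qed

lemma exp_L0:
  assumes "z \<in> cball 0 r"
  shows "F t z = z * exp (L z 0 + 2 * pi * \<i> * t)"
  using exp_L [OF assms, of 0 t] r by (cases "z = 0") auto

lemma F_inj:
  assumes "z \<in> cball 0 r" "w \<in> cball 0 r" "F t z = F t w"
  shows "z = w"
  using exp_L [OF assms(1,2), of t] assms(3) by (cases "z = w") auto

lemma L_sym: "L z w = L w z"
proof -
  have "(f z - f w) / (cis (2 * pi * \<alpha>) * (z - w)) = (f w - f z) / (cis (2 * pi * \<alpha>) * (w - z))"
    by (metis minus_diff_eq minus_divide_divide mult_minus_right)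
  then show ?thesis by (simp add: L_def)
qed

lemma L0_hol: "(\<lambda>z. L z 0) holomorphic_on ball 0 R"
proof -
  define g where "g = (\<lambda>z. if z = 0 then deriv f 0 else (f z - f 0) / (z - 0))"
  have g: "g holomorphic_on ball 0 R"
    unfolding g_def by (rule pole_lemma_open [OF holf open_ball])
  have gq: "g z / cis (2 * pi * \<alpha>) = (f z - f 0) / (cis (2 * pi * \<alpha>) * (z - 0))" if "z \<noteq> 0" for z
    using that by (simp add: g_def)
  have Re: "Re (g z / cis (2 * pi * \<alpha>)) > 0" if "z \<in> ball 0 R" for z
  proof (cases "z = 0")
    case True
    have "g 0 / cis (2 * pi * \<alpha>) = 1" by (simp add: g_def deriv0)
    then show ?thesis using True by simp
  next
    case False
    then show ?thesis using quotient_Re [OF that _ False] gq r by simp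
  qed
  have "(\<lambda>z. Ln (g z / cis (2 * pi * \<alpha>))) holomorphic_on ball 0 R"
  proof (intro holomorphic_intros g)
    show "g z / cis (2 * pi * \<alpha>) \<notin> \<real>\<^sub>\<le>\<^sub>0" if "z \<in> ball 0 R" for z
      using Re [OF that] by (auto simp: complex_nonpos_Reals_iff)
  qed auto
  moreover have "Ln (g z / cis (2 * pi * \<alpha>)) = L z 0" for z
    using gq [of z] by (cases "z = 0") (simp_all add: L_def, simp add: g_def deriv0)
  ultimately show ?thesis by simp
qed

lemma L_cont: "continuous_on {x \<in> cball 0 r \<times> cball 0 r. fst x \<noteq> snd x} (\<lambda>x. L (fst x) (snd x))"
proof -
  let ?S = "{x \<in> cball 0 r \<times> cball 0 r. fst x \<noteq> snd x} :: (complex \<times> complex) set"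
  have fs: "continuous_on ?S (\<lambda>x. f (fst x))" "continuous_on ?S (\<lambda>x. f (snd x))"
    by (rule continuous_on_compose2 [OF f_cont continuous_on_fst [OF continuous_on_id]]
        continuous_on_compose2 [OF f_cont continuous_on_snd [OF continuous_on_id]]; use r in auto)+
  have "continuous_on ?S (\<lambda>x. Ln ((f (fst x) - f (snd x)) / (cis (2 * pi * \<alpha>) * (fst x - snd x))))"
  proof (intro continuous_intros fs)
    fix x assume "x \<in> ?S"
    then have "fst x \<in> ball 0 R" "snd x \<in> ball 0 R" "fst x \<noteq> snd x" using r by auto
    then show "(f (fst x) - f (snd x)) / (cis (2 * pi * \<alpha>) * (fst x - snd x)) \<notin> \<real>\<^sub>\<le>\<^sub>0"
      using quotient_Re [of "fst x" "snd x"] unfolding complex_nonpos_Reals_iff by linarith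
  qed auto
  then show ?thesis
    by (rule continuous_on_eq) (simp add: L_def)
qed

lemma orbit_exp_sum:
  assumes "\<And>j. j < q \<Longrightarrow> (F t ^^ j) z \<in> cball 0 r"
  shows "(F t ^^ q) z = z * exp ((\<Sum>j<q. L ((F t ^^ j) z) 0) + 2 * pi * \<i> * (real q * t))"
  using assms
proof (induction q)
  case (Suc q)
  have "(F t ^^ Suc q) z = (F t ^^ q) z * exp (L ((F t ^^ q) z) 0 + 2 * pi * \<i> * t)"
    using exp_L0 [of "(F t ^^ q) z" t] Suc.prems [of q] by simp
  then show ?case using Suc by (simp add: exp_add [symmetric] algebra_simps)
qed simp

lemma orbit_exp_sum_diff:
  assumes "\<And>j. j < m \<Longrightarrow> (F t ^^ j) z \<in> cball 0 r" "\<And>j. j < m \<Longrightarrow> (F t ^^ j) w \<in> cball 0 r" "z \<noteq> w"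
  shows "(F t ^^ m) z \<noteq> (F t ^^ m) w \<and> (F t ^^ m) z - (F t ^^ m) w =
     (z - w) * exp ((\<Sum>j<m. L ((F t ^^ j) z) ((F t ^^ j) w)) + 2 * pi * \<i> * (real m * t))"
  using assms(1,2)
proof (induction m)
  case (Suc m)
  then have IH: "(F t ^^ m) z \<noteq> (F t ^^ m) w" "(F t ^^ m) z - (F t ^^ m) w =
     (z - w) * exp ((\<Sum>j<m. L ((F t ^^ j) z) ((F t ^^ j) w)) + 2 * pi * \<i> * (real m * t))" by auto
  have "(F t ^^ Suc m) z - (F t ^^ Suc m) w
      = ((F t ^^ m) z - (F t ^^ m) w) * exp (L ((F t ^^ m) z) ((F t ^^ m) w) + 2 * pi * \<i> * t)"
    using exp_L [OF _ _ IH(1), of t] Suc.prems by simp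
  also have "\<dots> = (z - w) * exp ((\<Sum>j<Suc m. L ((F t ^^ j) z) ((F t ^^ j) w)) + 2 * pi * \<i> * (real (Suc m) * t))"
    unfolding IH(2) by (simp add: exp_add [symmetric] algebra_simps)
  finally have eq: "(F t ^^ Suc m) z - (F t ^^ Suc m) w
     = (z - w) * exp ((\<Sum>j<Suc m. L ((F t ^^ j) z) ((F t ^^ j) w)) + 2 * pi * \<i> * (real (Suc m) * t))" .
  with assms(3) have "(F t ^^ Suc m) z - (F t ^^ Suc m) w \<noteq> 0" by (simp only: mult_eq_0_iff exp_not_eq_zero) simp
  then show ?case using eq by auto
qed (use assms(3) in simp)

section \<open>Cycles of prescribed rotation number and their persistence\<close>

text \<open>The pairs \<open>(t, z)\<close> such that \<open>z\<close> lies on a cycle of \<open>F t\<close> of rotation number \<open>p/q\<close> about 0: the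
  logarithm of \<open>F t z / z\<close>, summed along \<open>q\<close> steps, is \<open>2\<pi>i p\<close>.\<close>
definition cyc :: "int \<Rightarrow> nat \<Rightarrow> real \<Rightarrow> real \<Rightarrow> (real \<times> complex) set" where
  "cyc p q a b = {x. fst x \<in> {a..b} \<and> (\<forall>j<q. (F (fst x) ^^ j) (snd x) \<in> cball 0 r) \<and>
     (\<Sum>j<q. L (P ((F (fst x) ^^ j) (snd x))) 0) = 2 * pi * \<i> * (of_int p - real q * fst x)}"

text \<open>The retraction \<open>P\<close> makes each summand continuous for all (t, z), so that
  \<open>cyc\<close> is closed as the solution set of a globally continuous equation.\<close>

lemma L0P_cont: "continuous_on UNIV (\<lambda>x. L (P ((F (fst x) ^^ j) (snd x))) 0)"
proof (rule continuous_on_compose2 [OF holomorphic_on_imp_continuous_on [OF L0_hol]])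
  show "continuous_on UNIV (\<lambda>x. P ((F (fst x) ^^ j) (snd x)))"
    by (rule continuous_on_compose2 [OF P_cont Fn_cont]) auto
qed (use P_ball in auto)

lemma cyc_sum_cont:
  "continuous_on UNIV (\<lambda>x. (\<Sum>j<q. L (P ((F (fst x) ^^ j) (snd x))) 0) - 2 * pi * \<i> * (of_int p - real q * fst x))"
  by (intro continuous_on_diff continuous_on_sum L0P_cont) (intro continuous_intros)

lemma cyc_closed: "closed (cyc p q a b)"
proof -
  have "cyc p q a b = (fst -` {a..b}) \<inter> (\<Inter>j<q. (\<lambda>x. (F (fst x) ^^ j) (snd x)) -` cball 0 r) \<inter>
      (\<lambda>x. (\<Sum>j<q. L (P ((F (fst x) ^^ j) (snd x))) 0) - 2 * pi * \<i> * (of_int p - real q * fst x)) -` {0}"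
    unfolding cyc_def by auto
  also have "closed \<dots>"
    by (intro closed_Int closed_INT ballI closed_vimage Fn_cont cyc_sum_cont
        continuous_on_fst continuous_on_id closed_cball closed_real_atLeastAtMost closed_singleton)
  finally show ?thesis .
qed

text \<open>Exponentiating the equation in \<open>cyc\<close> shows that q steps multiply z by exp
  (2 pi i p) = 1.\<close>

lemma cyc_periodic:
  assumes "(t, z) \<in> cyc p q a b"
  shows "(F t ^^ q) z = z"
proof -
  have orb: "\<And>j. j < q \<Longrightarrow> (F t ^^ j) z \<in> cball 0 r" using assms by (simp add: cyc_def)
  have "(\<Sum>j<q. L ((F t ^^ j) z) 0) = (\<Sum>j<q. L (P ((F t ^^ j) z)) 0)"
    by (rule sum.cong) (use orb P_id in auto)
  also have "\<dots> = 2 * pi * \<i> * (of_int p - real q * t)" using assms by (simp add: cyc_def)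
  finally have "(\<Sum>j<q. L ((F t ^^ j) z) 0) + 2 * pi * \<i> * (real q * t) = 2 * of_int p * of_real pi * \<i>"
    by (simp add: algebra_simps)
  then have "exp ((\<Sum>j<q. L ((F t ^^ j) z) 0) + 2 * pi * \<i> * (real q * t)) = 1"
    using exp_integer_2pi [of "of_int p"] by (simp only: Ints_of_int) (simp add: mult_ac)
  then show ?thesis using orbit_exp_sum [of q t z] orb by simp
qed

lemma funpow_periodic:
  assumes "(g ^^ q) z = z" shows "(g ^^ (k * q + j)) z = (g ^^ j) z"
proof -
  have "(g ^^ (k * q)) z = z"
    by (induction k) (use assms in \<open>simp_all add: funpow_add\<close>)
  then show ?thesis by (metis add.commute comp_apply funpow_add)
qed

lemma cyc_orbit:
  assumes "(t, z) \<in> cyc p q a b" "q > 0"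
  shows "(F t ^^ j) z \<in> cball 0 r"
proof -
  have "(F t ^^ j) z = (F t ^^ (j mod q)) z"
    using funpow_periodic [OF cyc_periodic [OF assms(1)], of "j div q" "j mod q"] by simp
  then show ?thesis using assms by (simp add: cyc_def)
qed

lemma sum_split:
  fixes h :: "nat \<Rightarrow> complex"
  shows "(\<Sum>j<a + b. h j) = (\<Sum>j<a. h j) + (\<Sum>j<b. h (a + j))"
  by (induction b) (simp_all add: add.assoc)

lemma sum_periodic_blocks:
  fixes h :: "nat \<Rightarrow> complex"
  assumes "\<And>k j. h (k * q + j) = h j"
  shows "(\<Sum>j<m * q. h j) = of_nat m * (\<Sum>j<q. h j)"
proof (induction m)
  case (Suc m)
  have "(\<Sum>j<Suc m * q. h j) = (\<Sum>j<m * q. h j) + (\<Sum>j<q. h (m * q + j))"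
    using sum_split [of h "m * q" q] by (simp add: add.commute)
  then show ?case using Suc assms by (simp add: algebra_simps)
qed simp

lemma cyc_sum:
  assumes "(t, z) \<in> cyc p q a b" "q > 0"
  shows "(\<Sum>j<m * q. L ((F t ^^ j) z) 0) = of_nat m * (2 * pi * \<i> * (of_int p - real q * t))"
proof -
  have "(\<Sum>j<q. L ((F t ^^ j) z) 0) = (\<Sum>j<q. L (P ((F t ^^ j) z)) 0)"
    by (rule sum.cong) (use cyc_orbit [OF assms] P_id in auto)
  also have "\<dots> = 2 * pi * \<i> * (of_int p - real q * t)" using assms by (simp add: cyc_def)
  finally show ?thesis
    using sum_periodic_blocks [of "\<lambda>j. L ((F t ^^ j) z) 0" q m] funpow_periodic [OF cyc_periodic [OF assms(1)]]
    by simp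
qed

text \<open>All logarithms along the orbit of 0 vanish, so the fixed point satisfies the equation
  exactly at t = p/q, the parameter at which the cycle is born.\<close>

lemma cyc_zero: "t \<in> {a..b} \<Longrightarrow> real q * t = of_int p \<Longrightarrow> (t, 0) \<in> cyc p q a b"
proof -
  assume t: "t \<in> {a..b}" "real q * t = of_int p"
  have "of_nat q * complex_of_real t = of_int p"
    using arg_cong [OF t(2), of complex_of_real] by simp
  then show ?thesis using t r P_id [of 0] by (simp add: cyc_def L_def)
qed

text \<open>Relative clopenness is written as closedness of both pieces. Together with orbits
  staying off the boundary circle it prevents cycles from entering or leaving \<open>S\<close> as t
  varies.\<close>

definition isolated_part :: "(real \<times> complex) set \<Rightarrow> (real \<times> complex) set \<Rightarrow> bool" where
  "isolated_part Z S \<longleftrightarrow> S \<subseteq> Z \<and> closed S \<and> closed (Z - S) \<and>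
     (\<forall>t z j. (t, z) \<in> S \<longrightarrow> (F t ^^ j) z \<in> ball 0 r)"

lemma Fn_hol: "(F t ^^ j) holomorphic_on {z. \<forall>i<j. (F t ^^ i) z \<in> ball 0 r}"
proof (induction j)
  case (Suc j)
  let ?W = "{z. \<forall>i<Suc j. (F t ^^ i) z \<in> ball 0 r}"
  have "(F t ^^ j) holomorphic_on ?W"
    by (rule holomorphic_on_subset [OF Suc]) auto
  moreover have "(\<lambda>z. cis (2 * pi * (t - \<alpha>)) * f z) holomorphic_on ball 0 r"
    using r by (intro holomorphic_intros holomorphic_on_subset [OF holf]) auto
  ultimately have "((\<lambda>z. cis (2 * pi * (t - \<alpha>)) * f z) \<circ> (F t ^^ j)) holomorphic_on ?W"
    by (rule holomorphic_on_compose_gen) auto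
  then show ?case
    by (rule holomorphic_transform) (auto simp: F_eq less_imp_le)
qed (simp add: id_def)

lemma orbit_region_open: "open {z. \<forall>i<q. (F t ^^ i) z \<in> ball 0 r}"
proof -
  have "{z. \<forall>i<q. (F t ^^ i) z \<in> ball 0 r} = (\<Inter>i\<in>{..<q}. (F t ^^ i) -` ball 0 r)" by auto
  also have "open \<dots>"
    by (intro open_INT ballI open_vimage Fn_cont_snd) auto
  finally show ?thesis .
qed

lemma cyc_sum_hol:
  "(\<lambda>z. (\<Sum>j<q. L (P ((F t ^^ j) z)) 0) - 2 * pi * \<i> * (of_int p - real q * t))
    holomorphic_on {z. \<forall>i<q. (F t ^^ i) z \<in> ball 0 r}"
proof -
  let ?W = "{z. \<forall>i<q. (F t ^^ i) z \<in> ball 0 r}"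
  have "(\<lambda>z. L (P ((F t ^^ j) z)) 0) holomorphic_on ?W" if "j < q" for j
  proof -
    have "(F t ^^ j) holomorphic_on ?W"
      by (rule holomorphic_on_subset [OF Fn_hol]) (use that in auto)
    moreover have "(\<lambda>z. L z 0) holomorphic_on ball 0 r"
      by (rule holomorphic_on_subset [OF L0_hol]) (use r in auto)
    ultimately have "((\<lambda>z. L z 0) \<circ> (F t ^^ j)) holomorphic_on ?W"
      by (rule holomorphic_on_compose_gen) (use that in auto)
    then show ?thesis
      by (rule holomorphic_transform) (use that in \<open>auto simp: P_id less_imp_le\<close>)
  qed
  then show ?thesis by (intro holomorphic_intros) auto
qed

text \<open>If the slice \<open>A\<close> at parameter t accumulated at a point, the identity
  theorem and isolation would put a disc about that point into \<open>A\<close>. All limit points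
  being interior, the interior of \<open>A\<close> would be open, closed and nonempty, hence the
  whole plane, although \<open>A\<close> lies in the disc of radius \<open>r\<close>. In particular
  the iterate of order q cannot be the identity near a point of the slice.\<close>

lemma isolated_part_nonlimit:
  assumes "isolated_part (cyc p q a b) S" "q > 0" "(t, z0) \<in> S"
  shows "\<not> z0 islimpt {z. (t, z) \<in> S}"
proof
  define A where "A = {z. (t, z) \<in> S}"
  assume lim: "z0 islimpt {z. (t, z) \<in> S}"
  have S: "S \<subseteq> cyc p q a b" "closed S" "closed (cyc p q a b - S)"
    and Sint: "\<And>t z j. (t, z) \<in> S \<Longrightarrow> (F t ^^ j) z \<in> ball 0 r"
    using assms(1) unfolding isolated_part_def by blast+
  have "A = (\<lambda>z. (t, z)) -` S" by (auto simp: A_def)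
  then have clA: "closed A"
    using closed_vimage [OF S(2), of "\<lambda>z. (t, z)"] by (simp add: continuous_on_Pair)
  have bA: "bounded A"
    using Sint [of t _ 0] by (intro bounded_subset [OF bounded_ball [of 0 r]]) (auto simp: A_def)
  let ?W = "{z. \<forall>i<q. (F t ^^ i) z \<in> ball 0 r}"
  let ?G = "\<lambda>z. (\<Sum>j<q. L (P ((F t ^^ j) z)) 0) - 2 * pi * \<i> * (of_int p - real q * t)"
  have isol: "\<exists>e>0. ball z e \<subseteq> A" if z: "z \<in> A" "z islimpt A" for z
  proof -
    have tz: "(t, z) \<in> S" using z by (simp add: A_def)
    then have tab: "t \<in> {a..b}" using S(1) by (auto simp: cyc_def)
    have "open (- (cyc p q a b - S))" "(t, z) \<in> - (cyc p q a b - S)"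
      using S(3) tz by (simp_all only: closed_def) simp
    then obtain e1 where e1: "e1 > 0" "ball (t, z) e1 \<subseteq> - (cyc p q a b - S)"
      by (meson open_contains_ball)
    have "z \<in> ?W" using Sint [OF tz] by auto
    then obtain e2 where e2: "e2 > 0" "ball z e2 \<subseteq> ?W"
      using orbit_region_open [of q t] by (meson open_contains_ball)
    define e where "e = min e1 e2"
    have e: "e > 0" "ball z e \<subseteq> ?W" using e1 e2 by (auto simp: e_def)
    have "?G w = 0" if "w \<in> ball z e" for w
    proof (rule analytic_continuation [of ?G "ball z e" "A \<inter> ball z e" z])
      show "?G holomorphic_on ball z e"
        by (rule holomorphic_on_subset [OF cyc_sum_hol e(2)])
      show "z islimpt A \<inter> ball z e"
        using islimpt_Int_eventually [OF z(2)] eventually_at_ball e(1) by (metis eventually_at_in_open' open_ball centre_in_ball)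
      show "?G v = 0" if "v \<in> A \<inter> ball z e" for v
        using that S(1) by (auto simp: A_def cyc_def)
    qed (use e that in auto)
    moreover have "w \<in> A" if "w \<in> ball z e" "?G w = 0" for w
    proof -
      have "w \<in> ?W" using that e by blast
      then have "(t, w) \<in> cyc p q a b"
        using that(2) tab by (auto simp: cyc_def less_imp_le)
      moreover have "(t, w) \<in> ball (t, z) e1"
        using that(1) by (simp add: e_def dist_Pair_Pair)
      ultimately show ?thesis using e1(2) by (auto simp: A_def)
    qed
    ultimately show ?thesis using e(1) by blast
  qed
  have "open (interior A)" by simp
  moreover have "closed (interior A)"
    unfolding closed_limpt
  proof (intro allI impI)
    fix z assume "z islimpt interior A"
    then have "z islimpt A" using islimpt_subset interior_subset by blast
    moreover from this have "z \<in> A" using clA by (simp add: closed_limpt)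
    ultimately show "z \<in> interior A" using isol mem_interior by blast
  qed
  ultimately have "interior A = {} \<or> interior A = UNIV" using clopen by blast
  moreover have "interior A \<noteq> UNIV"
    using bA interior_subset [of A] not_bounded_UNIV bounded_subset by metis
  moreover have "z0 \<in> A" using assms(3) by (simp add: A_def)
  then have "z0 \<in> interior A" using isol lim mem_interior unfolding A_def [symmetric] by blast
  ultimately show False by blast
qed

text \<open>Cycles inside the disc persist: an isolated zero of a holomorphic function survives
  small perturbations.\<close>
lemma isolated_part_lift:
  assumes "isolated_part (cyc p q a b) S" "q > 0" "(t0, z0) \<in> S" "\<epsilon> > 0"
  obtains \<delta> where "\<delta> > 0" "\<And>t. t \<in> {a..b} \<Longrightarrow> \<bar>t - t0\<bar> < \<delta> \<Longrightarrow> \<exists>z. norm (z - z0) < \<epsilon> \<and> (t, z) \<in> S"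
proof -
  have S: "S \<subseteq> cyc p q a b" "closed S" "closed (cyc p q a b - S)"
    and Sint: "\<And>t z j. (t, z) \<in> S \<Longrightarrow> (F t ^^ j) z \<in> ball 0 r"
    using assms(1) unfolding isolated_part_def by blast+
  define G where "G = (\<lambda>x. (\<Sum>j<q. L (P ((F (fst x) ^^ j) (snd x))) 0) - 2 * pi * \<i> * (of_int p - real q * fst x))"
  have Gcont: "continuous_on UNIV G" unfolding G_def by (rule cyc_sum_cont)
  \<comment> \<open>Within \<open>V\<close>, every zero of \<open>G\<close> with parameter in {a..b}
    already belongs to \<open>S\<close>.\<close>
  define V where "V = - (cyc p q a b - S) \<inter> (\<Inter>j<q. (\<lambda>x. (F (fst x) ^^ j) (snd x)) -` ball 0 r)"
  have "open V"
    unfolding V_def using S(3) by (intro open_Int open_INT ballI open_vimage Fn_cont open_ball) (auto simp only: closed_def)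
  moreover have "(t0, z0) \<in> V" using assms(3) Sint by (auto simp: V_def)
  ultimately obtain e0 where e0: "e0 > 0" "cball (t0, z0) e0 \<subseteq> V"
    by (meson open_contains_cball)
  have VS: "x \<in> S" if "x \<in> V" "fst x \<in> {a..b}" "G x = 0" for x
  proof -
    have "x \<in> cyc p q a b"
      using that unfolding cyc_def G_def V_def by (auto simp: less_imp_le)
    then show ?thesis using that(1) by (auto simp: V_def)
  qed
  have t0: "t0 \<in> {a..b}" and G0: "G (t0, z0) = 0"
    using assms(3) S(1) by (auto simp: cyc_def G_def)
  obtain e1 where e1: "e1 > 0" "\<And>z. (t0, z) \<in> S \<Longrightarrow> z \<noteq> z0 \<Longrightarrow> dist z z0 \<ge> e1"
    using isolated_part_nonlimit [OF assms(1-3)] unfolding islimpt_approachable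
    by (metis mem_Collect_eq not_le)
  \<comment> \<open>\<open>e0/2\<close> keeps the box of radius \<open>e\<close> inside the ball
    where \<open>VS\<close> applies, \<open>e1/2\<close> excludes other zeros on the circle, and
    \<open>\<epsilon>/2\<close> gives the required closeness.\<close>
  define e where "e = Min {e0/2, e1/2, \<epsilon>/2}"
  have e: "e > 0" "e < e0" "e < e1" "e < \<epsilon>" "e \<le> e0/2" using e0 e1 assms(4) by (auto simp: e_def)
  have inV: "(t, z) \<in> V" if "\<bar>t - t0\<bar> \<le> e" "z \<in> cball z0 e" for t z
  proof -
    have "dist (t0, z0) (t, z) \<le> dist t0 t + dist z0 z"
      by (metis add.commute dist_Pair_Pair real_sqrt_sum_squares_triangle_ineq sqrt_sum_squares_le_sum zero_le_dist)
    also have "\<dots> \<le> e0" using that e(5) by (simp add: dist_norm abs_minus_commute)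
    finally show ?thesis using e0(2) by auto
  qed
  have ne: "G (t0, z) \<noteq> 0" if "dist z0 z = e" for z
  proof
    assume "G (t0, z) = 0"
    then have "(t0, z) \<in> S" using VS [of "(t0, z)"] inV [of t0 z] that t0 e by auto
    then show False using e1(2) [of z] that e by (auto simp: dist_commute)
  qed
  have "compact (sphere z0 e)" "sphere z0 e \<noteq> {}" using e by auto
  moreover have "continuous_on (sphere z0 e) (\<lambda>z. norm (G (t0, z)))"
    by (intro continuous_on_norm continuous_on_compose2 [OF Gcont] continuous_intros) auto
  ultimately obtain z1 where z1: "z1 \<in> sphere z0 e" "\<And>z. z \<in> sphere z0 e \<Longrightarrow> norm (G (t0, z1)) \<le> norm (G (t0, z))"
    using continuous_attains_inf by metis
  define m where "m = norm (G (t0, z1))"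
  have m: "m > 0" "\<And>z. dist z0 z = e \<Longrightarrow> m \<le> norm (G (t0, z))"
    using z1 ne by (auto simp: m_def)
  \<comment> \<open>For nearby t the modulus of \<open>G\<close> stays above m/2 on the circle and
    drops below m/2 at the centre, which forces a zero inside.\<close>
  have "uniformly_continuous_on ({t0 - e..t0 + e} \<times> cball z0 e) G"
    by (intro compact_uniformly_continuous continuous_on_subset [OF Gcont] compact_Times) auto
  then obtain d where d: "d > 0" "\<And>x y. x \<in> {t0 - e..t0 + e} \<times> cball z0 e \<Longrightarrow> y \<in> {t0 - e..t0 + e} \<times> cball z0 e
      \<Longrightarrow> dist y x < d \<Longrightarrow> dist (G y) (G x) < m / 2"
    using m(1) unfolding uniformly_continuous_on_def by (metis half_gt_zero)
  define \<delta> where "\<delta> = min d e"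
  show thesis
  proof (rule that)
    show "\<delta> > 0" using d e by (simp add: \<delta>_def)
    fix t assume t: "t \<in> {a..b}" "\<bar>t - t0\<bar> < \<delta>"
    have te: "\<bar>t - t0\<bar> \<le> e" "\<bar>t - t0\<bar> < d" using t by (auto simp: \<delta>_def)
    have close: "norm (G (t, z) - G (t0, z)) < m / 2" if "z \<in> cball z0 e" for z
    proof -
      have "(t0, z) \<in> {t0 - e..t0 + e} \<times> cball z0 e" "(t, z) \<in> {t0 - e..t0 + e} \<times> cball z0 e"
        using that te(1) e(1) unfolding abs_le_iff by auto
      from d(2) [OF this] show ?thesis using te(2) by (simp add: dist_norm dist_Pair_Pair)
    qed
    obtain z where z: "z \<in> ball z0 e" "G (t, z) = 0"
    proof (rule holomorphic_contract_to_zero [of z0 e "\<lambda>z. G (t, z)"])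
      show "continuous_on (cball z0 e) (\<lambda>z. G (t, z))"
        by (intro continuous_on_compose2 [OF Gcont] continuous_intros) auto
      have "(\<lambda>z. G (t, z)) holomorphic_on {z. \<forall>i<q. (F t ^^ i) z \<in> ball 0 r}"
        using cyc_sum_hol [of t q p] by (simp add: G_def)
      then show "(\<lambda>z. G (t, z)) holomorphic_on ball z0 e"
        by (rule holomorphic_on_subset) (use inV [OF te(1)] in \<open>auto simp: V_def\<close>)
      show "norm (G (t, z0)) < norm (G (t, z))" if "norm (z0 - z) = e" for z
      proof -
        have z: "dist z0 z = e" "z \<in> cball z0 e" using that by (auto simp: dist_norm)
        have "norm (G (t, z0)) < m / 2" using close [of z0] G0 e by simp
        moreover have "norm (G (t0, z)) - norm (G (t, z)) < m / 2"
          using close [OF z(2)] norm_triangle_ineq2 [of "G (t0, z)" "G (t, z)"] by (simp add: norm_minus_commute)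
        ultimately show ?thesis using m(2) [OF z(1)] by linarith
      qed
    qed (use e that in auto)
    have "(t, z) \<in> S"
      using VS [of "(t, z)"] inV [OF te(1), of z] z t by auto
    then show "\<exists>z. norm (z - z0) < \<epsilon> \<and> (t, z) \<in> S"
      using z e by (intro exI [of _ z]) (auto simp: dist_norm norm_minus_commute)
  qed
qed

lemma isolated_part_compact:
  assumes "isolated_part (cyc p q a b) S"
  shows "compact S"
proof -
  have "S \<subseteq> {a..b} \<times> ball 0 r"
  proof (rule subrelI)
    fix t z assume "(t, z) \<in> S"
    then have "(t, z) \<in> cyc p q a b" "(F t ^^ 0) z \<in> ball 0 r"
      using assms unfolding isolated_part_def by blast+
    then show "(t, z) \<in> {a..b} \<times> ball 0 r" by (auto simp: cyc_def)
  qed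
  moreover have "bounded ({a..b} \<times> ball (0::complex) r)"
    by (intro bounded_Times) auto
  ultimately show ?thesis
    using assms bounded_subset unfolding isolated_part_def compact_eq_bounded_closed by blast
qed

text \<open>Persistence makes the projection of \<open>S\<close> to the parameters open in {a..b},
  compactness makes it closed, and the interval is connected.\<close>

lemma isolated_part_onto:
  assumes "isolated_part (cyc p q a b) S" "q > 0" "(t0, z0) \<in> S" "t \<in> {a..b}"
  shows "\<exists>z. (t, z) \<in> S"
proof -
  have sub: "fst ` S \<subseteq> {a..b}"
    using assms(1) unfolding isolated_part_def cyc_def by auto
  have "closed (fst ` S)"
    by (intro compact_imp_closed compact_continuous_image isolated_part_compact [OF assms(1)] continuous_intros)
  then have c: "closedin (top_of_set {a..b}) (fst ` S)"
    using sub by (simp add: closed_subset)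
  have o: "openin (top_of_set {a..b}) (fst ` S)"
    unfolding openin_euclidean_subtopology_iff
  proof (intro conjI ballI sub)
    fix t assume "t \<in> fst ` S"
    then obtain z where "(t, z) \<in> S" by auto
    then obtain \<delta> where "\<delta> > 0" "\<And>t'. t' \<in> {a..b} \<Longrightarrow> \<bar>t' - t\<bar> < \<delta> \<Longrightarrow> \<exists>w. norm (w - z) < 1 \<and> (t', w) \<in> S"
      using isolated_part_lift [OF assms(1,2) _ zero_less_one] by metis
    then show "\<exists>e>0. \<forall>x'\<in>{a..b}. dist x' t < e \<longrightarrow> x' \<in> fst ` S"
      by (metis dist_real_def fst_conv image_eqI)
  qed
  have "connected {a..b}" by simp
  then have "fst ` S = {} \<or> fst ` S = {a..b}"
    using c o unfolding connected_clopen by blast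
  then have "t \<in> fst ` S" using assms(3,4) by auto
  then show ?thesis by auto
qed

section \<open>Linking numbers of pairs of cycles\<close>

definition linking :: "nat \<Rightarrow> real \<Rightarrow> complex \<Rightarrow> complex \<Rightarrow> complex" where
  "linking m t z w = (\<Sum>j<m. L ((F t ^^ j) z) ((F t ^^ j) w)) + 2 * pi * \<i> * (real m * t)"

text \<open>After a common period the chord from w to z returns to itself, so its accumulated
  logarithm is 2 pi i times a number of full turns. Integrality is what makes the linking number
  locally constant.\<close>

lemma linking_integral:
  assumes "\<And>j. (F t ^^ j) z \<in> cball 0 r" "\<And>j. (F t ^^ j) w \<in> cball 0 r" "z \<noteq> w"
    and "(F t ^^ m) z = z" "(F t ^^ m) w = w"
  obtains n :: int where "linking m t z w = 2 * pi * \<i> * of_int n"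
proof -
  have "z - w = (z - w) * exp (linking m t z w)"
    using orbit_exp_sum_diff [of m t z w] assms unfolding linking_def by simp
  then have "exp (linking m t z w) = 1" using assms(3) by simp
  then obtain n :: int where "Re (linking m t z w) = 0" "Im (linking m t z w) = of_int (2 * n) * pi"
    unfolding exp_eq_1 by blast
  then have "linking m t z w = 2 * pi * \<i> * of_int n"
    by (simp add: complex_eq_iff)
  then show thesis by (rule that)
qed

lemma linking_sym: "linking m t z w = linking m t w z"
  unfolding linking_def by (simp add: L_sym)

text \<open>Linking with the fixed point 0 counts the turns of the cycle about 0, which membership
  in \<open>cyc\<close> prescribes as p in every q steps.\<close>

lemma linking_0:
  assumes "(t, z) \<in> cyc p q a b" "q > 0"
  shows "linking (m * q) t z 0 = 2 * pi * \<i> * (of_nat m * of_int p)"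
  using cyc_sum [OF assms, of m] unfolding linking_def by (simp add: algebra_simps)

lemma linking_cont:
  assumes "closed C"
    and C: "\<And>t z w. (t, z, w) \<in> C \<Longrightarrow> (\<forall>j. (F t ^^ j) z \<in> cball 0 r) \<and> (\<forall>j. (F t ^^ j) w \<in> cball 0 r) \<and> z \<noteq> w"
  shows "continuous_on C (\<lambda>x. linking m (fst x) (fst (snd x)) (snd (snd x)))"
  unfolding linking_def
proof (intro continuous_on_add continuous_on_sum)
  fix j
  have c1: "continuous_on C (\<lambda>x. (F (fst x) ^^ j) (fst (snd x)))"
    by (rule continuous_on_compose2 [OF Fn_cont, of C "\<lambda>x. (fst x, fst (snd x))", simplified]) (intro continuous_intros)
  have c2: "continuous_on C (\<lambda>x. (F (fst x) ^^ j) (snd (snd x)))"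
    by (rule continuous_on_compose2 [OF Fn_cont, of C "\<lambda>x. (fst x, snd (snd x))", simplified]) (intro continuous_intros)
  have ne: "(F t ^^ j) z \<noteq> (F t ^^ j) w" if "(t, z, w) \<in> C" for t z w
    using orbit_exp_sum_diff [of j t z w] C [OF that] by blast
  show "continuous_on C (\<lambda>x. L ((F (fst x) ^^ j) (fst (snd x))) ((F (fst x) ^^ j) (snd (snd x))))"
    by (rule continuous_on_compose2 [OF L_cont, of C "\<lambda>x. ((F (fst x) ^^ j) (fst (snd x)), (F (fst x) ^^ j) (snd (snd x)))", simplified])
       (use C ne in \<open>auto intro!: continuous_on_Pair c1 c2\<close>)
next
  show "continuous_on C (\<lambda>x. 2 * pi * \<i> * complex_of_real (real m * fst x))"
    by (intro continuous_intros)
qed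

text \<open>Two cycles of rotation numbers \<open>p/q\<close> and \<open>p'/q'\<close> have a linking number which is constant
  under deformation. When the first one collapses to 0 it equals \<open>q p'\<close>, and when the second one
  does it equals \<open>q' p\<close>; so the two cycles cannot both survive between these two parameters.\<close>
theorem no_two_isolated_parts:
  assumes "a < b" "q > 0" "q' > 0" and a: "real q * a = of_int p" and b: "real q' * b = of_int p'"
    and S: "isolated_part (cyc p q a b) S" "(a, 0) \<in> S"
    and S': "isolated_part (cyc p' q' a b) S'" "(b, 0) \<in> S'"
  shows False
proof -
  \<comment> \<open>A common period of both kinds of cycles, so that all linking numbers count turns
    over the same time.\<close>
  define N where "N = q * q'"
  have Ssub: "S \<subseteq> cyc p q a b" "S' \<subseteq> cyc p' q' a b" and cl: "closed S" "closed S'" "closed (cyc p q a b - S)"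
    and Sint: "\<And>t z j. (t, z) \<in> S \<Longrightarrow> (F t ^^ j) z \<in> ball 0 r"
    using S(1) S'(1) unfolding isolated_part_def by blast+
  have orb: "(F t ^^ j) z \<in> cball 0 r" if "(t, z) \<in> S" for t z j
    using cyc_orbit that Ssub assms by blast
  have orb': "(F t ^^ j) z \<in> cball 0 r" if "(t, z) \<in> S'" for t z j
    using cyc_orbit that Ssub assms by blast
  have pq: "int q' * p < int q * p'"
  proof -
    have "real q * real q' * a < real q * real q' * b"
      using assms(1-3) by (intro mult_strict_left_mono) auto
    moreover have "real q * real q' * a = real q' * of_int p"
      by (simp add: a [symmetric])
    moreover have "real q * real q' * b = real q * of_int p'"
      by (simp add: b [symmetric])
    ultimately have "real q' * of_int p < real q * of_int p'" by linarith
    then have "real_of_int (int q' * p) < real_of_int (int q * p')" by simp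
    then show ?thesis by (simp only: of_int_less_iff)
  qed
  \<comment> \<open>A common point would turn about 0 with both rotation numbers p/q and p'/q';
    linking with 0 tells them apart.\<close>
  have ne: "z \<noteq> w" if "(t, z) \<in> S" "(t, w) \<in> S'" for t z w
  proof
    assume "z = w"
    have "linking (q' * q) t z 0 = 2 * pi * \<i> * (of_nat q' * of_int p)"
      using linking_0 that(1) Ssub assms by blast
    moreover have "linking (q * q') t w 0 = 2 * pi * \<i> * (of_nat q * of_int p')"
      using linking_0 that(2) Ssub assms by blast
    ultimately have "complex_of_int (int q' * p) = complex_of_int (int q * p')"
      using \<open>z = w\<close> by (simp add: mult.commute)
    then show False using pq by (simp only: of_int_eq_iff)
  qed
  have per: "(F t ^^ N) z = z" if "(t, z) \<in> S" for t z
    using funpow_periodic [OF cyc_periodic, of t z p q a b q' 0] that Ssub by (auto simp: N_def mult.commute)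
  have per': "(F t ^^ N) z = z" if "(t, z) \<in> S'" for t z
    using funpow_periodic [OF cyc_periodic, of t z p' q' a b q 0] that Ssub by (auto simp: N_def)
  define C where "C = {x. (fst x, fst (snd x)) \<in> S \<and> (fst x, snd (snd x)) \<in> S'}"
  have "C = (\<lambda>x. (fst x, fst (snd x))) -` S \<inter> (\<lambda>x. (fst x, snd (snd x))) -` S'"
    by (auto simp: C_def)
  then have clC: "closed C"
    by (simp add: closed_Int closed_vimage cl continuous_intros)
  have cont: "continuous_on C (\<lambda>x. linking N (fst x) (fst (snd x)) (snd (snd x)))"
    by (rule linking_cont [OF clC]) (use ne orb orb' in \<open>unfold C_def, simp only: mem_Collect_eq fst_conv snd_conv, blast\<close>)
  \<comment> \<open>The linking value of a point of \<open>S\<close> with 0 at t = b, where 0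
    belongs to \<open>S'\<close>.\<close>
  define v where "v = 2 * pi * \<i> * complex_of_int (int q' * p)"
  \<comment> \<open>\<open>E\<close> consists of the points of \<open>S\<close> having some partner
    in \<open>S'\<close> with linking value \<open>v\<close>. It contains the whole slice of
    \<open>S\<close> at t = b but not \<open>(a, 0)\<close>. Once \<open>E\<close> is shown clopen
    in \<open>S\<close>, the part \<open>S - E\<close> must persist from a to b, which is
    impossible.\<close>
  define E where "E = {x \<in> S. \<exists>w. (fst x, w) \<in> S' \<and> linking N (fst x) (snd x) w = v}"
  have lim_link: "linking N t z w = v"
    if lim: "(\<lambda>n. (t' n, z' n, w' n)) \<longlonglongrightarrow> (t, z, w)" and mem: "\<And>n. (t' n, z' n, w' n) \<in> C"
      and val: "\<And>n. linking N (t' n) (z' n) (w' n) = v" for t' z' w' t z w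
  proof -
    have "(t, z, w) \<in> C" using closed_sequentially [OF clC _ lim] mem by blast
    then have "(\<lambda>n. linking N (t' n) (z' n) (w' n)) \<longlonglongrightarrow> linking N t z w"
      using continuous_on_tendsto_compose [OF cont lim] mem by simp
    then show ?thesis by (simp only: val LIMSEQ_const_iff)
  qed
  \<comment> \<open>Partners of a convergent sequence subconverge by compactness of
    \<open>S'\<close>, and linking is continuous on pairs.\<close>
  have clE: "closed E"
    unfolding closed_sequential_limits
  proof (intro allI impI)
    fix x l assume xl: "(\<forall>n. x n \<in> E) \<and> x \<longlonglongrightarrow> l"
    then obtain w where w: "\<And>n. (fst (x n), w n) \<in> S'" "\<And>n. linking N (fst (x n)) (snd (x n)) (w n) = v" "\<And>n. x n \<in> S"
      unfolding E_def by (simp only: mem_Collect_eq) metis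
    have "l \<in> S" using closed_sequentially [OF cl(1), of x l] xl w(3) by blast
    have "compact S'" by (rule isolated_part_compact [OF S'(1)])
    then obtain y r where y: "y \<in> S'" "strict_mono r" "((\<lambda>n. (fst (x n), w n)) \<circ> r) \<longlonglongrightarrow> y"
      using w(1) unfolding compact_def by meson
    have xr: "(x \<circ> r) \<longlonglongrightarrow> l" using xl y(2) LIMSEQ_subseq_LIMSEQ by blast
    have f1: "(\<lambda>n. fst (x (r n))) \<longlonglongrightarrow> fst l" and s1: "(\<lambda>n. snd (x (r n))) \<longlonglongrightarrow> snd l"
      using tendsto_fst [OF xr] tendsto_snd [OF xr] by (simp_all add: o_def)
    have f2: "(\<lambda>n. fst (x (r n))) \<longlonglongrightarrow> fst y" and s2: "(\<lambda>n. w (r n)) \<longlonglongrightarrow> snd y"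
      using tendsto_fst [OF y(3)] tendsto_snd [OF y(3)] by (simp_all add: o_def)
    have fy: "fst y = fst l" using LIMSEQ_unique [OF f2 f1] .
    have "linking N (fst l) (snd l) (snd y) = v"
      by (rule lim_link [of "\<lambda>n. fst (x (r n))" "\<lambda>n. snd (x (r n))" "\<lambda>n. w (r n)"])
         (use w f1 s1 s2 in \<open>auto simp: C_def intro!: tendsto_Pair\<close>)
    moreover have "(fst l, snd y) \<in> S'" using y(1) fy by (metis prod.collapse)
    ultimately show "l \<in> E" using \<open>l \<in> S\<close> by (auto simp: E_def)
  qed
  \<comment> \<open>A partner \<open>w\<close> of the limit persists to partners of nearby points of
    \<open>S\<close>, by \<open>isolated_part_lift\<close>. Their linking values are close to
    \<open>v\<close> and integral multiples of 2 pi i, hence equal to \<open>v\<close>.\<close>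
  have clSE: "closed (S - E)"
    unfolding closed_sequential_limits
  proof (intro allI impI)
    fix x l assume xl: "(\<forall>n. x n \<in> S - E) \<and> x \<longlonglongrightarrow> l"
    then have lS: "l \<in> S" using closed_sequentially [OF cl(1), of x l] by blast
    show "l \<in> S - E"
    proof (rule ccontr)
      assume "l \<notin> S - E"
      then obtain w where w: "(fst l, w) \<in> S'" "linking N (fst l) (snd l) w = v"
        using lS by (auto simp: E_def)
      have "\<exists>m u. (fst (x m), u) \<in> S' \<and> norm (u - w) < 1 / real (Suc n) \<and> dist (x m) l < 1 / real (Suc n)" for n
      proof -
        obtain \<delta> where \<delta>: "\<delta> > 0" "\<And>t. t \<in> {a..b} \<Longrightarrow> \<bar>t - fst l\<bar> < \<delta> \<Longrightarrow> \<exists>z. norm (z - w) < 1 / real (Suc n) \<and> (t, z) \<in> S'"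
          by (rule isolated_part_lift [OF S'(1) \<open>q' > 0\<close> w(1), of "1 / real (Suc n)"]) auto
        have "\<forall>\<^sub>F m in sequentially. dist (x m) l < min \<delta> (1 / real (Suc n))"
          using xl \<delta>(1) by (intro tendstoD) auto
        then obtain m where m: "dist (x m) l < min \<delta> (1 / real (Suc n))"
          using eventually_happens' sequentially_bot by blast
        have "x m \<in> cyc p q a b" using xl Ssub by blast
        then have "fst (x m) \<in> {a..b}" by (simp add: cyc_def)
        moreover have "\<bar>fst (x m) - fst l\<bar> < \<delta>"
          using m dist_fst_le [of "x m" l] by (simp add: dist_real_def)
        ultimately obtain u where "norm (u - w) < 1 / real (Suc n)" "(fst (x m), u) \<in> S'" using \<delta>(2) by blast
        then show ?thesis using m by auto
      qed
      then obtain m u where mu: "\<And>n. (fst (x (m n)), u n) \<in> S'" "\<And>n. norm (u n - w) < 1 / real (Suc n)"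
        "\<And>n. dist (x (m n)) l < 1 / real (Suc n)" by metis
      have inv0: "(\<lambda>n. 1 / real (Suc n)) \<longlonglongrightarrow> 0"
        using LIMSEQ_inverse_real_of_nat by (simp add: inverse_eq_divide)
      have b3: "norm (dist (x (m n)) l) \<le> 1 / real (Suc n)" for n
        unfolding real_norm_def abs_of_nonneg [OF zero_le_dist] by (rule less_imp_le [OF mu(3)])
      have "(\<lambda>n. dist (x (m n)) l) \<longlonglongrightarrow> 0"
        by (rule Lim_null_comparison [OF _ inv0]) (intro always_eventually allI b3)
      then have xm: "(\<lambda>n. x (m n)) \<longlonglongrightarrow> l" by (rule tendsto_dist_iff [THEN iffD2])
      have "(\<lambda>n. u n - w) \<longlonglongrightarrow> 0"
        by (rule Lim_null_comparison [OF _ inv0]) (intro always_eventually allI less_imp_le mu(2))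
      then have um: "u \<longlonglongrightarrow> w" by (rule LIM_zero_cancel)
      have memC: "(fst (x (m n)), snd (x (m n)), u n) \<in> C" for n
        using mu(1) xl by (auto simp: C_def)
      have memL: "(fst l, snd l, w) \<in> C" using lS w by (simp add: C_def)
      have "(\<lambda>n. (fst (x (m n)), snd (x (m n)), u n)) \<longlonglongrightarrow> (fst l, snd l, w)"
        by (intro tendsto_Pair tendsto_fst tendsto_snd xm um)
      then have "(\<lambda>n. linking N (fst (x (m n))) (snd (x (m n))) (u n)) \<longlonglongrightarrow> v"
        using continuous_on_tendsto_compose [OF cont _ memL] memC w(2) by fastforce
      then have "\<forall>\<^sub>F n in sequentially. dist (linking N (fst (x (m n))) (snd (x (m n))) (u n)) v < 1"
        by (rule tendstoD) simp
      then obtain n where n: "dist (linking N (fst (x (m n))) (snd (x (m n))) (u n)) v < 1"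
        using eventually_happens' sequentially_bot by blast
      have xS: "(fst (x (m n)), snd (x (m n))) \<in> S" using xl by auto
      obtain k :: int where k: "linking N (fst (x (m n))) (snd (x (m n))) (u n) = 2 * pi * \<i> * of_int k"
        by (rule linking_integral [of "fst (x (m n))" "snd (x (m n))" "u n" N])
           (use orb [OF xS] orb' [OF mu(1)] ne [OF xS mu(1)] per [OF xS] per' [OF mu(1)] in auto)
      have "dist (2 * pi * \<i> * complex_of_int k) v = 2 * pi * \<bar>real_of_int (k - int q' * p)\<bar>"
      proof -
        have "2 * pi * \<i> * complex_of_int k - v = 2 * pi * \<i> * complex_of_int (k - int q' * p)"
          by (simp add: v_def algebra_simps)
        moreover have "norm (2 * pi * \<i> * complex_of_int n) = 2 * pi * \<bar>real_of_int n\<bar>" for n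
          by (simp add: norm_mult)
        ultimately show ?thesis by (simp only: dist_norm)
      qed
      then have lt: "2 * pi * \<bar>real_of_int (k - int q' * p)\<bar> < 1" using n k by simp
      have "k = int q' * p"
      proof (rule ccontr)
        assume "k \<noteq> int q' * p"
        then have "\<bar>real_of_int (k - int q' * p)\<bar> \<ge> 1" by linarith
        then have "2 * pi * 1 \<le> 2 * pi * \<bar>real_of_int (k - int q' * p)\<bar>" by (intro mult_left_mono) auto
        then show False using lt pi_gt3 by linarith
      qed
      then have "x (m n) \<in> E"
        using k xl mu(1) [of n] unfolding E_def v_def by auto
      then show False using xl by blast
    qed
  qed
  have "isolated_part (cyc p q a b) (S - E)"
    unfolding isolated_part_def
  proof (intro conjI allI impI)
    have "cyc p q a b - (S - E) = (cyc p q a b - S) \<union> E"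
      using Ssub by (auto simp: E_def)
    then show "closed (cyc p q a b - (S - E))" using cl clE by (simp add: closed_Un)
  qed (use Ssub Sint clSE in auto)
  \<comment> \<open>At t = a the point 0 links with every point of \<open>S'\<close> with value 2 pi
    i q p', which differs from \<open>v\<close> since p/q < p'/q'.\<close>
  moreover have "(a, 0) \<in> S - E"
  proof -
    have "linking N a 0 w \<noteq> v" if "(a, w) \<in> S'" for w
    proof -
      have "linking N a 0 w = 2 * pi * \<i> * (of_nat q * of_int p')"
        using linking_0 [of a w p' q' a b q] that Ssub assms linking_sym unfolding N_def by auto
      then have "linking N a 0 w = v \<longleftrightarrow> complex_of_int (int q * p') = complex_of_int (int q' * p)"
        by (simp add: v_def)
      then show ?thesis using pq by (simp only: of_int_eq_iff)
    qed
    then show ?thesis using S(2) by (auto simp: E_def)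
  qed
  ultimately obtain z where z: "(b, z) \<in> S - E"
    using isolated_part_onto [of p q a b "S - E" a 0 b] assms(1,2) by auto
  have "linking N b z 0 = v"
    using linking_0 [of b z p q a b q'] z Ssub assms(2) unfolding N_def v_def by (auto simp: mult.commute)
  then show False using z S'(2) by (auto simp: E_def)
qed

end

section \<open>Small Siegel compacta: the non-escaping set\<close>

lemma closed_orbit_condition:
  fixes h :: "'a::topological_space \<Rightarrow> 'b::topological_space"
  assumes "continuous_on UNIV h" "closed T"
  shows "closed {x. h x \<in> T}"
proof -
  have "{x. h x \<in> T} = h -` T" by auto
  then show ?thesis using closed_vimage [OF assms(2,1)] by simp
qed

text \<open>The inside of \<open>K\<close> is mapped into itself; were the image smaller, the complement of the image
  of the filled set would be disconnected.\<close>
lemma filled_invariant: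
  fixes f :: "complex \<Rightarrow> complex"
  assumes K: "compact K" "f ` K = K" "K \<subseteq> cball 0 r" and "r < R"
    and holf: "f holomorphic_on ball 0 R" and inj: "inj_on f (ball 0 R)"
  shows "f ` (K \<union> inside K) = K \<union> inside K" "K \<union> inside K \<subseteq> cball 0 r" "compact (K \<union> inside K)"
    "connected (- (K \<union> inside K))"
proof -
  define I where "I = inside K"
  have clK: "closed K" and bK: "bounded K" using K(1) by (auto intro: compact_imp_closed compact_imp_bounded)
  have "- cball 0 r \<subseteq> outside K" by (rule outside_subset_convex) (use K in auto)
  moreover have "I \<inter> outside K = {}" by (simp add: I_def)
  ultimately have I: "I \<subseteq> cball 0 r" by blast
  have KI: "K \<union> I \<subseteq> cball 0 r" using I K by blast
  have compl: "- (K \<union> I) = outside K" by (simp add: I_def outside_inside)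
  have "closed (K \<union> I)"
    using open_outside [OF clK] unfolding compl [symmetric] by (simp only: closed_def)
  then have comp: "compact (K \<union> I)"
    using KI bounded_subset bounded_cball by (metis compact_eq_bounded_closed)
  have conn: "connected (- (K \<union> I))"
    unfolding compl by (rule connected_outside [OF bK]) simp
  have sub: "K \<union> I \<subseteq> ball 0 R" using KI \<open>r < R\<close> by auto
  have opI: "open I" unfolding I_def by (rule open_inside [OF clK])
  have holI: "f holomorphic_on I" by (rule holomorphic_on_subset [OF holf]) (use sub in blast)
  have opfI: "open (f ` I)"
    by (rule open_mapping_thm3 [OF holI opI]) (rule inj_on_subset [OF inj], use sub in blast)
  have cont: "continuous_on (K \<union> I) f"
    by (rule continuous_on_subset [OF holomorphic_on_imp_continuous_on [OF holf] sub])
  have disj: "f ` I \<inter> K = {}"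
  proof -
    have "f ` I \<inter> f ` K = f ` (I \<inter> K)"
      by (rule inj_on_image_Int [OF inj, symmetric]) (use sub in auto)
    then show ?thesis using K(2) by (simp add: I_def)
  qed
  have clf: "closure (f ` I) \<subseteq> f ` I \<union> K"
  proof -
    have "closed (f ` (K \<union> I))" by (intro compact_imp_closed compact_continuous_image cont comp)
    then have "closure (f ` I) \<subseteq> f ` (K \<union> I)" by (intro closure_minimal) auto
    then show ?thesis using K(2) by blast
  qed
  have fr: "frontier (f ` I) \<subseteq> K"
    using clf opfI unfolding frontier_def by (auto simp: interior_open)
  have bfI: "bounded (f ` I)"
    by (rule bounded_subset [OF compact_imp_bounded [OF compact_continuous_image [OF cont comp]]]) auto
  \<comment> \<open>A component of the complement of \<open>K\<close> cannot cross the frontier of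
    \<open>f\<close> I\<open>, which lies in\<close>K\<open>. A component meeting\<close>f
    \<open>I\<close> is therefore contained in it and bounded.\<close>
  have fI: "f ` I \<subseteq> I"
  proof
    fix x assume x: "x \<in> f ` I"
    let ?C = "connected_component_set (- K) x"
    have "?C \<inter> frontier (f ` I) = {}"
      using fr connected_component_subset [of "- K" x] by blast
    moreover have "x \<in> - K" using x disj by blast
    then have "x \<in> ?C" by simp
    then have "?C \<inter> f ` I \<noteq> {}" using x by blast
    ultimately have "?C - f ` I = {}"
      using connected_Int_frontier [OF connected_connected_component, of "- K" x "f ` I"] by blast
    then have "bounded ?C" using bfI bounded_subset by blast
    then show "x \<in> I" using x disj unfolding I_def inside_def by blast
  qed
  \<comment> \<open>Whether a compact set separates the plane depends only on its topological type,
    so the image also has connected complement.\<close>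
  have "f ` (K \<union> I) homeomorphic K \<union> I"
    using homeomorphic_compact [OF comp cont refl inj_on_subset [OF inj sub]] homeomorphic_sym by blast
  then have "f ` (K \<union> I) homotopy_eqv K \<union> I" by (rule homeomorphic_imp_homotopy_eqv)
  moreover have "compact (f ` (K \<union> I))" by (rule compact_continuous_image [OF cont comp])
  ultimately have conn': "connected (- f ` (K \<union> I))"
    using homotopy_eqv_separation comp conn by blast
  have split: "- f ` (K \<union> I) = outside K \<union> (I - closure (f ` I))"
  proof -
    have "I - closure (f ` I) = I - f ` I"
      using clf closure_subset [of "f ` I"] by (auto simp: I_def inside_def)
    moreover have "f ` (K \<union> I) = K \<union> f ` I" using K(2) by (simp add: image_Un)
    ultimately show ?thesis
      using compl fI disj by (auto simp: I_def inside_def)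
  qed
  have "I - closure (f ` I) = {}"
  proof (rule ccontr)
    assume ne: "I - closure (f ` I) \<noteq> {}"
    have "open (outside K)" by (rule open_outside [OF clK])
    moreover have "open (I - closure (f ` I))" using opI by (intro open_Diff) auto
    moreover have "outside K \<inter> (I - closure (f ` I)) = {}" by (auto simp: I_def inside_Int_outside dest: disjoint_iff [THEN iffD1, OF inside_Int_outside, rule_format])
    moreover have "outside K \<noteq> {}" by (rule outside_bounded_nonempty [OF bK])
    ultimately show False
      using conn' ne unfolding split connected_def by blast
  qed
  then have "I \<subseteq> f ` I" using clf by (auto simp: I_def inside_def)
  with fI have "f ` I = I" by blast
  then show "f ` (K \<union> inside K) = K \<union> inside K" using K(2) by (simp add: image_Un I_def)
  show "K \<union> inside K \<subseteq> cball 0 r" "compact (K \<union> inside K)" "connected (- (K \<union> inside K))"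
    using KI comp conn by (simp_all add: I_def)
qed

context disc_map
begin

text \<open>Midpoints of orbit segments of length \<open>2k\<close> in the disc; this describes two-sided orbits without
  mentioning an inverse of \<open>f\<close>.\<close>
definition nonescaping :: "nat \<Rightarrow> complex set" where
  "nonescaping k = (F \<alpha> ^^ k) ` {y. \<forall>j\<le>2*k. (F \<alpha> ^^ j) y \<in> cball 0 r}"

lemma nonescaping_compact: "compact (nonescaping k)"
proof -
  have "{y. \<forall>j\<le>2*k. (F \<alpha> ^^ j) y \<in> cball 0 r} = (\<Inter>j\<in>{..2*k}. {y. (F \<alpha> ^^ j) y \<in> cball 0 r})" by auto
  also have "closed \<dots>"
    by (intro closed_INT ballI closed_orbit_condition Fn_cont_snd closed_cball)
  finally have "closed {y. \<forall>j\<le>2*k. (F \<alpha> ^^ j) y \<in> cball 0 r}" .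
  moreover have "{y. \<forall>j\<le>2*k. (F \<alpha> ^^ j) y \<in> cball 0 r} \<subseteq> cball 0 r"
    by (metis (mono_tags, lifting) funpow_0 le0 mem_Collect_eq subsetI)
  ultimately have "compact {y. \<forall>j\<le>2*k. (F \<alpha> ^^ j) y \<in> cball 0 r}"
    using bounded_cball bounded_subset compact_eq_bounded_closed by blast
  then show ?thesis
    unfolding nonescaping_def
    by (intro compact_continuous_image continuous_on_subset [OF Fn_cont_snd]) auto
qed

lemma nonescaping_Suc: "nonescaping (Suc k) \<subseteq> nonescaping k"
proof
  fix x assume "x \<in> nonescaping (Suc k)"
  then obtain y where y: "x = (F \<alpha> ^^ Suc k) y" "\<And>j. j \<le> 2 * Suc k \<Longrightarrow> (F \<alpha> ^^ j) y \<in> cball 0 r"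
    unfolding nonescaping_def by blast
  have "(F \<alpha> ^^ j) (F \<alpha> y) = (F \<alpha> ^^ Suc j) y" for j by (simp add: funpow_swap1)
  then have "\<forall>j\<le>2*k. (F \<alpha> ^^ j) (F \<alpha> y) \<in> cball 0 r" "x = (F \<alpha> ^^ k) (F \<alpha> y)"
    using y by (metis Suc_le_mono mult_Suc_right add_2_eq_Suc le_SucI, metis)
  then show "x \<in> nonescaping k" unfolding nonescaping_def by blast
qed

lemma nonescaping_mono: "m \<le> n \<Longrightarrow> nonescaping n \<subseteq> nonescaping m"
  using lift_Suc_antimono_le [of nonescaping] nonescaping_Suc by blast

definition M :: "complex set" where "M = (\<Inter>k. nonescaping k)"

lemma M_compact: "compact M"
proof -
  have "closed M" unfolding M_def using nonescaping_compact compact_imp_closed by blast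
  then show ?thesis using nonescaping_compact [of 0] unfolding M_def
    by (metis INF_lower UNIV_I compact_Int_closed inf.absorb_iff2 M_def)
qed

lemma M_in: "M \<subseteq> cball 0 r"
proof -
  have "nonescaping 0 = cball 0 r" by (auto simp: nonescaping_def)
  then show ?thesis unfolding M_def by blast
qed

lemma zero_in_M: "0 \<in> M"
proof -
  have "0 \<in> nonescaping k" for k
    unfolding nonescaping_def using r by (intro image_eqI [of _ _ 0]) auto
  then show ?thesis by (simp add: M_def)
qed

lemma M_forward: "x \<in> M \<Longrightarrow> F \<alpha> x \<in> M"
proof -
  assume x: "x \<in> M"
  have "F \<alpha> x \<in> nonescaping k" for k
  proof -
    have "x \<in> nonescaping (Suc k)" using x by (simp add: M_def)
    then obtain y where y: "x = (F \<alpha> ^^ Suc k) y" "\<And>j. j \<le> 2 * Suc k \<Longrightarrow> (F \<alpha> ^^ j) y \<in> cball 0 r"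
      unfolding nonescaping_def by blast
    \<comment> \<open>Starting the window of length 2k two steps later moves its midpoint from
      \<open>x\<close> to \<open>F \<alpha> x\<close>, still inside the orbit segment of length 2k +
      2.\<close>
    have eq: "(F \<alpha> ^^ j) ((F \<alpha> ^^ 2) y) = (F \<alpha> ^^ (j + 2)) y" for j by (simp only: funpow_add o_apply)
    have "F \<alpha> x = (F \<alpha> ^^ k) ((F \<alpha> ^^ 2) y)"
      unfolding eq by (simp add: y(1))
    moreover have "(F \<alpha> ^^ j) ((F \<alpha> ^^ 2) y) \<in> cball 0 r" if "j \<le> 2 * k" for j
      unfolding eq using that by (intro y(2)) simp
    ultimately show ?thesis unfolding nonescaping_def by blast
  qed
  then show ?thesis by (simp add: M_def)
qed

text \<open>Each \<open>nonescaping k\<close> supplies its own preimage of \<open>x\<close> in the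
  disc; by injectivity all of them are the same point.\<close>

lemma M_backward:
  assumes "x \<in> M"
  obtains y where "y \<in> M" "F \<alpha> y = x"
proof -
  have ex: "\<exists>u. u \<in> nonescaping k \<and> u \<in> cball 0 r \<and> F \<alpha> u = x" for k
  proof -
    have "x \<in> nonescaping (Suc k)" using assms by (simp add: M_def)
    then obtain y where y: "x = (F \<alpha> ^^ Suc k) y" "\<And>j. j \<le> 2 * Suc k \<Longrightarrow> (F \<alpha> ^^ j) y \<in> cball 0 r"
      unfolding nonescaping_def by blast
    have "(F \<alpha> ^^ k) y \<in> nonescaping k"
      unfolding nonescaping_def using y(2) by (intro imageI) auto
    moreover have "(F \<alpha> ^^ k) y \<in> cball 0 r" using y(2) [of k] by simp
    ultimately show ?thesis using y(1) by auto
  qed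
  obtain u0 where u0: "u0 \<in> cball 0 r" "F \<alpha> u0 = x" using ex [of 0] by blast
  have "u0 \<in> nonescaping k" for k
    using ex [of k] F_inj [of _ u0 \<alpha>] u0 by metis
  then show thesis using that u0 by (auto simp: M_def)
qed

definition core :: "complex set" where "core = connected_component_set M 0"

lemma core_props: "compact core" "connected core" "0 \<in> core" "core \<subseteq> M"
proof -
  show "core \<subseteq> M" unfolding core_def by (rule connected_component_subset)
  moreover have "closed core"
    unfolding core_def by (intro closed_connected_component compact_imp_closed M_compact)
  ultimately show "compact core"
    using M_compact by (metis compact_Int_closed inf.absorb_iff2)
  show "connected core" unfolding core_def by simp
  show "0 \<in> core" unfolding core_def using zero_in_M by simp
qed

lemma core_invariant: "f ` core = core"
proof -
  have Feq: "F \<alpha> ` A = f ` A" if "A \<subseteq> cball 0 r" for A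
    using that F_alpha by (intro image_cong) auto
  have core_in: "core \<subseteq> cball 0 r" using core_props M_in by blast
  have contF: "continuous_on A (F \<alpha>)" for A
    using continuous_on_subset [OF Fn_cont_snd [of 1 \<alpha>]] by simp
  have "F \<alpha> ` core \<subseteq> core"
    unfolding core_def
  proof (rule connected_component_maximal)
    show "0 \<in> F \<alpha> ` connected_component_set M 0"
      using core_props(3) F_0 unfolding core_def by (metis image_eqI)
    show "connected (F \<alpha> ` connected_component_set M 0)"
      by (intro connected_continuous_image contF) simp
    show "F \<alpha> ` connected_component_set M 0 \<subseteq> M"
      using M_forward connected_component_subset by blast
  qed
  moreover have "core \<subseteq> F \<alpha> ` core"
  proof -
    \<comment> \<open>The inverse is continuous on the image of the compact disc and preserves
      \<open>M\<close>, so maximality of the component applies to it as well.\<close>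
    define h where "h = the_inv_into (cball 0 r) (F \<alpha>)"
    have inj: "inj_on (F \<alpha>) (cball 0 r)" using F_inj by (auto intro!: inj_onI)
    have conth: "continuous_on (F \<alpha> ` cball 0 r) h"
      unfolding h_def by (rule continuous_on_inv_into [OF contF compact_cball inj])
    have hM: "h x \<in> M \<and> F \<alpha> (h x) = x" if "x \<in> M" for x
    proof -
      obtain y where y: "y \<in> M" "F \<alpha> y = x" using M_backward [OF \<open>x \<in> M\<close>] .
      then have "h x = y" unfolding h_def using the_inv_into_f_f [OF inj, of y] M_in by auto
      then show ?thesis using y by simp
    qed
    have MF: "M \<subseteq> F \<alpha> ` cball 0 r" using hM M_in by (metis image_eqI subset_iff)
    have "h ` core \<subseteq> core"
      unfolding core_def
    proof (rule connected_component_maximal)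
      have "h 0 = 0" unfolding h_def using the_inv_into_f_f [OF inj, of 0] r by simp
      then show "0 \<in> h ` connected_component_set M 0"
        using core_props(3) unfolding core_def by (metis image_eqI)
      show "connected (h ` connected_component_set M 0)"
        by (intro connected_continuous_image continuous_on_subset [OF conth]
            subset_trans [OF connected_component_subset MF] connected_connected_component)
      show "h ` connected_component_set M 0 \<subseteq> M"
        using hM connected_component_subset by blast
    qed
    then show ?thesis using hM core_props(4) by (metis image_eqI image_subset_iff subset_iff)
  qed
  ultimately show ?thesis using Feq [OF core_in] by blast
qed

text \<open>If the core stayed inside, a neighbourhood \<open>U\<close> of 0 would have a frontier
  disjoint from \<open>M\<close>. Compactness reduces this to orbit segments of one finite length, a
  condition that survives small changes of t. Cycles of nearby \<open>F t\<close> then avoid the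
  frontier, so those inside \<open>U\<close> form an isolated part, for two rational rotation
  numbers on either side of \<alpha>.\<close>

lemma core_reaches_boundary: "core \<inter> sphere 0 r \<noteq> {}"
proof
  assume empty: "core \<inter> sphere 0 r = {}"
  have "core \<subseteq> cball 0 r" using core_props(4) M_in by blast
  then have core_ball: "core \<subseteq> ball 0 r" using empty by (force simp: less_le)
  have "core \<in> components M" unfolding core_def components_def using zero_in_M by blast
  \<comment> \<open>In a compact space a component is the intersection of the clopen sets containing
    it, so \<open>core\<close> lies in a clopen piece of \<open>M\<close> within the open
    disc.\<close>
  then obtain X where X: "openin (top_of_set M) X" "compact X" "core \<subseteq> X" "X \<subseteq> ball 0 r"
    using Sura_Bura_clopen_subset [OF closed_imp_locally_compact [OF compact_imp_closed [OF M_compact]] _ core_props(1) open_ball core_ball]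
    by blast
  have "closedin (top_of_set M) (M - X)"
    using X(1) by (simp add: closedin_def openin_imp_subset double_diff openin_subset)
  then have "closed (M - X)" using closedin_closed_trans M_compact compact_imp_closed by blast
  then have "closed ((M - X) \<union> - ball 0 r)" by (intro closed_Un) (simp_all add: closed_Compl)
  moreover have "X \<inter> ((M - X) \<union> - ball 0 r) = {}" using X(4) by blast
  ultimately obtain U V where U: "open U" "compact (closure U)" "open V" "X \<subseteq> U" "(M - X) \<union> - ball 0 r \<subseteq> V" "U \<inter> V = {}"
    using separation_normal_compact [OF X(2)] by blast
  have "V \<inter> closure U = {}" using U by (metis inf_commute open_Int_closure_eq_empty)
  then have clU: "closure U \<subseteq> ball 0 r" and frM: "frontier U \<inter> M = {}"
    using U X(3) unfolding frontier_def by (auto simp: interior_open)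
  have cfr: "compact (frontier U)" using U(2) compact_frontier_bounded compact_imp_bounded bounded_subset closure_subset by metis
  have zU: "0 \<in> U" using core_props(3) X U by blast
  \<comment> \<open>The compact sets \<open>nonescaping k\<close> decrease to \<open>M\<close>, so
    one of them already misses the frontier.\<close>
  obtain k where k: "nonescaping k \<inter> frontier U = {}"
  proof (rule ccontr)
    assume "\<not> thesis"
    then have ne: "nonescaping k \<inter> frontier U \<noteq> {}" for k using that by blast
    have "\<Inter> (range (\<lambda>k. nonescaping k \<inter> frontier U)) \<noteq> {}"
      by (rule compact_nest) (use ne nonescaping_mono cfr nonescaping_compact in \<open>auto intro: compact_Int\<close>)
    then show False using frM unfolding M_def by auto
  qed
  \<comment> \<open>\<open>B\<close> collects the segments violating this for parameters t near
    \<alpha>. The interval of half-length 1 only makes it compact; its projection is then closed and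
    omits \<alpha>.\<close>
  define B where "B = {x. fst x \<in> {\<alpha> - 1..\<alpha> + 1} \<and> (\<forall>j\<le>2*k. (F (fst x) ^^ j) (snd x) \<in> cball 0 r)
     \<and> (F (fst x) ^^ k) (snd x) \<in> frontier U}"
  have "B = {x. fst x \<in> {\<alpha> - 1..\<alpha> + 1}} \<inter> (\<Inter>j\<in>{..2*k}. {x. (F (fst x) ^^ j) (snd x) \<in> cball 0 r})
      \<inter> {x. (F (fst x) ^^ k) (snd x) \<in> frontier U}"
    unfolding B_def by auto
  also have "closed \<dots>"
    by (intro closed_Int closed_INT ballI closed_orbit_condition Fn_cont continuous_on_fst continuous_on_id
        closed_cball closed_real_atLeastAtMost frontier_closed)
  finally have "closed B" .
  moreover have "B \<subseteq> {\<alpha> - 1..\<alpha> + 1} \<times> cball 0 r"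
  proof
    fix x assume "x \<in> B"
    then have "fst x \<in> {\<alpha> - 1..\<alpha> + 1}" "(F (fst x) ^^ 0) (snd x) \<in> cball 0 r" unfolding B_def by blast+
    then show "x \<in> {\<alpha> - 1..\<alpha> + 1} \<times> cball 0 r" by (cases x) simp
  qed
  moreover have "bounded ({\<alpha> - 1..\<alpha> + 1} \<times> cball (0::complex) r)"
    by (intro bounded_Times) auto
  ultimately have "compact B" using bounded_subset compact_eq_bounded_closed by blast
  then have "closed (fst ` B)"
    by (intro compact_imp_closed compact_continuous_image continuous_intros)
  moreover have "\<alpha> \<notin> fst ` B"
  proof
    assume "\<alpha> \<in> fst ` B"
    then obtain y where "\<forall>j\<le>2*k. (F \<alpha> ^^ j) y \<in> cball 0 r" "(F \<alpha> ^^ k) y \<in> frontier U"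
      unfolding B_def by auto
    then show False using k unfolding nonescaping_def by blast
  qed
  ultimately obtain \<delta>0 where \<delta>0: "\<delta>0 > 0" "ball \<alpha> \<delta>0 \<subseteq> - fst ` B"
    by (metis ComplI open_Compl open_contains_ball)
  define \<delta> where "\<delta> = min \<delta>0 1"
  have \<delta>: "\<delta> > 0" using \<delta>0 by (simp add: \<delta>_def)
  have avoid: "(F t ^^ k) y \<notin> frontier U"
    if "\<bar>t - \<alpha>\<bar> < \<delta>" "\<And>j. (F t ^^ j) y \<in> cball 0 r" for t y
  proof
    assume "(F t ^^ k) y \<in> frontier U"
    moreover have "t \<in> {\<alpha> - 1..\<alpha> + 1}" using that(1) by (simp add: \<delta>_def abs_le_iff) linarith
    ultimately have "(t, y) \<in> B" using that(2) unfolding B_def by simp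
    then have "t \<in> fst ` B" by force
    moreover have "t \<in> ball \<alpha> \<delta>0" using that(1) by (simp add: \<delta>_def dist_real_def abs_minus_commute)
    ultimately show False using \<delta>0 by blast
  qed
  have iso: "isolated_part (cyc p q a b) {x \<in> cyc p q a b. \<forall>j. (F (fst x) ^^ j) (snd x) \<in> U}"
    if ab: "\<alpha> - \<delta> < a" "b < \<alpha> + \<delta>" and "q > 0" for p q a b
  proof -
    let ?Z = "cyc p q a b"
    let ?S = "{x \<in> ?Z. \<forall>j. (F (fst x) ^^ j) (snd x) \<in> U}"
    have nf: "(F t ^^ j) z \<notin> frontier U" if tz: "(t, z) \<in> ?Z" for t z j
    proof -
      have t: "\<bar>t - \<alpha>\<bar> < \<delta>" using tz ab by (auto simp: cyc_def abs_less_iff)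
      \<comment> \<open>By periodicity every point of a cycle is the midpoint of an orbit segment in
        the disc: going \<open>k * q + j - k\<close> steps forward amounts to going \<open>k\<close>
        steps back. The difference is not truncated because q > 0.\<close>
      define y where "y = (F t ^^ (k * q + j - k)) z"
      have "k + (k * q + j - k) = k * q + j" using \<open>q > 0\<close> by (cases q) auto
      then have "(F t ^^ k) y = (F t ^^ (k * q + j)) z"
        unfolding y_def by (metis comp_apply funpow_add)
      also have "\<dots> = (F t ^^ j) z" by (rule funpow_periodic [OF cyc_periodic [OF tz]])
      finally have "(F t ^^ k) y = (F t ^^ j) z" .
      moreover have "(F t ^^ i) y \<in> cball 0 r" for i
        unfolding y_def using cyc_orbit [OF tz \<open>q > 0\<close>, of "i + (k * q + j - k)"] by (simp add: funpow_add)
      ultimately show ?thesis using avoid [OF t] by metis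
    qed
    \<comment> \<open>As cycles avoid the frontier, \<open>U\<close> may be replaced by its closure,
      which shows that the set is closed.\<close>
    have eq: "?S = ?Z \<inter> (\<Inter>j. {x. (F (fst x) ^^ j) (snd x) \<in> closure U})"
      using nf U(1) closure_subset [of U] by (fastforce simp: frontier_def interior_open)
    \<comment> \<open>Periodicity leaves finitely many conditions, so the union of closed sets is
      closed.\<close>
    have "?Z - ?S = (\<Union>j<q. ?Z \<inter> {x. (F (fst x) ^^ j) (snd x) \<in> - U})"
    proof (intro set_eqI iffI)
      fix x assume x: "x \<in> ?Z - ?S"
      then obtain j where j: "(F (fst x) ^^ j) (snd x) \<notin> U" by blast
      have "(fst x, snd x) \<in> ?Z" using x by simp
      from funpow_periodic [OF cyc_periodic [OF this], of "j div q" "j mod q"]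
      have "(F (fst x) ^^ (j mod q)) (snd x) \<notin> U" using j by simp
      moreover have "j mod q < q" using \<open>q > 0\<close> by simp
      ultimately show "x \<in> (\<Union>j<q. ?Z \<inter> {x. (F (fst x) ^^ j) (snd x) \<in> - U})" using x by blast
    qed auto
    also have "closed \<dots>"
      using U(1) by (intro closed_UN closed_Int cyc_closed closed_orbit_condition Fn_cont ballI) auto
    finally have c2: "closed (?Z - ?S)" .
    have c1: "closed ?S"
      unfolding eq by (intro closed_Int closed_INT ballI cyc_closed closed_orbit_condition Fn_cont closed_closure)
    show ?thesis
      unfolding isolated_part_def
      using c1 c2 closure_subset [of U] clU by fastforce
  qed
  obtain a where a: "a \<in> \<rat>" "\<alpha> - \<delta> < a" "a < \<alpha>" using Rats_dense_in_real [of "\<alpha> - \<delta>" \<alpha>] \<delta> by auto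
  obtain b where b: "b \<in> \<rat>" "\<alpha> < b" "b < \<alpha> + \<delta>" using Rats_dense_in_real [of \<alpha> "\<alpha> + \<delta>"] \<delta> by auto
  obtain p q where pq: "q > 0" "a = of_int p / of_int q" using a(1) by (rule Rats_cases')
  obtain p' q' where pq': "q' > 0" "b = of_int p' / of_int q'" using b(1) by (rule Rats_cases')
  have q1: "real (nat q) * a = of_int p" "nat q > 0" using pq by auto
  have q2: "real (nat q') * b = of_int p'" "nat q' > 0" using pq' by auto
  have "a < b" using a b by linarith
  show False
  proof (rule no_two_isolated_parts [OF \<open>a < b\<close> q1(2) q2(2) q1(1) q2(1)])
    show "isolated_part (cyc p (nat q) a b) {x \<in> cyc p (nat q) a b. \<forall>j. (F (fst x) ^^ j) (snd x) \<in> U}"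
      by (rule iso [OF a(2) b(3) q1(2)])
    show "isolated_part (cyc p' (nat q') a b) {x \<in> cyc p' (nat q') a b. \<forall>j. (F (fst x) ^^ j) (snd x) \<in> U}"
      by (rule iso [OF a(2) b(3) q2(2)])
    show "(a, 0) \<in> {x \<in> cyc p (nat q) a b. \<forall>j. (F (fst x) ^^ j) (snd x) \<in> U}"
      using cyc_zero [OF _ q1(1), of a b] \<open>a < b\<close> zU by simp
    show "(b, 0) \<in> {x \<in> cyc p' (nat q') a b. \<forall>j. (F (fst x) ^^ j) (snd x) \<in> U}"
      using cyc_zero [OF _ q2(1), of a b] \<open>a < b\<close> zU by simp
  qed
qed

text \<open>Adding \<open>inside core\<close> makes the core full without destroying invariance, and
  meeting the circle of radius \<open>r\<close> prevents it from being {0}.\<close>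

lemma siegel_compact_core: "siegel_compact f (core \<union> inside core)" "core \<union> inside core \<subseteq> cball 0 r"
proof -
  define K where "K = core \<union> inside core"
  have core_in: "core \<subseteq> cball 0 r" using core_props(4) M_in by blast
  note fill = filled_invariant [OF core_props(1) core_invariant core_in r(2) holf f_inj, folded K_def]
  have KR: "K \<subseteq> ball 0 R" using fill(2) r by auto
  have "connected K"
    unfolding K_def using connected_with_inside core_props compact_imp_closed by blast
  moreover have "0 \<in> K" using core_props(3) by (simp add: K_def)
  moreover have "K \<noteq> {0}"
  proof -
    obtain x where "x \<in> core" "x \<in> sphere 0 r" using core_reaches_boundary by blast
    then have "x \<in> core" "x \<noteq> 0" using r(1) by auto
    then show ?thesis unfolding K_def by blast
  qed
  moreover have "\<exists>U G. open U \<and> K \<subseteq> U \<and> G holomorphic_on U \<and> inj_on G U \<and>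
      (\<forall>\<^sub>F z in nhds 0. G z = f z) \<and> G ` K = K"
    using KR holf f_inj fill(1) by (intro exI [of _ "ball 0 R"] exI [of _ f]) auto
  moreover have "\<exists>V G. open V \<and> K \<subseteq> V \<and> G holomorphic_on V \<and> inj_on G V \<and>
      (\<forall>\<^sub>F z in nhds 0. G (f z) = z) \<and> G ` K = K"
  proof -
    obtain G where G: "G holomorphic_on (f ` ball 0 R)" "\<And>z. z \<in> ball 0 R \<Longrightarrow> G (f z) = z"
      using holomorphic_has_inverse [OF holf open_ball f_inj] by metis
    have "open (f ` ball 0 R)" by (rule open_mapping_thm3 [OF holf open_ball f_inj])
    moreover have "K \<subseteq> f ` ball 0 R" using fill(1) KR by blast
    moreover have "inj_on G (f ` ball 0 R)" using G(2) by (auto intro!: inj_onI)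
    moreover have "\<forall>\<^sub>F z in nhds 0. z \<in> ball (0::complex) R"
      using r by (intro eventually_nhds_in_open) auto
    then have "\<forall>\<^sub>F z in nhds 0. G (f z) = z" by (rule eventually_mono) (rule G(2))
    moreover have "G ` K = K"
    proof -
      have "G ` (f ` K) = K" using G(2) KR by (force simp: image_image)
      then show ?thesis using fill(1) by simp
    qed
    ultimately show ?thesis using G(1) by blast
  qed
  ultimately show "siegel_compact f (core \<union> inside core)"
    unfolding siegel_compact_def full_continuum_def K_def [symmetric]
    using fill(3,4) by (simp only: Compl_eq_Diff_UNIV) blast
  show "core \<union> inside core \<subseteq> cball 0 r" using fill(2) by (simp add: K_def)
qed

end

section \<open>Germs and Siegel compacta\<close>

lemma diff_germ_analytic:
  assumes "diff_germ f"
  shows "f analytic_on {0}" "f 0 = 0" "deriv f 0 \<noteq> 0"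
proof -
  obtain r where r: "r > 0" "f holomorphic_on ball 0 r" "inj_on f (ball 0 r)" "f 0 = 0"
    using assms unfolding diff_germ_def by blast
  then show "f analytic_on {0}" "f 0 = 0" by (auto simp: analytic_on_def)
  show "deriv f 0 \<noteq> 0"
    using holomorphic_injective_imp_regular [OF r(2) open_ball r(3)] r(1) by simp
qed

text \<open>Small Siegel compacta give substance to germ equality, which constrains only compacta of
  small diameter, and supply the hedgehog for the forward direction.\<close>

theorem small_siegel_compact:
  assumes "diff_germ f" "deriv f 0 = cis (2 * pi * \<alpha>)" "\<epsilon> > 0"
  obtains K where "siegel_compact f K" "K \<subseteq> cball 0 \<epsilon>"
proof -
  note an = diff_germ_analytic [OF assms(1)]
  obtain R0 where R0: "R0 > 0" "f holomorphic_on ball 0 R0"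
    using an(1) by (rule analytic_at_0_D)
  obtain \<delta> where \<delta>: "\<delta> > 0"
    "\<And>u v. u \<in> ball 0 \<delta> \<Longrightarrow> v \<in> ball 0 \<delta> \<Longrightarrow> norm (f u - f v - deriv f 0 * (u - v)) \<le> (1/2) * norm (u - v)"
    using strict_derivative_at_0 [OF an(1), of "1/2"] by auto
  define R where "R = min R0 \<delta>"
  define r where "r = min \<epsilon> (R / 2)"
  have R: "R > 0" using R0 \<delta> by (simp add: R_def)
  interpret disc_map f \<alpha> r R
  proof
    show "0 < r" "r < R" using R assms(3) by (auto simp: r_def)
    show "f holomorphic_on ball 0 R" using R0(2) by (rule holomorphic_on_subset) (auto simp: R_def)
    show "f 0 = 0" "deriv f 0 = cis (2 * pi * \<alpha>)" by fact+
    fix z w :: complex assume zw: "z \<in> ball 0 R" "w \<in> ball 0 R" "z \<noteq> w"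
    have "(f z - f w) / (cis (2 * pi * \<alpha>) * (z - w)) - 1 = (f z - f w - deriv f 0 * (z - w)) / (cis (2 * pi * \<alpha>) * (z - w))"
      using zw(3) by (simp add: assms(2) diff_divide_distrib)
    then have "norm ((f z - f w) / (cis (2 * pi * \<alpha>) * (z - w)) - 1) = norm (f z - f w - deriv f 0 * (z - w)) / norm (z - w)"
      by (simp add: norm_divide norm_mult)
    also have "\<dots> \<le> 1 / 2"
      using \<delta>(2) [of z w] zw by (simp add: divide_le_eq R_def)
    finally show "norm ((f z - f w) / (cis (2 * pi * \<alpha>) * (z - w)) - 1) \<le> 1 / 2" .
  qed
  have "cball (0::complex) r \<subseteq> cball 0 \<epsilon>" by (auto simp: r_def)
  then show thesis using that siegel_compact_core by blast
qed

text \<open>Averages of the normalized iterates converge (along a subsequence) to a map semiconjugating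
  the germ to its rotation.\<close>
lemma interior_imp_linearizable:
  assumes "siegel_compact f K" "f analytic_on {0}" "f 0 = 0" and norm1: "norm (deriv f 0) = 1" and "0 \<in> interior K"
  shows "linearizable f"
proof -
  define \<mu> where "\<mu> = deriv f 0"
  have \<mu>: "norm \<mu> = 1" "\<mu> \<noteq> 0" using norm1 by (auto simp: \<mu>_def)
  obtain U F where U: "open U" "K \<subseteq> U" "F holomorphic_on U" "\<forall>\<^sub>F z in nhds 0. F z = f z" "F ` K = K"
    using assms(1) unfolding siegel_compact_def by blast
  have "compact K" using assms(1) unfolding siegel_compact_def full_continuum_def by blast
  then obtain B where B: "\<And>z. z \<in> K \<Longrightarrow> norm z \<le> B"
    using compact_imp_bounded bounded_iff by metis
  obtain \<rho> where \<rho>: "\<rho> > 0" "ball 0 \<rho> \<subseteq> K"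
    using assms(5) mem_interior by blast
  have F0: "F 0 = 0" using eventually_nhds_x_imp_x [OF U(4)] assms(3) by simp
  have dF: "deriv F 0 = \<mu>" unfolding \<mu>_def by (rule deriv_cong_ev [OF U(4) refl])
  have FnK: "(F ^^ j) z \<in> K" if "z \<in> K" for j z
    by (induction j) (use that U(5) in auto)
  have Fn0: "(F ^^ j) 0 = 0" for j by (induction j) (auto simp: F0)
  have Fnhol: "(F ^^ j) holomorphic_on ball 0 \<rho>" for j
  proof (induction j)
    case (Suc j)
    have "F \<circ> (F ^^ j) holomorphic_on ball 0 \<rho>"
      by (rule holomorphic_on_compose_gen [OF Suc U(3)]) (use FnK \<rho> U in auto)
    then show ?case by (simp only: funpow.simps)
  qed (simp add: id_def)
  have Fder: "deriv (F ^^ j) 0 = \<mu> ^ j" for j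
  proof (induction j)
    case (Suc j)
    have "deriv (F \<circ> (F ^^ j)) 0 = deriv F ((F ^^ j) 0) * deriv (F ^^ j) 0"
    proof (rule deriv_chain)
      show "(F ^^ j) field_differentiable at 0"
        using Fnhol [of j] \<rho>(1) by (simp add: holomorphic_on_imp_differentiable_at)
      have "0 \<in> U" using \<rho> U(2) by force
      then show "F field_differentiable at ((F ^^ j) 0)"
        unfolding Fn0 using U(1,3) by (simp add: holomorphic_on_imp_differentiable_at)
    qed
    then show ?case unfolding Suc Fn0 dF by (simp only: funpow.simps power_Suc)
  qed simp
  define A where "A = (\<lambda>N z. (\<Sum>j<Suc N. (F ^^ j) z / \<mu> ^ j) / of_nat (Suc N))"
  have Ahol: "A N holomorphic_on ball 0 \<rho>" for N
    unfolding A_def using \<mu> by (intro holomorphic_intros Fnhol) auto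
  have Abound: "norm (A N z) \<le> B" if "z \<in> ball 0 \<rho>" for N z
  proof -
    have "norm (\<Sum>j<Suc N. (F ^^ j) z / \<mu> ^ j) \<le> (\<Sum>j<Suc N. B)"
    proof (rule sum_norm_le)
      fix j
      show "norm ((F ^^ j) z / \<mu> ^ j) \<le> B"
        using B [OF FnK, of z j] that \<rho> \<mu> by (auto simp: norm_divide norm_power)
    qed
    then have "norm (\<Sum>j<Suc N. (F ^^ j) z / \<mu> ^ j) \<le> real (Suc N) * B" by simp
    then show ?thesis unfolding A_def norm_divide norm_of_nat by (simp add: divide_le_eq mult.commute)
  qed
  have Ader: "deriv (A N) 0 = 1" for N
  proof -
    have "((\<lambda>z. (F ^^ j) z / \<mu> ^ j) has_field_derivative 1) (at 0)" for j
    proof -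
      have "((F ^^ j) has_field_derivative \<mu> ^ j) (at 0)"
        using holomorphic_derivI [OF Fnhol [of j] open_ball, of 0 UNIV] \<rho>(1) Fder by simp
      then show ?thesis using \<mu>(2) by (auto intro!: derivative_eq_intros)
    qed
    then have "((\<lambda>z. (\<Sum>j<Suc N. (F ^^ j) z / \<mu> ^ j) / of_nat (Suc N)) has_field_derivative (\<Sum>j<Suc N. 1) / of_nat (Suc N)) (at 0)"
      by (intro DERIV_cdivide DERIV_sum)
    then have "(A N has_field_derivative 1) (at 0)"
      unfolding A_def by (simp del: sum.lessThan_Suc of_nat_Suc)
    then show ?thesis by (rule DERIV_imp_deriv)
  qed
  have A0: "A N 0 = 0" for N by (simp add: A_def Fn0)
  \<comment> \<open>All iterates map the disc into the bounded set \<open>K\<close>, so the averages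
    are uniformly bounded and form a normal family.\<close>
  obtain H s where H: "H holomorphic_on ball 0 \<rho>" "strict_mono (s :: nat \<Rightarrow> nat)"
      "\<And>z. z \<in> ball 0 \<rho> \<Longrightarrow> (\<lambda>n. A (s n) z) \<longlonglongrightarrow> H z"
      "\<And>C. compact C \<Longrightarrow> C \<subseteq> ball 0 \<rho> \<Longrightarrow> uniform_limit C (A \<circ> s) H sequentially"
    by (rule Montel [of "ball 0 \<rho>" "range A" A]) (use Ahol Abound in blast)+
  have z0: "0 \<in> ball (0::complex) \<rho>" using \<rho>(1) by simp
  have H0: "H 0 = 0" using H(3) [OF z0] by (simp add: A0 LIMSEQ_const_iff)
  have dH: "deriv H 0 = 1"
  proof -
    have "(\<lambda>n. deriv (A (s n)) 0) \<longlonglongrightarrow> deriv H 0"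
    proof -
      have "uniform_limit (cball 0 (\<rho>/2)) (A \<circ> s) H sequentially"
        by (rule H(4)) (use \<rho>(1) in auto)
      then have ul: "uniform_limit (cball 0 (\<rho>/2)) (\<lambda>n. A (s n)) H sequentially" by (simp add: o_def)
      have "(\<lambda>n. (deriv ^^ 1) (A (s n)) 0) \<longlonglongrightarrow> (deriv ^^ 1) H 0"
      proof (rule higher_deriv_complex_uniform_limit)
        show "uniform_limit (ball 0 (\<rho>/2)) (\<lambda>n. A (s n)) H sequentially"
          by (rule uniform_limit_on_subset [OF ul]) auto
        show "\<forall>\<^sub>F n in sequentially. A (s n) holomorphic_on ball 0 (\<rho>/2)"
          by (intro always_eventually allI holomorphic_on_subset [OF Ahol]) (use \<rho>(1) in auto)
      qed (use \<rho>(1) in auto)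
      then show ?thesis by simp
    qed
    then show ?thesis by (simp add: Ader LIMSEQ_const_iff)
  qed
  have semi: "H (F z) = \<mu> * H z" if z: "z \<in> ball 0 \<rho>" "F z \<in> ball 0 \<rho>" for z
  proof -
    \<comment> \<open>Shifting the index by one changes the sum only in its two end terms; these are
      bounded, so the defect is of order 1/N.\<close>
    have diff: "A N (F z) - \<mu> * A N z = \<mu> * ((F ^^ Suc N) z / \<mu> ^ Suc N - z) / of_nat (Suc N)" for N
    proof -
      have "(\<Sum>j<Suc N. (F ^^ j) (F z) / \<mu> ^ j) = (\<Sum>j<Suc N. \<mu> * ((F ^^ Suc j) z / \<mu> ^ Suc j))"
        using \<mu>(2) by (intro sum.cong) (auto simp: funpow_swap1)
      then have "(\<Sum>j<Suc N. (F ^^ j) (F z) / \<mu> ^ j) - \<mu> * (\<Sum>j<Suc N. (F ^^ j) z / \<mu> ^ j)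
          = \<mu> * (\<Sum>j<Suc N. (F ^^ Suc j) z / \<mu> ^ Suc j - (F ^^ j) z / \<mu> ^ j)"
        by (simp only: sum_distrib_left [symmetric] sum_subtractf right_diff_distrib)
      also have "(\<Sum>j<Suc N. (F ^^ Suc j) z / \<mu> ^ Suc j - (F ^^ j) z / \<mu> ^ j) = (F ^^ Suc N) z / \<mu> ^ Suc N - z"
        using sum_lessThan_telescope [of "\<lambda>j. (F ^^ j) z / \<mu> ^ j" "Suc N"] by simp
      finally show ?thesis
        unfolding A_def times_divide_eq_right diff_divide_distrib [symmetric] by simp
    qed
    have bnd: "norm (A N (F z) - \<mu> * A N z) \<le> 2 * B * (1 / real (Suc N))" for N
    proof -
      have zK: "z \<in> K" using z \<rho> by blast
      have "norm ((F ^^ Suc N) z / \<mu> ^ Suc N - z) \<le> norm ((F ^^ Suc N) z / \<mu> ^ Suc N) + norm z"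
        by (rule norm_triangle_ineq4)
      also have "\<dots> \<le> B + B"
        using B [OF FnK [OF zK], of "Suc N"] B [OF zK] \<mu>(1) by (intro add_mono) (auto simp: norm_divide norm_power norm_mult)
      finally show ?thesis
        unfolding diff norm_divide norm_mult norm_of_nat by (simp add: \<mu> divide_right_mono)
    qed
    have "(\<lambda>n. 1 / real (Suc n)) \<longlonglongrightarrow> 0"
      using LIMSEQ_inverse_real_of_nat by (simp add: inverse_eq_divide)
    then have "(\<lambda>n. 2 * B * (1 / real (Suc n))) \<longlonglongrightarrow> 0"
      by (rule tendsto_mult_right_zero)
    then have "(\<lambda>N. A N (F z) - \<mu> * A N z) \<longlonglongrightarrow> 0"
      by (rule Lim_null_comparison [rotated]) (intro always_eventually allI bnd)
    then have "(\<lambda>n. A (s n) (F z) - \<mu> * A (s n) z) \<longlonglongrightarrow> 0"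
      using LIMSEQ_subseq_LIMSEQ [OF _ H(2)] unfolding o_def by blast
    moreover have "(\<lambda>n. A (s n) (F z) - \<mu> * A (s n) z) \<longlonglongrightarrow> H (F z) - \<mu> * H z"
      by (intro tendsto_intros H(3) z)
    ultimately have "H (F z) - \<mu> * H z = 0" by (rule LIMSEQ_unique [symmetric])
    then show ?thesis by simp
  qed
  have Han: "H analytic_on {0}" using H(1) \<rho>(1) by (auto simp: analytic_on_def)
  \<comment> \<open>\<open>H\<close> satisfies H o F = \<mu> H near 0, so its local inverse is the
    linearizing map.\<close>
  obtain h where h: "h analytic_on {0}" "h 0 = 0" "deriv h 0 = inverse (deriv H 0)"
    "\<forall>\<^sub>F z in nhds 0. H (h z) = z" "\<forall>\<^sub>F z in nhds 0. h (H z) = z"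
    by (rule analytic_local_inverse [OF Han H0]) (use dH in auto)
  obtain r where r: "r > 0" "h holomorphic_on ball 0 r" using h(1) by (rule analytic_at_0_D)
  have th: "filterlim h (nhds 0) (nhds 0)" by (rule analytic_at_0_tendsto [OF h(1,2)])
  have tf: "filterlim f (nhds 0) (nhds 0)" by (rule analytic_at_0_tendsto [OF assms(2,3)])
  have inb: "\<forall>\<^sub>F z in nhds 0. z \<in> ball (0::complex) \<rho>"
    using \<rho>(1) by (intro eventually_nhds_in_open) auto
  have fh: "filterlim (\<lambda>w. f (h w)) (nhds 0) (nhds 0)" by (rule filterlim_compose [OF tf th])
  have ev: "\<forall>\<^sub>F w in nhds 0. f (h w) = h (\<mu> * w)"
    using eventually_compose_filterlim [OF U(4) th] eventually_compose_filterlim [OF inb th]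
      eventually_compose_filterlim [OF inb fh] h(4) eventually_compose_filterlim [OF h(5) fh]
  proof eventually_elim
    case (elim w)
    have "H (F (h w)) = \<mu> * H (h w)"
      by (rule semi [OF elim(2)]) (use elim(1,3) in simp)
    then have "H (f (h w)) = \<mu> * w" by (simp only: elim(1,4))
    then show ?case using elim(5) by (simp only:)
  qed
  have "deriv h 0 = 1" using h(3) dH by simp
  then show ?thesis
    unfolding linearizable_def \<mu>_def [symmetric] using r h(2) ev by blast
qed

text \<open>Restricting the map of any linearization domain to a small disc, where the extension
  agrees with \<open>f\<close>, would linearize the germ.\<close>

lemma hedgehog_iff_siegel_compact:
  assumes "f analytic_on {0}" "f 0 = 0" "\<not> linearizable f"
  shows "hedgehog f K \<longleftrightarrow> siegel_compact f K"
proof -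
  have "\<not> linearization_domain f D" for D
  proof
    assume "linearization_domain f D"
    then obtain B h F where B: "B = UNIV \<or> (\<exists>\<rho>>0. B = ball 0 \<rho>)" and h: "h holomorphic_on B" "h 0 = 0" "deriv h 0 = 1"
      and F: "\<forall>\<^sub>F z in nhds 0. F z = f z" "\<forall>w\<in>B. F (h w) = h (deriv f 0 * w)"
      unfolding linearization_domain_def by blast
    obtain \<rho> where \<rho>: "\<rho> > 0" "ball 0 \<rho> \<subseteq> B"
      using B zero_less_one by (metis order_refl top_greatest)
    have hol: "h holomorphic_on ball 0 \<rho>" using h(1) \<rho>(2) by (rule holomorphic_on_subset)
    then have "h analytic_on {0}" using \<rho>(1) by (auto simp: analytic_on_def)
    then have "filterlim h (nhds 0) (nhds 0)" using analytic_at_0_tendsto h(2) by blast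
    then have "\<forall>\<^sub>F w in nhds 0. F (h w) = f (h w)"
      by (rule eventually_compose_filterlim [OF F(1)])
    moreover have "\<forall>\<^sub>F w in nhds 0. w \<in> ball (0::complex) \<rho>"
      using \<rho>(1) by (intro eventually_nhds_in_open) auto
    ultimately have "\<forall>\<^sub>F w in nhds 0. f (h w) = h (deriv f 0 * w)"
    proof eventually_elim
      case (elim w)
      then have "w \<in> B" using \<rho>(2) by blast
      then show ?case using F(2) elim(1) by simp
    qed
    then have "linearizable f"
      unfolding linearizable_def using hol \<rho>(1) h by blast
    with assms(3) show False by contradiction
  qed
  then show ?thesis unfolding hedgehog_def by blast
qed

text \<open>Since the extension is injective on a whole neighbourhood of \<open>K\<close> and maps
  \<open>K\<close> onto itself, no nearby point outside \<open>K\<close> can enter it.\<close>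

lemma siegel_compact_locally_invariant:
  assumes "siegel_compact f K"
  shows "\<forall>\<^sub>F z in nhds 0. f z \<in> K \<longleftrightarrow> z \<in> K"
proof -
  obtain U F where U: "open U" "K \<subseteq> U" "inj_on F U" "\<forall>\<^sub>F z in nhds 0. F z = f z" "F ` K = K"
    and "0 \<in> K"
    using assms unfolding siegel_compact_def by blast
  then have "\<forall>\<^sub>F z in nhds 0. z \<in> U" by (intro eventually_nhds_in_open) auto
  with U(4) show ?thesis
  proof eventually_elim
    case (elim z)
    have "F z \<in> F ` K \<longleftrightarrow> z \<in> K" by (rule inj_on_image_mem_iff [OF U(3) elim(2) U(2)])
    then show ?case using U(5) elim(1) by simp
  qed
qed

section \<open>Transport of Siegel compacta by univalent maps\<close>

lemma image_left_inverse:
  assumes "\<And>z. z \<in> A \<Longrightarrow> \<psi> (\<phi> z) = z"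
  shows "\<psi> ` \<phi> ` A = A"
proof -
  have "(\<lambda>z. \<psi> (\<phi> z)) ` A = (\<lambda>z. z) ` A" by (rule image_cong [OF refl assms])
  then show ?thesis by (simp only: image_image image_ident)
qed

text \<open>The neighbourhood is cut down to the points whose image under \<open>F\<close> is still
  in the domain of \<phi>. The lemma serves both the extension of the germ and that of its
  inverse.\<close>

lemma conjugate_extension:
  assumes W: "open W" "\<phi> holomorphic_on W" "inj_on \<phi> W" "K \<subseteq> W"
    and \<psi>: "\<psi> holomorphic_on \<phi> ` W" "\<And>z. z \<in> W \<Longrightarrow> \<psi> (\<phi> z) = z"
    and F: "open U" "K \<subseteq> U" "F holomorphic_on U" "inj_on F U" "F ` K = K"
  obtains V where "open V" "\<phi> ` K \<subseteq> V" "(\<phi> \<circ> F \<circ> \<psi>) holomorphic_on V" "inj_on (\<phi> \<circ> F \<circ> \<psi>) V"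
    "(\<phi> \<circ> F \<circ> \<psi>) ` (\<phi> ` K) = \<phi> ` K"
proof -
  define A where "A = (U \<inter> W) \<inter> F -` W"
  have "continuous_on (U \<inter> W) F"
    by (rule continuous_on_subset [OF holomorphic_on_imp_continuous_on [OF F(3)]]) auto
  then have opA: "open A" unfolding A_def using F(1) W(1) by (intro continuous_open_preimage open_Int)
  have KA: "K \<subseteq> A" using F W by (auto simp: A_def)
  have A: "A \<subseteq> U" "A \<subseteq> W" "F ` A \<subseteq> W" by (auto simp: A_def)
  have \<psi>A: "\<psi> ` \<phi> ` A = A" by (rule image_left_inverse) (use \<psi>(2) A in blast)
  show thesis
  proof (rule that [of "\<phi> ` A"])
    show "open (\<phi> ` A)"
      by (rule open_mapping_thm3 [OF _ opA]) (use A W in \<open>blast intro: holomorphic_on_subset inj_on_subset\<close>)+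
    show "\<phi> ` K \<subseteq> \<phi> ` A" using KA by blast
    have h1: "\<psi> holomorphic_on \<phi> ` A" by (rule holomorphic_on_subset [OF \<psi>(1)]) (use A in blast)
    have h2: "F holomorphic_on A" by (rule holomorphic_on_subset [OF F(3) A(1)])
    have "(\<phi> \<circ> F) holomorphic_on A"
      by (rule holomorphic_on_compose_gen [OF h2 W(2)]) (use A in blast)
    then show "(\<phi> \<circ> F \<circ> \<psi>) holomorphic_on \<phi> ` A"
      by (rule holomorphic_on_compose_gen [OF h1]) (use \<psi>A in blast)
    have "inj_on (\<phi> \<circ> F) (\<psi> ` \<phi> ` A)"
      unfolding \<psi>A by (rule comp_inj_on) (use A W(3) F(4) in \<open>blast intro: inj_on_subset\<close>)+
    moreover have "inj_on \<psi> (\<phi> ` A)" by (rule inj_on_inverseI [where g = \<phi>]) (use \<psi>(2) A in auto)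
    ultimately show "inj_on (\<phi> \<circ> F \<circ> \<psi>) (\<phi> ` A)"
      by (rule comp_inj_on [rotated])
    have "\<psi> ` \<phi> ` K = K" by (rule image_left_inverse) (use \<psi>(2) W(4) in blast)
    moreover have "(\<phi> \<circ> F \<circ> \<psi>) ` (\<phi> ` K) = \<phi> ` F ` \<psi> ` \<phi> ` K" by (simp add: image_image)
    ultimately show "(\<phi> \<circ> F \<circ> \<psi>) ` (\<phi> ` K) = \<phi> ` K" by (simp only: F(5))
  qed
qed

text \<open>\<phi> is controlled only on \<open>K\<close> and not on its complement, so fullness is
  transported as a topological invariant of compact plane sets.\<close>

lemma univalent_image_full:
  assumes "compact K" "connected (- K)" "continuous_on K \<phi>" "inj_on \<phi> K"
  shows "connected (- \<phi> ` (K :: complex set) :: complex set)"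
proof -
  have "K homeomorphic \<phi> ` K" by (rule homeomorphic_compact [OF assms(1,3) refl assms(4)])
  then have "K homotopy_eqv \<phi> ` K" by (rule homeomorphic_imp_homotopy_eqv)
  then show ?thesis
    using homotopy_eqv_separation [of K "\<phi> ` K"] assms compact_continuous_image by blast
qed

text \<open>The conjugacy equation holds only near 0, while the extensions live around all of
  \<open>K\<close>. The extensions are conjugated globally and compared with \<open>f2\<close> only
  near 0.\<close>

lemma siegel_compact_transport:
  assumes f1: "f1 analytic_on {0}" "f1 0 = 0"
    and W: "open W" "\<phi> holomorphic_on W" "inj_on \<phi> W" "K \<subseteq> W" and "\<phi> 0 = 0"
    and conj: "conjugates \<phi> f1 f2" and K: "siegel_compact f1 K"
  shows "siegel_compact f2 (\<phi> ` K)"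
proof -
  obtain \<psi> where \<psi>: "\<psi> holomorphic_on \<phi> ` W" "\<And>z. z \<in> W \<Longrightarrow> \<psi> (\<phi> z) = z"
    using holomorphic_has_inverse [OF W(2,1,3)] by metis
  have K0: "0 \<in> K" "K \<noteq> {0}" and full: "compact K" "connected K" "connected (- K)"
    using K unfolding siegel_compact_def full_continuum_def Compl_eq_Diff_UNIV by blast+
  have "0 \<in> W" using K0 W by blast
  have opW: "open (\<phi> ` W)" by (rule open_mapping_thm3 [OF W(2,1,3)])
  have 0: "0 \<in> \<phi> ` W" "\<psi> 0 = 0" using \<open>0 \<in> W\<close> \<open>\<phi> 0 = 0\<close> \<psi>(2) by force+
  have "\<psi> analytic_on {0}" using \<psi>(1) opW 0 by (metis analytic_at)
  then have t\<psi>: "filterlim \<psi> (nhds 0) (nhds 0)" using analytic_at_0_tendsto 0 by blast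
  have tf: "filterlim (\<lambda>y. f1 (\<psi> y)) (nhds 0) (nhds 0)"
    by (rule filterlim_compose [OF analytic_at_0_tendsto(1) [OF f1] t\<psi>])
  have y: "\<forall>\<^sub>F y in nhds 0. y \<in> \<phi> ` W" by (rule eventually_nhds_in_open [OF opW 0(1)])
  have fW: "\<forall>\<^sub>F y in nhds 0. f1 (\<psi> y) \<in> W"
    by (rule eventually_compose_filterlim [OF eventually_nhds_in_open [OF W(1) \<open>0 \<in> W\<close>] tf])
  have cj: "\<forall>\<^sub>F y in nhds 0. \<phi> (f1 (\<psi> y)) = f2 y"
    using eventually_compose_filterlim [OF conj [unfolded conjugates_def] t\<psi>] y
    by eventually_elim (auto simp: \<psi>(2))
  have cont: "continuous_on K \<phi>"
    by (rule continuous_on_subset [OF holomorphic_on_imp_continuous_on [OF W(2)] W(4)])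
  have injK: "inj_on \<phi> K" by (rule inj_on_subset [OF W(3,4)])
  obtain U F where U: "open U" "K \<subseteq> U" "F holomorphic_on U" "inj_on F U" "\<forall>\<^sub>F z in nhds 0. F z = f1 z" "F ` K = K"
    using K unfolding siegel_compact_def by blast
  obtain V G where V: "open V" "K \<subseteq> V" "G holomorphic_on V" "inj_on G V" "\<forall>\<^sub>F z in nhds 0. G (f1 z) = z" "G ` K = K"
    using K unfolding siegel_compact_def by blast
  have F2: "\<forall>\<^sub>F y in nhds 0. (\<phi> \<circ> F \<circ> \<psi>) y = f2 y"
    using eventually_compose_filterlim [OF U(5) t\<psi>] cj by eventually_elim simp
  have G2: "\<forall>\<^sub>F y in nhds 0. (\<phi> \<circ> G \<circ> \<psi>) (f2 y) = y"
    using eventually_compose_filterlim [OF V(5) t\<psi>] cj fW y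
  proof eventually_elim
    case (elim y)
    have "\<psi> (f2 y) = f1 (\<psi> y)" using elim(2,3) \<psi>(2) by metis
    moreover have "\<phi> (\<psi> y) = y" using elim(4) \<psi>(2) by auto
    ultimately show ?case using elim(1) by simp
  qed
  obtain U2 where U2: "open U2" "\<phi> ` K \<subseteq> U2" "(\<phi> \<circ> F \<circ> \<psi>) holomorphic_on U2" "inj_on (\<phi> \<circ> F \<circ> \<psi>) U2"
    "(\<phi> \<circ> F \<circ> \<psi>) ` (\<phi> ` K) = \<phi> ` K"
    by (rule conjugate_extension [OF W \<psi> U(1-4,6)])
  obtain V2 where V2: "open V2" "\<phi> ` K \<subseteq> V2" "(\<phi> \<circ> G \<circ> \<psi>) holomorphic_on V2" "inj_on (\<phi> \<circ> G \<circ> \<psi>) V2"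
    "(\<phi> \<circ> G \<circ> \<psi>) ` (\<phi> ` K) = \<phi> ` K"
    by (rule conjugate_extension [OF W \<psi> V(1-4,6)])
  have "0 \<in> \<phi> ` K" using K0 \<open>\<phi> 0 = 0\<close> by force
  moreover have "\<phi> ` K \<noteq> {0}"
  proof
    assume "\<phi> ` K = {0}"
    then have "\<phi> x = \<phi> 0" if "x \<in> K" for x using that \<open>\<phi> 0 = 0\<close> by auto
    then have "K = {0}" using inj_onD [OF injK] K0(1) by blast
    then show False using K0(2) by blast
  qed
  moreover have "full_continuum (\<phi> ` K)"
    unfolding full_continuum_def Compl_eq_Diff_UNIV [symmetric]
    using full cont injK univalent_image_full compact_continuous_image connected_continuous_image by blast
  moreover have "\<exists>U F. open U \<and> \<phi> ` K \<subseteq> U \<and> F holomorphic_on U \<and> inj_on F U \<and>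
      (\<forall>\<^sub>F z in nhds 0. F z = f2 z) \<and> F ` \<phi> ` K = \<phi> ` K"
    using U2 F2 by blast
  moreover have "\<exists>U F. open U \<and> \<phi> ` K \<subseteq> U \<and> F holomorphic_on U \<and> inj_on F U \<and>
      (\<forall>\<^sub>F z in nhds 0. F (f2 z) = z) \<and> F ` \<phi> ` K = \<phi> ` K"
    using V2 G2 by blast
  ultimately show ?thesis unfolding siegel_compact_def by blast
qed

text \<open>Pulled back by \<phi>, \<open>f2\<close> becomes a germ \<open>g\<close> with the
  multiplier of \<open>f1\<close> that also preserves \<open>K\<close> near 0; rigidity identifies
  \<open>g\<close> with \<open>f1\<close>.\<close>

lemma common_hedgehog_imp_conjugates:
  assumes f1: "diff_germ f1" "\<not> linearizable f1" "deriv f1 0 = cis (2 * pi * \<alpha>)" "\<alpha> \<notin> \<rat>"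
    and f2: "diff_germ f2" "deriv f1 0 = deriv f2 0" and \<phi>: "diff_germ \<phi>"
    and U: "open U" "K \<subseteq> U" "inj_on \<phi> U"
    and K: "siegel_compact f1 K" "siegel_compact f2 (\<phi> ` K)"
  shows "conjugates \<phi> f1 f2"
proof -
  note a1 = diff_germ_analytic [OF f1(1)] and a2 = diff_germ_analytic [OF f2(1)] and a\<phi> = diff_germ_analytic [OF \<phi>]
  obtain \<psi> where \<psi>: "\<psi> analytic_on {0}" "\<psi> 0 = 0" "deriv \<psi> 0 = inverse (deriv \<phi> 0)"
    "\<forall>\<^sub>F z in nhds 0. \<phi> (\<psi> z) = z" "\<forall>\<^sub>F z in nhds 0. \<psi> (\<phi> z) = z"
    by (rule analytic_local_inverse [OF a\<phi>])
  define g where "g = \<psi> \<circ> (f2 \<circ> \<phi>)"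
  have gan0: "(f2 \<circ> \<phi>) analytic_on {0}" by (rule analytic_on_compose) (use a\<phi> a2 in auto)
  have gan: "g analytic_on {0}"
    unfolding g_def by (rule analytic_on_compose [OF gan0]) (use \<psi> a\<phi> a2 in auto)
  have g0: "g 0 = 0" by (simp add: g_def a\<phi> a2 \<psi>)
  have dg: "deriv g 0 = deriv f1 0"
  proof -
    have "deriv (f2 \<circ> \<phi>) 0 = deriv f2 (\<phi> 0) * deriv \<phi> 0"
      by (rule deriv_chain) (use a\<phi> a2 in \<open>auto intro: analytic_on_imp_differentiable_at\<close>)
    moreover have "deriv g 0 = deriv \<psi> ((f2 \<circ> \<phi>) 0) * deriv (f2 \<circ> \<phi>) 0"
      unfolding g_def by (rule deriv_chain) (use gan0 a\<phi> a2 \<psi> in \<open>auto intro: analytic_on_imp_differentiable_at\<close>)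
    ultimately show ?thesis using a\<phi> a2 \<psi>(3) f2(2) by simp
  qed
  have t\<phi>: "filterlim \<phi> (nhds 0) (nhds 0)" by (rule analytic_at_0_tendsto [OF a\<phi>(1,2)])
  have t2: "filterlim (\<lambda>z. f2 (\<phi> z)) (nhds 0) (nhds 0)"
    by (rule filterlim_compose [OF analytic_at_0_tendsto(1) [OF a2(1,2)] t\<phi>])
  have tg: "filterlim g (nhds 0) (nhds 0)" by (rule analytic_at_0_tendsto [OF gan g0])
  have \<phi>g: "\<forall>\<^sub>F z in nhds 0. \<phi> (g z) = f2 (\<phi> z)"
    using eventually_compose_filterlim [OF \<psi>(4) t2] by eventually_elim (simp add: g_def)
  have K0: "0 \<in> K" "K \<noteq> {0}" and cK: "compact K" "connected K"
    using K(1) unfolding siegel_compact_def full_continuum_def by blast+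
  have inU: "\<forall>\<^sub>F z in nhds 0. z \<in> U" by (rule eventually_nhds_in_open) (use U K0 in auto)
  have invg: "\<forall>\<^sub>F z in nhds 0. g z \<in> K \<longleftrightarrow> z \<in> K"
    using \<phi>g inU eventually_compose_filterlim [OF inU tg]
      eventually_compose_filterlim [OF siegel_compact_locally_invariant [OF K(2)] t\<phi>]
  proof eventually_elim
    case (elim z)
    have "g z \<in> K \<longleftrightarrow> \<phi> (g z) \<in> \<phi> ` K" "z \<in> K \<longleftrightarrow> \<phi> z \<in> \<phi> ` K"
      using inj_on_image_mem_iff [OF U(3) _ U(2)] elim by blast+
    then show ?case using elim by simp
  qed
  have lim: "0 islimpt K"
    by (rule connected_imp_perfect [OF cK(2) K0(1)]) (use K0 in blast)
  have "0 \<notin> interior K"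
    using interior_imp_linearizable [OF K(1) a1(1,2)] f1(2,3) by auto
  then have cl: "0 \<in> closure (- K)" by (simp add: closure_complement)
  have "\<forall>\<^sub>F z in nhds 0. f1 z = g z"
    by (rule invariant_set_rigidity [OF compact_imp_closed [OF cK(1)] a1(1) gan a1(2) g0 f1(3) dg f1(4)
        siegel_compact_locally_invariant [OF K(1)] invg lim cl])
  then show ?thesis
    unfolding conjugates_def using \<phi>g by eventually_elim simp
qed

lemma conjugates_deriv_eq:
  assumes "diff_germ f1" "diff_germ f2" "diff_germ \<phi>" "conjugates \<phi> f1 f2"
  shows "deriv f1 0 = deriv f2 0"
proof -
  note a1 = diff_germ_analytic [OF assms(1)] and a2 = diff_germ_analytic [OF assms(2)] and a\<phi> = diff_germ_analytic [OF assms(3)]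
  have "deriv (\<phi> \<circ> f1) 0 = deriv (f2 \<circ> \<phi>) 0"
    by (rule deriv_cong_ev) (use assms(4) in \<open>simp_all add: conjugates_def\<close>)
  moreover have "deriv (\<phi> \<circ> f1) 0 = deriv \<phi> (f1 0) * deriv f1 0" "deriv (f2 \<circ> \<phi>) 0 = deriv f2 (\<phi> 0) * deriv \<phi> 0"
    by (rule deriv_chain; use a1 a2 a\<phi> in \<open>auto intro: analytic_on_imp_differentiable_at\<close>)+
  ultimately show ?thesis using a1 a2 a\<phi> by simp
qed

lemma conjugates_germ_action:
  assumes f1: "diff_germ f1" and f2: "diff_germ f2" and \<phi>: "diff_germ \<phi>" and conj: "conjugates \<phi> f1 f2"
  shows "germ_action_eq \<phi> (siegel_family f1) (siegel_family f2)"
proof -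
  note a1 = diff_germ_analytic [OF f1] and a2 = diff_germ_analytic [OF f2]
  obtain \<rho> where \<rho>: "\<rho> > 0" "\<phi> holomorphic_on ball 0 \<rho>" "inj_on \<phi> (ball 0 \<rho>)" "\<phi> 0 = 0"
    using \<phi> unfolding diff_germ_def by blast
  let ?W = "\<phi> ` ball 0 \<rho>"
  have opW: "open ?W" by (rule open_mapping_thm3 [OF \<rho>(2) open_ball \<rho>(3)])
  obtain \<psi> where \<psi>: "\<psi> holomorphic_on ?W" "\<And>z. z \<in> ball 0 \<rho> \<Longrightarrow> \<psi> (\<phi> z) = z"
    using holomorphic_has_inverse [OF \<rho>(2) open_ball \<rho>(3)] by metis
  have 0: "0 \<in> ?W" "\<psi> 0 = 0" using \<rho> \<psi>(2) [of 0] by force+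
  have inj\<psi>: "inj_on \<psi> ?W" using \<psi>(2) by (auto intro!: inj_onI)
  obtain \<epsilon> where \<epsilon>: "\<epsilon> > 0" "ball 0 \<epsilon> \<subseteq> ?W" using opW 0(1) open_contains_ball by metis
  \<comment> \<open>A Siegel compact contains 0, so its diameter bounds its distance from 0.\<close>
  have small: "K \<subseteq> ball 0 e" if "siegel_compact f K" "diameter K < e" for f K e
  proof
    fix x assume "x \<in> K"
    have "bounded K" "0 \<in> K" using that(1) compact_imp_bounded unfolding siegel_compact_def full_continuum_def by blast+
    then have "dist 0 x \<le> diameter K" using \<open>x \<in> K\<close> by (intro diameter_bounded_bound) auto
    then show "x \<in> ball 0 e" using that(2) by simp
  qed
  have "\<psi> analytic_on {0}" using \<psi>(1) opW 0 by (metis analytic_at)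
  then have t\<psi>: "filterlim \<psi> (nhds 0) (nhds 0)" using analytic_at_0_tendsto 0 by blast
  have tf: "filterlim (\<lambda>y. f1 (\<psi> y)) (nhds 0) (nhds 0)"
    by (rule filterlim_compose [OF analytic_at_0_tendsto(1) [OF a1(1,2)] t\<psi>])
  have "\<forall>\<^sub>F z in nhds 0. z \<in> ball (0::complex) \<rho>" by (rule eventually_nhds_in_open) (use \<rho> in auto)
  then have "\<forall>\<^sub>F y in nhds 0. f1 (\<psi> y) \<in> ball 0 \<rho>"
    using tf by (rule eventually_compose_filterlim)
  then have conj': "conjugates \<psi> f2 f1"
    unfolding conjugates_def
    using eventually_compose_filterlim [OF conj [unfolded conjugates_def] t\<psi>] eventually_nhds_in_open [OF opW 0(1)]
  proof eventually_elim
    case (elim y)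
    have "\<phi> (\<psi> y) = y" using elim(3) \<psi>(2) by auto
    then have "f2 y = \<phi> (f1 (\<psi> y))" using elim(2) by simp
    then show ?case using \<psi>(2) [OF elim(1)] by simp
  qed
  \<comment> \<open>As representative serve the Siegel compacta inside the disc where \<phi> is
    univalent. That small ones of \<open>f2\<close> arise from them is transport by the inverse
    \<psi>.\<close>
  define \<K> where "\<K> = {K. siegel_compact f1 K \<and> K \<subseteq> ball 0 \<rho>}"
  have "germ_equiv \<K> (siegel_family f1)"
    unfolding germ_equiv_def \<K>_def siegel_family_def using \<rho>(1) small by blast
  moreover have "\<forall>K\<in>\<K>. \<exists>U. open U \<and> K \<subseteq> U \<and> \<phi> holomorphic_on U \<and> inj_on \<phi> U"
    unfolding \<K>_def using \<rho> open_ball by blast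
  moreover have "germ_equiv ((\<lambda>K. \<phi> ` K) ` \<K>) (siegel_family f2)"
    unfolding germ_equiv_def siegel_family_def
  proof (intro exI [of _ \<epsilon>] conjI allI impI iffI \<epsilon>(1))
    fix K assume "K \<in> (\<lambda>K. \<phi> ` K) ` \<K>"
    then show "K \<in> {K. siegel_compact f2 K}"
      unfolding \<K>_def using siegel_compact_transport [OF a1(1,2) open_ball \<rho>(2,3) _ \<rho>(4) conj] by auto
  next
    fix K assume "compact K \<and> diameter K < \<epsilon>" "K \<in> {K. siegel_compact f2 K}"
    then have K: "siegel_compact f2 K" "K \<subseteq> ?W" using small \<epsilon>(2) by blast+
    have "siegel_compact f1 (\<psi> ` K)"
      by (rule siegel_compact_transport [OF a2(1,2) opW \<psi>(1) inj\<psi> K(2) 0(2) conj' K(1)])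
    moreover have "\<psi> ` K \<subseteq> ball 0 \<rho>" using K(2) \<psi>(2) by (auto simp del: mem_ball)
    moreover have "\<phi> ` \<psi> ` K = K"
      by (rule image_left_inverse) (use K(2) \<psi>(2) in \<open>auto simp del: mem_ball\<close>)
    ultimately show "K \<in> (\<lambda>K. \<phi> ` K) ` \<K>" unfolding \<K>_def by (metis (mono_tags, lifting) image_eqI mem_Collect_eq)
  qed
  ultimately show ?thesis unfolding germ_action_eq_def by blast
qed

text \<open>One Siegel compact of \<open>f1\<close> suffices, provided that it and its image are
  small enough for both equalities of germs to apply.\<close>

lemma germ_action_imp_common_hedgehog:
  assumes f1: "diff_germ f1" "deriv f1 0 = cis (2 * pi * \<alpha>)" and \<phi>: "diff_germ \<phi>"
    and act: "germ_action_eq \<phi> (siegel_family f1) (siegel_family f2)"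
  obtains K U where "siegel_compact f1 K" "siegel_compact f2 (\<phi> ` K)" "open U" "K \<subseteq> U"
    "\<phi> holomorphic_on U" "inj_on \<phi> U"
proof -
  note a\<phi> = diff_germ_analytic [OF \<phi>]
  obtain \<K> where \<K>: "germ_equiv \<K> (siegel_family f1)"
    "\<And>K. K \<in> \<K> \<Longrightarrow> \<exists>U. open U \<and> K \<subseteq> U \<and> \<phi> holomorphic_on U \<and> inj_on \<phi> U"
    "germ_equiv ((\<lambda>K. \<phi> ` K) ` \<K>) (siegel_family f2)"
    using act unfolding germ_action_eq_def by blast
  obtain e1 where e1: "e1 > 0" "\<And>K. compact K \<Longrightarrow> diameter K < e1 \<Longrightarrow> siegel_compact f1 K \<Longrightarrow> K \<in> \<K>"
    using \<K>(1) unfolding germ_equiv_def siegel_family_def by blast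
  obtain e2 where e2: "e2 > 0" "\<And>K. compact K \<Longrightarrow> diameter K < e2 \<Longrightarrow> K \<in> (\<lambda>K. \<phi> ` K) ` \<K> \<Longrightarrow> siegel_compact f2 K"
    using \<K>(3) unfolding germ_equiv_def siegel_family_def by blast
  obtain d where d: "d > 0" "\<And>z. norm z < d \<Longrightarrow> norm (\<phi> z) < e2 / 4"
  proof -
    have "isCont \<phi> 0" by (rule analytic_at_0_isCont [OF a\<phi>(1)])
    then obtain d where "d > 0" "\<And>z. norm z < d \<Longrightarrow> norm (\<phi> z - \<phi> 0) < e2 / 4"
      using e2(1) unfolding continuous_at_eps_delta dist_norm by (metis diff_zero divide_pos_pos zero_less_numeral)
    then show thesis using that a\<phi>(2) by simp
  qed
  \<comment> \<open>A disc has diameter twice its radius: a quarter of \<open>e1\<close> and of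
    \<open>e2\<close> as radii keeps both diameters strictly below the thresholds.\<close>
  define \<eta> where "\<eta> = min (d / 2) (e1 / 4)"
  have \<eta>: "\<eta> > 0" "\<eta> < d" "2 * \<eta> < e1" using d e1 by (auto simp: \<eta>_def)
  obtain K where K: "siegel_compact f1 K" "K \<subseteq> cball 0 \<eta>"
    using small_siegel_compact [OF f1 \<eta>(1)] by blast
  have cK: "compact K" using K(1) unfolding siegel_compact_def full_continuum_def by blast
  have "diameter K \<le> diameter (cball (0::complex) \<eta>)" by (rule diameter_subset [OF K(2)]) simp
  then have "diameter K < e1" using \<eta> by simp
  then have "K \<in> \<K>" using e1 cK K(1) by blast
  then obtain U where U: "open U" "K \<subseteq> U" "\<phi> holomorphic_on U" "inj_on \<phi> U" using \<K>(2) by blast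
  have "compact (\<phi> ` K)"
    by (rule compact_continuous_image [OF continuous_on_subset [OF holomorphic_on_imp_continuous_on [OF U(3)] U(2)] cK])
  moreover have "\<phi> ` K \<subseteq> cball 0 (e2 / 4)"
    using d(2) K(2) \<eta>(2) by (force intro: less_imp_le)
  then have "diameter (\<phi> ` K) \<le> diameter (cball (0::complex) (e2 / 4))" by (rule diameter_subset) simp
  then have "diameter (\<phi> ` K) < e2" using e2(1) by simp
  ultimately have "siegel_compact f2 (\<phi> ` K)" using e2(2) \<open>K \<in> \<K>\<close> by blast
  then show thesis using that K(1) U by blast
qed

theorem theorem3p7:
  fixes f1 f2 :: "complex \<Rightarrow> complex" and \<alpha>1 \<alpha>2 :: real
  assumes "diff_germ f1" and "diff_germ f2"
    and "has_rotation_number f1 \<alpha>1" and "\<alpha>1 \<notin> \<rat>"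
    and "has_rotation_number f2 \<alpha>2" and "\<alpha>2 \<notin> \<rat>"
    and "\<not> linearizable f1" and "\<not> linearizable f2"
  shows "(\<forall>\<phi>. diff_germ \<phi> \<longrightarrow>
            (conjugates \<phi> f1 f2 \<longleftrightarrow>
              (deriv f1 0 = deriv f2 0 \<and>
               (\<exists>K1 U. hedgehog f1 K1 \<and> open U \<and> K1 \<subseteq> U \<and> \<phi> holomorphic_on U \<and>
                       inj_on \<phi> U \<and> hedgehog f2 (\<phi> ` K1)))))
       \<and> ((\<exists>\<phi>. diff_germ \<phi> \<and> conjugates \<phi> f1 f2) \<longleftrightarrow>
            (deriv f1 0 = deriv f2 0 \<and>
             (\<exists>\<phi>. diff_germ \<phi> \<and> germ_action_eq \<phi> (siegel_family f1) (siegel_family f2))))"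
proof -
  note a1 = diff_germ_analytic [OF assms(1)] and a2 = diff_germ_analytic [OF assms(2)]
  have d1: "deriv f1 0 = cis (2 * pi * \<alpha>1)"
    using assms(3) by (simp add: has_rotation_number_def cis_conv_exp mult_ac)
  have h1: "hedgehog f1 K \<longleftrightarrow> siegel_compact f1 K" for K
    by (rule hedgehog_iff_siegel_compact [OF a1(1,2) assms(7)])
  have h2: "hedgehog f2 K \<longleftrightarrow> siegel_compact f2 K" for K
    by (rule hedgehog_iff_siegel_compact [OF a2(1,2) assms(8)])
  note conv = common_hedgehog_imp_conjugates [OF assms(1,7) d1 assms(4,2)]
  have forward: "\<exists>K U. siegel_compact f1 K \<and> open U \<and> K \<subseteq> U \<and> \<phi> holomorphic_on U \<and> inj_on \<phi> U \<and> siegel_compact f2 (\<phi> ` K)"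
    if \<phi>: "diff_germ \<phi>" "conjugates \<phi> f1 f2" for \<phi>
  proof -
    obtain \<rho> where \<rho>: "\<rho> > 0" "\<phi> holomorphic_on ball 0 \<rho>" "inj_on \<phi> (ball 0 \<rho>)" "\<phi> 0 = 0"
      using \<phi>(1) unfolding diff_germ_def by blast
    have "\<rho> / 2 > 0" using \<rho>(1) by simp
    then obtain K where K: "siegel_compact f1 K" "K \<subseteq> cball 0 (\<rho> / 2)"
      using small_siegel_compact [OF assms(1) d1] by blast
    then have "K \<subseteq> ball 0 \<rho>" using \<rho>(1) by auto
    moreover from this have "siegel_compact f2 (\<phi> ` K)"
      by (rule siegel_compact_transport [OF a1(1,2) open_ball \<rho>(2,3) _ \<rho>(4) \<phi>(2) K(1)])
    ultimately show ?thesis using K(1) \<rho>(2,3) open_ball by blast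
  qed
  have part1: "conjugates \<phi> f1 f2 \<longleftrightarrow> (deriv f1 0 = deriv f2 0 \<and>
      (\<exists>K1 U. hedgehog f1 K1 \<and> open U \<and> K1 \<subseteq> U \<and> \<phi> holomorphic_on U \<and> inj_on \<phi> U \<and> hedgehog f2 (\<phi> ` K1)))"
    if "diff_germ \<phi>" for \<phi>
    unfolding h1 h2
    using conjugates_deriv_eq [OF assms(1,2) that] forward [OF that] conv [OF _ that] by blast
  have part2: "deriv f1 0 = deriv f2 0 \<Longrightarrow> germ_action_eq \<phi> (siegel_family f1) (siegel_family f2) \<Longrightarrow> conjugates \<phi> f1 f2"
    if \<phi>: "diff_germ \<phi>" for \<phi>
    using germ_action_imp_common_hedgehog [OF assms(1) d1 \<phi>] conv [OF _ \<phi>] by metis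
  show ?thesis
    using part1 part2 conjugates_deriv_eq [OF assms(1,2)] conjugates_germ_action [OF assms(1,2)] by blast
qed

end
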